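(* Let $\mathbf{t}=(\psi_0;(\phi_1,\lambda_1,\psi_1);\dots;(\phi_{r-1},\lambda_{r-1},\psi_{r-1}))$ be a type over $\mathcal{O}_{\mathfrak p}$, of order $r-1\ge 0$, dividing $f(x)$, and let $\phi_r$ be a representative of $\mathbf t$; suppose that $\phi_1,\dots,\phi_r\in A[x]$. Let $1\le s\le\ell(N_r^-(f))$ be an integer, and let $S$ be the side of $N_r^-(f)$ whose projection to the horizontal axis contains $s$ (the left adjacent side if $s$ is the abscissa of a vertex). Let $\lambda_r=-h_r/e_r$ be the slope of $S$ ($h_r,e_r$ positive coprime integers), let $b$ be the abscissa of the right end point of $S$, and put $R_r:=R_{\lambda_r,r}$. Let $Q_s(x)$ be the $s$-th $\phi_r$-quotient of $f(x)$, let $(s,y_s)\in N_r^-(f)$, and $H_s:=(y_s-sV_r)/(e_0\cdots e_{r-1})$. Let $\psi_r\in\mathbb F_r[y]$ be a monic irreducible factor of $R_r(f)$, $f_r:=\deg\psi_r$, and consider the type $\mathbf t':=(\mathbf t;(\phi_r,\lambda_r,\psi_r))$. Let $\mathfrak P\mid\mathfrak p$ be a prime ideal of $B$ such that $\mathbf t'\mid F_{\mathfrak P}$, and suppose that $0\le b-s<e_rf_r$. Then $w_{\mathfrak P}(Q_s(\theta))=H_s$.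
   Context: Global setting. $A$ is a Dedekind domain whose field of fractions $K$ is a global field; $f(x)\in A[x]$ is monic, irreducible and separable of degree $n>1$; $\theta\in K^{\rm sep}$ is a root of $f$; $L=K(\theta)$; $B$ is the integral closure of $A$ in $L$. $\mathfrak p$ is a non-zero prime ideal of $A$, $\pi\in A$ a generator of the maximal ideal of the localization $A_{\mathfrak p}$, $K_{\mathfrak p}$ the completion of $K$ at $\mathfrak p$, $\mathcal{O}_{\mathfrak p}$ its valuation ring. For a prime $\mathfrak P\mid\mathfrak p$ of $B$, $w_{\mathfrak P}:=e(\mathfrak P/\mathfrak p)^{-1}v_{\mathfrak P}$ with $v_{\mathfrak P}$ the normalized discrete valuation of $L$ attached to $\mathfrak P$, and $F_{\mathfrak P}\in\mathcal O_{\mathfrak p}[x]$ is the monic irreducible factor of $f$ over $\mathcal O_{\mathfrak p}$ corresponding to $\mathfrak P$ (the minimal polynomial over $K_{\mathfrak p}$ of the image of $\theta$ in the completion $L_{\mathfrak P}$). Quotients. For a monic $\phi\in A[x]$ of positive degree, the $s$-th $\phi$-quotient $Q_s(x)$ of $f$ is the quotient of the division with remainder of $f(x)$ by $\phi(x)^s$. The $\phi$-expansion of a polynomial $g$ is $g=\sum_{s\ge0}a_s\phi^s$ with $\deg a_s<\deg\phi$. Types. Let $k=K_{\mathfrak p}$, with normalized valuation $v$, valuation ring $\mathcal{O}=\mathcal O_{\mathfrak p}$, uniformizer $\pi$, residue field $\mathbb{F}=\mathbb F_0$. The symbol $\sim$ means equality up to a non-zero constant factor. A type of order $0$ is $\mathbf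 t=(\psi_0)$ with $\psi_0\in\mathbb F[y]$ monic irreducible. Put $e_0=1$, $h_0=V_0=0$, $m_0=1$, $f_0=m_1=\deg\psi_0$, $\mathbb F_1=\mathbb F[y]/(\psi_0)$, $z_0$ = class of $y$; $v_1(g)$ is the minimum of the $v$-values of the coefficients of $g\in k[x]$; $R_0(g)\in\mathbb F[y]$ is the reduction of $g/\pi^{v_1(g)}$. Recursively, a type of order $i\ge1$ is $\mathbf t=(\psi_0;(\phi_1,\lambda_1,\psi_1);\dots;(\phi_i,\lambda_i,\psi_i))$, where dropping the last level gives a type of order $i-1$, $\phi_i$ is a representative of that type of order $i-1$, $\lambda_i=-h_i/e_i$ with $h_i,e_i$ positive coprime integers, and $\psi_i\in\mathbb F_i[y]$ is monic irreducible, $\psi_i\ne y$. A representative of a type of order $i-1$ is a monic $\phi_i\in\mathcal O[x]$ of degree $m_i$ with $R_{i-1}(\phi_i)\sim\psi_{i-1}$. Given a type of order $i-1$ and a representative $\phi_i$: (1) For $0\ne g\in k[x]$ with $\phi_i$-expansion $g=\sum_s a_s\phi_i^s$, $N_i(g)$ is the lower convex hull of the points $(s,v_i(a_s\phi_i^s))$ and $N_i^-(g)$ is its part formed by the sides of negative slope (only the left end point if there are none). The length $\ell(N)$ of a polygon is the abscissa of its right end point. (2) For $\lambda=-h/e<0$ ($h,e$ positive coprime), the $\lambda$-component of a polygon $N$ is $\{(x,y)\in N: y-\lambda x \text{ minimal}\}$. For $s$ in the abscissa range of $N_i^-(g)$ put $c_s=0$ if $(s,v_i(a_s\phi_i^s))$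 lies above $N_i^-(g)$, and $c_s=z_{i-1}^{t_{i-1}(s)}R_{i-1}(a_s)(z_{i-1})\in\mathbb F_i$ if it lies on $N_i^-(g)$, where $t_0(s)=0$ and, for $i>1$, $t_{i-1}(s)=(\sigma-\ell_{i-1}v_i(a_s\phi_i^s))/e_{i-1}$ with $\sigma$ the abscissa of the left end point of the $\lambda_{i-1}$-component of $N_{i-1}(a_s)$. If the $\lambda$-component of $N_i(g)$ has left end abscissa $s_0$ and its projection has length $de$, then $R_{\lambda,i}(g)(y)=\sum_{0\le j\le d}c_{s_0+je}\,y^j\in\mathbb F_i[y]$. (3) Given also $\lambda_i,\psi_i$: $R_i=R_{\lambda_i,i}$, $f_i=\deg\psi_i$, $m_{i+1}=e_if_im_i$, $\mathbb F_{i+1}=\mathbb F_i[y]/(\psi_i)$, $z_i$ = class of $y$, $\ell_i,\ell_i'$ are fixed integers with $\ell_ih_i-\ell_i'e_i=1$, and $v_{i+1}$ is the valuation of $k(x)$ given on polynomials by $v_{i+1}(g)=\min_s\{e_iv_i(a_s\phi_i^s)+sh_i\}$. Put $V_i:=v_i(\phi_i)$. For a type $\mathbf t$ of order $i$, $\operatorname{ord}_{\mathbf t}(g)$ is the exponent of $\psi_i$ in $R_i(g)$, and $\mathbf t\mid g$ means $\operatorname{ord}_{\mathbf t}(g)>0$. *)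

theory Defs
  imports
    "HOL-Algebra.Ideal_Product"
    "HOL-Algebra.Ring_Divisibility"
    "HOL-Algebra.Generated_Fields"
    "HOL-Algebra.Finite_Extensions"
    "HOL-Algebra.Algebraic_Closure_Type"
    "HOL-Library.Extended_Real"
    "HOL-Analysis.Convex"
begin

section \<open>Subrings of a field, and ideals in them\<close>

abbreviation ring_on :: "'a::comm_ring_1 set \<Rightarrow> 'a ring" where
  "ring_on S \<equiv> ring_of_type_algebra\<lparr>carrier := S\<rparr>"

definition polys_over :: "'a::zero set \<Rightarrow> 'a poly set" where
  "polys_over S = {g. \<forall>n. Polynomial.coeff g n \<in> S}"

text \<open>Irreducibility in the ring \<open>S[x]\<close>, for a subring \<open>S\<close>.\<close>

definition irreducible_over :: "'a::comm_ring_1 set \<Rightarrow> 'a poly \<Rightarrow> bool" where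
  "irreducible_over S g \<longleftrightarrow>
     g \<in> polys_over S \<and> g \<noteq> 0 \<and> \<not> (\<exists>u\<in>polys_over S. g * u = 1) \<and>
     (\<forall>a\<in>polys_over S. \<forall>b\<in>polys_over S. g = a * b \<longrightarrow>
        (\<exists>u\<in>polys_over S. a * u = 1) \<or> (\<exists>u\<in>polys_over S. b * u = 1))"

definition integral_closure :: "'a::comm_ring_1 set \<Rightarrow> 'a set \<Rightarrow> 'a set" where
  "integral_closure R S =
     {x\<in>S. \<exists>g\<in>polys_over R. Polynomial.lead_coeff g = 1 \<and> poly g x = 0}"

definition dedekind_domain_of_fractions :: "'a::field set \<Rightarrow> bool" where
  "dedekind_domain_of_fractions A \<longleftrightarrow>
     noetherian_domain (ring_on A) \<and>
     (\<forall>x. \<exists>a\<in>A. \<exists>b\<in>A. b \<noteq> 0 \<and> x = a / b) \<and>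
     integral_closure A UNIV = A \<and>
     (\<forall>I. primeideal I (ring_on A) \<and> I \<noteq> {0} \<longrightarrow> maximalideal I (ring_on A))"

text \<open>The field generated by the empty set is the prime field. A global field is a number field
  or a finite extension of a rational function field in one variable over a prime field
  of positive characteristic (allowing a larger finite constant field gives nothing new).\<close>

definition global_field :: "'a::field itself \<Rightarrow> bool" where
  "global_field TYPE('a) \<longleftrightarrow>
     (let R = (ring_of_type_algebra :: 'a ring) in
       CHAR('a) = 0 \<and> ring.finite_dimension R (generate_field R {}) UNIV \<or>
       CHAR('a) > 0 \<and> (\<exists>t. ring.transcendental R (generate_field R {}) t \<and>
                            ring.finite_dimension R (generate_field R {t}) UNIV))"

primrec ideal_power :: "('a, 'b) ring_scheme \<Rightarrow> 'a set \<Rightarrow> nat \<Rightarrow> 'a set" where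
  "ideal_power R I 0 = carrier R"
| "ideal_power R I (Suc n) = ideal_prod R (ideal_power R I n) I"

text \<open>For \<open>Y\<close> not contained in \<open>{0}\<close> and a Dedekind domain \<open>R\<close> this is the exponent of the
  prime \<open>P\<close> in the factorization of the ideal of \<open>R\<close> generated by \<open>Y\<close>.\<close>

definition ideal_exponent :: "'a::comm_ring_1 set \<Rightarrow> 'a set \<Rightarrow> 'a set \<Rightarrow> nat" where
  "ideal_exponent R P Y = (GREATEST n. Y \<subseteq> ideal_power (ring_on R) P n)"

text \<open>The normalized discrete valuation attached to the prime \<open>P\<close> on the field of fractions
  of \<open>R\<close>. All integer-valued valuations below are meaningful only at non-zero arguments.\<close>

definition prime_val :: "'a::field set \<Rightarrow> 'a set \<Rightarrow> 'a \<Rightarrow> int" where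
  "prime_val R P x =
     (THE k. \<exists>b\<in>R. \<exists>c\<in>R. b \<noteq> 0 \<and> c \<noteq> 0 \<and> x = b / c \<and>
        k = int (ideal_exponent R P {b}) - int (ideal_exponent R P {c}))"

definition scaled_val :: "nat \<Rightarrow> ('a::zero \<Rightarrow> int) \<Rightarrow> 'a \<Rightarrow> ereal" where
  "scaled_val e v x = (if x = 0 then \<infinity> else ereal (of_int (v x) / of_nat e))"

definition localization_at :: "'a::field set \<Rightarrow> 'a set \<Rightarrow> 'a set" where
  "localization_at A p = {a / b | a b. a \<in> A \<and> b \<in> A - p}"

definition generates_max_ideal :: "'a::field set \<Rightarrow> 'a set \<Rightarrow> 'a \<Rightarrow> bool" where
  "generates_max_ideal A p \<pi> \<longleftrightarrow>
     {a / b | a b. a \<in> p \<and> b \<in> A - p} = (\<lambda>x. \<pi> * x) ` localization_at A p"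

section \<open>Completions\<close>

definition val_ge :: "('k::zero \<Rightarrow> int) \<Rightarrow> int \<Rightarrow> 'k \<Rightarrow> bool" where
  "val_ge v N x \<longleftrightarrow> x = 0 \<or> N \<le> v x"

definition discrete_valuation :: "('k::field \<Rightarrow> int) \<Rightarrow> bool" where
  "discrete_valuation v \<longleftrightarrow>
     (\<forall>x y. x \<noteq> 0 \<and> y \<noteq> 0 \<longrightarrow> v (x * y) = v x + v y) \<and>
     (\<forall>x y N. val_ge v N x \<and> val_ge v N y \<longrightarrow> val_ge v N (x + y)) \<and>
     (\<exists>x. x \<noteq> 0 \<and> v x = 1)"

definition complete_valuation :: "('k::field \<Rightarrow> int) \<Rightarrow> bool" where
  "complete_valuation v \<longleftrightarrow>
     (\<forall>Y :: nat \<Rightarrow> 'k.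
        (\<forall>N. \<exists>M. \<forall>m\<ge>M. \<forall>n\<ge>M. val_ge v N (Y m - Y n)) \<longrightarrow>
        (\<exists>x. \<forall>N. \<exists>M. \<forall>n\<ge>M. val_ge v N (Y n - x)))"

text \<open>\<open>'k\<close>, valued by \<open>v\<close>, is a completion (unique up to a unique isomorphism) of the
  subfield \<open>F\<close> valued by \<open>u\<close>, through the embedding \<open>\<iota>\<close>.\<close>

definition is_completion ::
  "'x::field set \<Rightarrow> ('x \<Rightarrow> int) \<Rightarrow> ('x \<Rightarrow> 'k::field) \<Rightarrow> ('k \<Rightarrow> int) \<Rightarrow> bool" where
  "is_completion F u \<iota> v \<longleftrightarrow>
     discrete_valuation v \<and> complete_valuation v \<and>
     \<iota> \<in> ring_hom (ring_on F) ring_of_type_algebra \<and>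
     (\<forall>x\<in>F. x \<noteq> 0 \<longrightarrow> v (\<iota> x) = u x) \<and>
     (\<forall>y N. \<exists>x\<in>F. val_ge v N (y - \<iota> x))"

text \<open>\<open>F\<close> is the minimal polynomial of \<open>\<alpha>\<close> over \<open>'k\<close>, for a field embedding \<open>j\<close>.\<close>

definition is_min_poly :: "('k::field \<Rightarrow> 'l::field) \<Rightarrow> 'l \<Rightarrow> 'k poly \<Rightarrow> bool" where
  "is_min_poly j \<alpha> F \<longleftrightarrow>
     Polynomial.lead_coeff F = 1 \<and> poly (map_poly j F) \<alpha> = 0 \<and>
     (\<forall>g. poly (map_poly j g) \<alpha> = 0 \<longrightarrow> F dvd g)"

section \<open>Polygons\<close>

definition lower_hull :: "(real \<times> real) set \<Rightarrow> (real \<times> real) set" where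
  "lower_hull S = {(x, y) \<in> convex hull S. \<forall>y'. (x, y') \<in> convex hull S \<longrightarrow> y \<le> y'}"

definition left_abscissa :: "(real \<times> real) set \<Rightarrow> real" where
  "left_abscissa N = Inf (fst ` N)"

definition right_abscissa :: "(real \<times> real) set \<Rightarrow> real" where
  "right_abscissa N = Sup (fst ` N)"

definition component :: "real \<Rightarrow> (real \<times> real) set \<Rightarrow> (real \<times> real) set" where
  "component \<mu> N = {(x, y) \<in> N. \<forall>(x', y') \<in> N. y - \<mu> * x \<le> y' - \<mu> * x'}"

definition is_side :: "(real \<times> real) set \<Rightarrow> real \<Rightarrow> (real \<times> real) set \<Rightarrow> bool" where
  "is_side N \<mu> S \<longleftrightarrow> S = component \<mu> N \<and> left_abscissa S < right_abscissa S"

definition negative_part :: "(real \<times> real) set \<Rightarrow> (real \<times> real) set" where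
  "negative_part N = {q \<in> N. fst q = left_abscissa N} \<union> \<Union>{S. \<exists>\<mu><0. is_side N \<mu> S}"

section \<open>Types\<close>

text \<open>The \<open>s\<close>-th coefficient of the \<open>\<phi>\<close>-expansion.\<close>

definition expansion_coeff :: "'k::field poly \<Rightarrow> 'k poly \<Rightarrow> nat \<Rightarrow> 'k poly" where
  "expansion_coeff \<phi> g s = (g div \<phi> ^ s) mod \<phi>"

lemma expansion_coeff_sum:
  "g = (\<Sum>s<n. expansion_coeff \<phi> g s * \<phi> ^ s) + (g div \<phi> ^ n) * \<phi> ^ n"
proof (induction n)
  case (Suc n)
  have "g div \<phi> ^ Suc n = (g div \<phi> ^ n) div \<phi>"
    by (metis power_Suc2 poly_div_mult_right)
  then have "g div \<phi> ^ n = (g div \<phi> ^ Suc n) * \<phi> + expansion_coeff \<phi> g n"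
    by (simp add: expansion_coeff_def)
  then have "(g div \<phi> ^ n) * \<phi> ^ n
      = expansion_coeff \<phi> g n * \<phi> ^ n + (g div \<phi> ^ Suc n) * \<phi> ^ Suc n"
    by (metis (no_types, lifting) add.commute distrib_right mult.assoc power_Suc)
  with Suc show ?case by (simp add: add.assoc)
qed simp

lemma expansion_coeff_degree:
  assumes "Polynomial.degree \<phi> > 0"
  shows "Polynomial.degree (expansion_coeff \<phi> g s) < Polynomial.degree \<phi>"
  using assms degree_mod_less'[of \<phi> "g div \<phi> ^ s"]
  by (cases "\<phi> = 0"; cases "expansion_coeff \<phi> g s = 0") (auto simp: expansion_coeff_def)

text \<open>
  The data over which types are formed: a field \<open>'k\<close> with valuation \<open>val0\<close> and uniformizer
  \<open>unif\<close>, and a reduction map \<open>red\<close> from the valuation ring into a field \<open>'e\<close>. The residue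
  field \<open>F\<^sub>0\<close> is the image of \<open>red\<close>, and \<open>'e\<close> is a common overfield for the tower
  \<open>F\<^sub>0 \<subseteq> F\<^sub>1 \<subseteq> \<dots>\<close>: the extension \<open>F\<^sub>i[y]/(\<psi>\<^sub>i)\<close> is realized inside \<open>'e\<close> as
  \<open>F\<^sub>i[z\<^sub>i]\<close> for a root \<open>z\<^sub>i\<close> of \<open>\<psi>\<^sub>i\<close>. The roots \<open>zc i\<close> and the
  Bezout coefficients \<open>ell i\<close>, \<open>ell' i\<close> are arbitrary choices, fixed once and for all.
\<close>

record ('k, 'e) type_data =
  val0 :: "'k \<Rightarrow> int"
  unif :: 'k
  red :: "'k \<Rightarrow> 'e"
  zc :: "nat \<Rightarrow> 'e"
  ell :: "nat \<Rightarrow> int"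
  ell' :: "nat \<Rightarrow> int"

definition valuation_ring :: "('k::zero \<Rightarrow> int) \<Rightarrow> 'k set" where
  "valuation_ring v = {x. val_ge v 0 x}"

definition reduction_map :: "('k::field \<Rightarrow> int) \<Rightarrow> ('k \<Rightarrow> 'e::field) \<Rightarrow> bool" where
  "reduction_map v r \<longleftrightarrow>
     r \<in> ring_hom (ring_on (valuation_ring v)) ring_of_type_algebra \<and>
     (\<forall>x\<in>valuation_ring v. r x = 0 \<longleftrightarrow> val_ge v 1 x)"

text \<open>Tuples representing types; \<open>is_type\<close> below singles out the actual types.
  \<open>Type0 \<psi>\<^sub>0\<close> is \<open>(\<psi>\<^sub>0)\<close>, and \<open>Extend t \<phi> h e \<psi>\<close> is \<open>(t; (\<phi>, -h/e, \<psi>))\<close>.\<close>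

datatype ('p, 'q) om_tuple =
  Type0 'q
| Extend "('p, 'q) om_tuple" 'p nat nat 'q

type_synonym ('k, 'e) om_type = "('k poly, 'e poly) om_tuple"

primrec type_order :: "('k::zero, 'e::zero) om_type \<Rightarrow> nat" where
  "type_order (Type0 \<psi>) = 0"
| "type_order (Extend t \<phi> h e \<psi>) = Suc (type_order t)"

primrec type_psi :: "('k::zero, 'e::zero) om_type \<Rightarrow> 'e poly" where
  "type_psi (Type0 \<psi>) = \<psi>"
| "type_psi (Extend t \<phi> h e \<psi>) = \<psi>"

primrec type_phis :: "('k::zero, 'e::zero) om_type \<Rightarrow> 'k poly set" where
  "type_phis (Type0 \<psi>) = {}"
| "type_phis (Extend t \<phi> h e \<psi>) = insert \<phi> (type_phis t)"

text \<open>For a type of order \<open>i\<close>: the product \<open>e\<^sub>0 \<cdots> e\<^sub>i\<close>, the degree \<open>m\<^bsub>i+1\<^esub>\<close>,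
  the field \<open>F\<^bsub>i+1\<^esub>\<close>, and the valuation \<open>v\<^bsub>i+1\<^esub>\<close>.\<close>

primrec type_eprod :: "('k::zero, 'e::zero) om_type \<Rightarrow> nat" where
  "type_eprod (Type0 \<psi>) = 1"
| "type_eprod (Extend t \<phi> h e \<psi>) = type_eprod t * e"

primrec type_deg :: "('k::zero, 'e::zero) om_type \<Rightarrow> nat" where
  "type_deg (Type0 \<psi>) = Polynomial.degree \<psi>"
| "type_deg (Extend t \<phi> h e \<psi>) = e * Polynomial.degree \<psi> * type_deg t"

primrec type_field :: "('k::field, 'e::field) type_data \<Rightarrow> ('k, 'e) om_type \<Rightarrow> 'e set" where
  "type_field D (Type0 \<psi>) =
     {poly g (zc D 0) | g. g \<in> polys_over (red D ` valuation_ring (val0 D))}"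
| "type_field D (Extend t \<phi> h e \<psi>) =
     {poly g (zc D (Suc (type_order t))) | g. g \<in> polys_over (type_field D t)}"

primrec type_val :: "('k::field, 'e::field) type_data \<Rightarrow> ('k, 'e) om_type \<Rightarrow> 'k poly \<Rightarrow> int" where
  "type_val D (Type0 \<psi>) = (\<lambda>g.
     Min {val0 D (Polynomial.coeff g n) | n. Polynomial.coeff g n \<noteq> 0})"
| "type_val D (Extend t \<phi> h e \<psi>) = (\<lambda>g.
     Min {int e * type_val D t (expansion_coeff \<phi> g s * \<phi> ^ s) + int s * int h | s.
          expansion_coeff \<phi> g s \<noteq> 0})"

text \<open>The polygon \<open>N\<^sub>i\<close> and the polynomial \<open>R\<^bsub>\<lambda>,i\<^esub>\<close> depend on a type \<open>t\<close> of order \<open>i - 1\<close>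
  and a representative \<open>\<phi>\<close> of it; \<open>\<lambda> = -h/e\<close>.\<close>

definition newton_polygon ::
  "('k::field, 'e::field) type_data \<Rightarrow> ('k, 'e) om_type \<Rightarrow> 'k poly \<Rightarrow> 'k poly \<Rightarrow> (real \<times> real) set"
where
  "newton_polygon D t \<phi> g =
     lower_hull {(real s, of_int (type_val D t (expansion_coeff \<phi> g s * \<phi> ^ s))) | s.
                 expansion_coeff \<phi> g s \<noteq> 0}"

abbreviation neg_newton_polygon where
  "neg_newton_polygon D t \<phi> g \<equiv> negative_part (newton_polygon D t \<phi> g)"

definition slope :: "nat \<Rightarrow> nat \<Rightarrow> real" where
  "slope h e = - (real h / real e)"

text \<open>The exponent \<open>t\<^bsub>i-1\<^esub>(s)\<close>; the division is exact.\<close>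

fun twist_exponent ::
  "('k::field, 'e::field) type_data \<Rightarrow> ('k, 'e) om_type \<Rightarrow> 'k poly \<Rightarrow> 'k poly \<Rightarrow> nat \<Rightarrow> int"
where
  "twist_exponent D (Type0 \<psi>) \<phi> g s = 0"
| "twist_exponent D (Extend t \<phi>' h' e' \<psi>') \<phi> g s =
     (\<lfloor>left_abscissa (component (slope h' e')
          (newton_polygon D t \<phi>' (expansion_coeff \<phi> g s)))\<rfloor>
      - ell D (Suc (type_order t)) *
        type_val D (Extend t \<phi>' h' e' \<psi>') (expansion_coeff \<phi> g s * \<phi> ^ s)) div int e'"

text \<open>In the next two definitions \<open>R\<close> stands for \<open>R\<^bsub>i-1\<^esub>\<close>, to be instantiated with the residual
  polynomial operator of \<open>t\<close> itself.\<close>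

definition residual_coeff ::
  "('k::field, 'e::field) type_data \<Rightarrow> ('k, 'e) om_type \<Rightarrow> ('k poly \<Rightarrow> 'e poly) \<Rightarrow>
   'k poly \<Rightarrow> 'k poly \<Rightarrow> nat \<Rightarrow> 'e"
where
  "residual_coeff D t R \<phi> g s =
     (let a = expansion_coeff \<phi> g s; z = zc D (type_order t) in
      if a \<noteq> 0 \<and> (real s, of_int (type_val D t (a * \<phi> ^ s))) \<in> neg_newton_polygon D t \<phi> g
      then z powi (twist_exponent D t \<phi> g s) * poly (R a) z
      else 0)"

definition slope_residual ::
  "('k::field, 'e::field) type_data \<Rightarrow> ('k, 'e) om_type \<Rightarrow> ('k poly \<Rightarrow> 'e poly) \<Rightarrow>
   'k poly \<Rightarrow> nat \<Rightarrow> nat \<Rightarrow> 'k poly \<Rightarrow> 'e poly"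
where
  "slope_residual D t R \<phi> h e g =
     (let S = component (slope h e) (newton_polygon D t \<phi> g);
          s0 = nat \<lfloor>left_abscissa S\<rfloor>;
          d = nat \<lfloor>(right_abscissa S - left_abscissa S) / real e\<rfloor>
      in \<Sum>j\<le>d. Polynomial.monom (residual_coeff D t R \<phi> g (s0 + j * e)) j)"

text \<open>\<open>R\<^sub>i\<close>, for a type of order \<open>i\<close>.\<close>

primrec type_residual ::
  "('k::field, 'e::field) type_data \<Rightarrow> ('k, 'e) om_type \<Rightarrow> 'k poly \<Rightarrow> 'e poly"
where
  "type_residual D (Type0 \<psi>) = (\<lambda>g.
     map_poly (red D) (Polynomial.smult (unif D powi (- type_val D (Type0 \<psi>) g)) g))"
| "type_residual D (Extend t \<phi> h e \<psi>) = slope_residual D t (type_residual D t) \<phi> h e"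

definition is_representative ::
  "('k::field, 'e::field) type_data \<Rightarrow> ('k, 'e) om_type \<Rightarrow> 'k poly \<Rightarrow> bool"
where
  "is_representative D t \<phi> \<longleftrightarrow>
     Polynomial.lead_coeff \<phi> = 1 \<and> \<phi> \<in> polys_over (valuation_ring (val0 D)) \<and>
     Polynomial.degree \<phi> = type_deg t \<and>
     (\<exists>c. c \<noteq> 0 \<and> type_residual D t \<phi> = Polynomial.smult c (type_psi t))"

primrec is_type :: "('k::field, 'e::field) type_data \<Rightarrow> ('k, 'e) om_type \<Rightarrow> bool" where
  "is_type D (Type0 \<psi>) \<longleftrightarrow>
     Polynomial.lead_coeff \<psi> = 1 \<and>
     irreducible_over (red D ` valuation_ring (val0 D)) \<psi> \<and>
     poly \<psi> (zc D 0) = 0"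
| "is_type D (Extend t \<phi> h e \<psi>) \<longleftrightarrow>
     is_type D t \<and> is_representative D t \<phi> \<and> h > 0 \<and> e > 0 \<and> coprime h e \<and>
     Polynomial.lead_coeff \<psi> = 1 \<and> irreducible_over (type_field D t) \<psi> \<and> \<psi> \<noteq> [:0, 1:] \<and>
     poly \<psi> (zc D (Suc (type_order t))) = 0 \<and>
     ell D (Suc (type_order t)) * int h - ell' D (Suc (type_order t)) * int e = 1"

text \<open>Divisibility by the monic \<open>\<psi>\<^sub>i\<close> does not change between \<open>F\<^sub>i[y]\<close> and \<open>'e[y]\<close>.\<close>

definition type_ord ::
  "('k::field, 'e::field) type_data \<Rightarrow> ('k, 'e) om_type \<Rightarrow> 'k poly \<Rightarrow> nat"
where
  "type_ord D t g = (GREATEST n. type_psi t ^ n dvd type_residual D t g)"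

definition type_dvd ::
  "('k::field, 'e::field) type_data \<Rightarrow> ('k, 'e) om_type \<Rightarrow> 'k poly \<Rightarrow> bool"
where
  "type_dvd D t g \<longleftrightarrow> type_ord D t g > 0"

end

theory Submission
  imports Defs
begin

text \<open>
  Let \<open>\<mu>\<close> be the valuation of \<open>'k[x]\<close> attached to \<open>(t; (\<phi>, -h/e, \<psi>))\<close>, and \<open>\<alpha>\<close> the root of \<open>F\<close> that
  is the image of \<open>\<theta>\<close>. The core is a criterion for \<open>w(g(\<alpha>)) = \<mu>(g)\<close> (up to scaling): no power of \<open>g\<close> is
  congruent modulo \<open>F\<close> to a polynomial of larger \<open>\<mu>\<close>-value. Under this hypothesis
  \<open>g \<mapsto> sup\<^sub>q \<mu>(g + q F)\<close> is a norm on the finite extension \<open>'k[x]/(F)\<close> of the complete field \<open>'k\<close>, hence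
  equivalent to \<open>w\<close>; comparing both on \<open>g\<^sup>n\<close> for large \<open>n\<close> gives the equality.

  The criterion holds whenever the residual polynomial of \<open>F\<close> is divisible by \<open>\<psi>\<close> and that of \<open>g\<close> is
  not, because residual polynomials are multiplicative. The \<open>\<phi>\<close>-expansion of the quotient
  \<open>Q\<^sub>s\<close> is that of \<open>f\<close> shifted by \<open>s\<close>, so the residual polynomial of \<open>Q\<^sub>s\<close> has degree at most
  \<open>(b - s)/e < deg \<psi>\<close>, and \<open>\<mu>(Q\<^sub>s)\<close> is read off the side \<open>S\<close>.
\<close>

section \<open>Polynomials over a subfield\<close>

text \<open>The obstacle is the twist by powers of \<open>z\<close> in the coefficients of residual
  polynomials, which hides their multiplicativity. An invariant (\<open>regular\<close>) is
  therefore carried from order to order: every type has a valuation of \<open>'k[x]\<close> together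
  with a residue map into \<open>type_field\<close>, multiplicative, and additive in each fixed
  degree of the valuation, which kills representatives but no non-zero polynomial of smaller degree.
  Such a map turns \<open>\<phi>\<close>-expansions into initial forms that multiply like ordinary
  polynomials; a residual polynomial is an initial form with a power of \<open>y\<close> split off
  and \<open>y^e\<close> replaced by \<open>y\<close>. The twist is exactly what makes the residue
  map of the next order multiplicative: it stands for a power of an \<open>e\<close>-th root of
  \<open>z\<close>, taken in an algebraic closure.

  Two facts are hidden behind definitions by ideals and have to be extracted separately: the
  uniformizer has value 1, and the ramification index \<open>ram\<close> is positive.\<close>

definition is_subfield :: "'a::field set \<Rightarrow> bool" where
  "is_subfield F \<longleftrightarrow> 0 \<in> F \<and> 1 \<in> F \<and>
     (\<forall>x\<in>F. \<forall>y\<in>F. x - y \<in> F \<and> x * y \<in> F) \<and> (\<forall>x\<in>F. inverse x \<in> F)"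

context
  fixes F :: "'a::field set"
  assumes F: "is_subfield F"
begin

lemma subfield_0: "0 \<in> F" and subfield_1: "1 \<in> F"
  and subfield_diff: "x \<in> F \<Longrightarrow> y \<in> F \<Longrightarrow> x - y \<in> F"
  and subfield_mult: "x \<in> F \<Longrightarrow> y \<in> F \<Longrightarrow> x * y \<in> F"
  and subfield_inverse: "x \<in> F \<Longrightarrow> inverse x \<in> F"
  using F by (auto simp: is_subfield_def)

lemma subfield_uminus: "x \<in> F \<Longrightarrow> - x \<in> F"
  using subfield_diff[OF subfield_0] by simp

lemma subfield_add: "x \<in> F \<Longrightarrow> y \<in> F \<Longrightarrow> x + y \<in> F"
  using subfield_diff[of x "- y"] subfield_uminus by simp

lemma subfield_power: "x \<in> F \<Longrightarrow> x ^ n \<in> F"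
  by (induction n) (auto intro: subfield_1 subfield_mult)

lemma subfield_powi: "x \<in> F \<Longrightarrow> x powi n \<in> F"
  by (auto simp: power_int_def intro: subfield_power subfield_inverse)

lemma subfield_sum: "(\<And>i. i \<in> I \<Longrightarrow> f i \<in> F) \<Longrightarrow> sum f I \<in> F"
  by (induction I rule: infinite_finite_induct) (auto intro: subfield_0 subfield_add)

lemma polys_over_0: "0 \<in> polys_over F" and polys_over_1: "1 \<in> polys_over F"
  by (auto simp: polys_over_def subfield_0 subfield_1 Polynomial.coeff_1)

lemma polys_over_const: "c \<in> F \<Longrightarrow> [:c:] \<in> polys_over F"
  by (auto simp: polys_over_def subfield_0 Polynomial.coeff_pCons split: nat.split)

lemma polys_over_diff: "g \<in> polys_over F \<Longrightarrow> h \<in> polys_over F \<Longrightarrow> g - h \<in> polys_over F"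
  by (auto simp: polys_over_def subfield_diff)

lemma polys_over_add: "g \<in> polys_over F \<Longrightarrow> h \<in> polys_over F \<Longrightarrow> g + h \<in> polys_over F"
  by (auto simp: polys_over_def subfield_add)

lemma polys_over_mult: "g \<in> polys_over F \<Longrightarrow> h \<in> polys_over F \<Longrightarrow> g * h \<in> polys_over F"
  by (auto simp: polys_over_def Polynomial.coeff_mult intro!: subfield_sum subfield_mult)

lemma polys_over_monom: "c \<in> F \<Longrightarrow> Polynomial.monom c n \<in> polys_over F"
  by (auto simp: polys_over_def subfield_0)

lemma polys_over_X: "[:0, 1:] \<in> polys_over F"
  by (auto simp: polys_over_def Polynomial.coeff_pCons subfield_0 subfield_1 split: nat.split)

text \<open>Here \<open>F\<close> is a subset of the field \<open>'a\<close>, and division over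
  \<open>'a\<close> by itself says nothing about where coefficients lie; long division keeps them in
  \<open>F\<close> because the leading coefficient of \<open>\<psi>\<close> is inverted inside
  \<open>F\<close>.\<close>

lemma polys_over_division:
  assumes "g \<in> polys_over F" "\<psi> \<in> polys_over F" "\<psi> \<noteq> 0"
  shows "\<exists>q\<in>polys_over F. \<exists>r\<in>polys_over F.
    g = q * \<psi> + r \<and> (r = 0 \<or> Polynomial.degree r < Polynomial.degree \<psi>)"
  using assms(1)
proof (induction "Polynomial.degree g" arbitrary: g rule: less_induct)
  case (less g)
  let ?n = "Polynomial.degree g" and ?m = "Polynomial.degree \<psi>"
  show ?case
  proof (cases "g = 0 \<or> ?n < ?m")
    case True
    with less.prems show ?thesis
      by (intro bexI[of _ 0] bexI[of _ g]) (auto intro: polys_over_0)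
  next
    case False
    then have g0: "g \<noteq> 0" and nm: "?m \<le> ?n" by auto
    define c where "c = Polynomial.lead_coeff g / Polynomial.lead_coeff \<psi>"
    define u where "u = Polynomial.monom c (?n - ?m)"
    have cF: "c \<in> F"
      using less.prems assms(2) unfolding c_def divide_inverse polys_over_def
      by (auto intro!: subfield_mult subfield_inverse)
    have c0: "c \<noteq> 0" using g0 assms(3) by (simp add: c_def)
    have uF: "u \<in> polys_over F" using cF by (simp add: u_def polys_over_monom)
    define g' where "g' = g - u * \<psi>"
    have g'F: "g' \<in> polys_over F"
      unfolding g'_def by (intro polys_over_diff polys_over_mult less.prems uF assms)
    have du: "Polynomial.degree (u * \<psi>) = ?n"
      using Polynomial.degree_mult_eq[of u \<psi>] Polynomial.degree_monom_eq[OF c0, of "?n - ?m"] c0 assms(3) nm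
      unfolding u_def by simp
    have "Polynomial.lead_coeff (u * \<psi>) = c * Polynomial.lead_coeff \<psi>"
      using Polynomial.degree_monom_eq[OF c0, of "?n - ?m"] by (simp only: Polynomial.lead_coeff_mult u_def Polynomial.coeff_monom if_True simp_thms)
    then have cn: "Polynomial.coeff g' ?n = 0"
      using du assms(3) by (simp add: g'_def c_def)
    have dle: "Polynomial.degree g' \<le> ?n"
      unfolding g'_def using du by (intro Polynomial.degree_diff_le) auto
    have "g' = 0 \<or> Polynomial.degree g' < ?n"
      using cn dle by (metis le_neq_implies_less Polynomial.leading_coeff_0_iff)
    then obtain q r where qr: "q \<in> polys_over F" "r \<in> polys_over F" "g' = q * \<psi> + r"
      "r = 0 \<or> Polynomial.degree r < ?m"
    proof
      assume "g' = 0" then show ?thesis using that[of 0 0] polys_over_0 by auto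
    qed (use less.hyps[OF _ g'F] that in blast)
    have "g = (q + u) * \<psi> + r" using qr(3) unfolding g'_def by (simp add: algebra_simps)
    with qr uF show ?thesis by (intro bexI[of _ "q + u"] bexI[of _ r]) (auto intro: polys_over_add)
  qed
qed

text \<open>Euclidean descent on the degree of \<open>a\<close>: a long \<open>a\<close> is reduced
  modulo \<open>\<psi>\<close>, a short one is used to reduce \<open>\<psi>\<close>. Divisibility is
  meant over the ambient field, while the cofactors stay over \<open>F\<close>; this mixture is what
  makes irreducibility over \<open>F\<close> usable at roots lying outside \<open>F\<close>.\<close>

lemma irreducible_over_bezout:
  assumes \<psi>: "irreducible_over F \<psi>" and a: "a \<in> polys_over F" "\<not> \<psi> dvd a"
  shows "\<exists>u\<in>polys_over F. \<exists>v\<in>polys_over F. u * \<psi> + v * a = 1"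
  using a
proof (induction "Polynomial.degree a" arbitrary: a rule: less_induct)
  case (less a)
  note irr = \<psi>[unfolded irreducible_over_def]
  have \<psi>F: "\<psi> \<in> polys_over F" and \<psi>0: "\<psi> \<noteq> 0" using irr by auto
  have a0: "a \<noteq> 0" using less.prems by auto
  consider "Polynomial.degree a = 0" | "Polynomial.degree \<psi> \<le> Polynomial.degree a"
    | "Polynomial.degree a > 0" "Polynomial.degree a < Polynomial.degree \<psi>" by linarith
  then show ?case
  proof cases
    case 1
    then obtain c where c: "a = [:c:]" by (auto elim: Polynomial.degree_eq_zeroE)
    have "c \<in> F" using less.prems(1) c unfolding polys_over_def by (auto dest: spec[of _ 0])
    moreover have "c \<noteq> 0" using a0 c by simp
    ultimately show ?thesis using c
      by (intro bexI[of _ 0] bexI[of _ "[:inverse c:]"])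
        (auto intro!: polys_over_0 polys_over_const subfield_inverse)
  next
    case 2
    obtain q r where qr: "q \<in> polys_over F" "r \<in> polys_over F" "a = q * \<psi> + r"
      "r = 0 \<or> Polynomial.degree r < Polynomial.degree \<psi>"
      using polys_over_division[OF less.prems(1) \<psi>F \<psi>0] by blast
    have nd: "\<not> \<psi> dvd r" using less.prems(2) qr(3) by auto
    then have "Polynomial.degree r < Polynomial.degree a" using qr(4) 2 by auto
    from less.hyps[OF this qr(2) nd] obtain u v where uv: "u \<in> polys_over F" "v \<in> polys_over F"
      "u * \<psi> + v * r = 1" by blast
    have "(u - v * q) * \<psi> + v * a = 1" using uv(3) qr(3) by (simp add: algebra_simps)
    with uv qr show ?thesis by (blast intro: polys_over_diff polys_over_mult)
  next
    case 3
    obtain q r where qr: "q \<in> polys_over F" "r \<in> polys_over F" "\<psi> = q * a + r"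
      "r = 0 \<or> Polynomial.degree r < Polynomial.degree a"
      using polys_over_division[OF \<psi>F less.prems(1) a0] by blast
    \<comment> \<open>A zero remainder would give \<open>\<psi> = q * a\<close>: if \<open>q\<close>
      is a unit then \<open>\<psi>\<close> divides \<open>a\<close>, and if \<open>a\<close> is a
      unit its degree is 0.\<close>
    have r0: "r \<noteq> 0"
    proof
      assume "r = 0"
      with qr have e: "\<psi> = q * a" by simp
      with irr qr(1) less.prems(1) consider u where "q * u = 1" | u where "a * u = 1" by blast
      then show False
      proof cases
        case 1
        then have "a = \<psi> * u" using e by (metis mult.assoc mult.commute mult.left_neutral)
        then show False using less.prems(2) by auto
      next
        case 2
        then have "Polynomial.degree a = 0"
          using a0 dvdI[of 1 a u] by (simp add: Polynomial.is_unit_iff_degree)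
        with 3 show False by simp
      qed
    qed
    then have dr: "Polynomial.degree r < Polynomial.degree a" using qr(4) by auto
    have nd: "\<not> \<psi> dvd r"
      using r0 dr 3 by (meson Polynomial.dvd_imp_degree_le leD less_trans)
    from less.hyps[OF dr qr(2) nd] obtain u v where uv: "u \<in> polys_over F" "v \<in> polys_over F"
      "u * \<psi> + v * r = 1" by blast
    have "(u + v) * \<psi> + (- (v * q)) * a = 1" using uv(3) qr(3) by (simp add: algebra_simps)
    moreover have "- (v * q) \<in> polys_over F"
      using polys_over_diff[OF polys_over_0 polys_over_mult[OF uv(2) qr(1)]] by simp
    ultimately show ?thesis using uv by (blast intro: polys_over_add)
  qed
qed

lemma irreducible_over_dvd_mult:
  assumes \<psi>: "irreducible_over F \<psi>" and a: "a \<in> polys_over F" and d: "\<psi> dvd a * b"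
  shows "\<psi> dvd a \<or> \<psi> dvd b"
proof (rule disjCI)
  assume nb: "\<not> \<psi> dvd b"
  show "\<psi> dvd a"
  proof (rule ccontr)
    assume "\<not> \<psi> dvd a"
    then obtain u v where "u * \<psi> + v * a = 1" using irreducible_over_bezout[OF \<psi> a] by blast
    then have "b = (u * \<psi> + v * a) * b" by simp
    then have "b = (u * b) * \<psi> + v * (a * b)"
      by (simp add: algebra_simps)
    with d have "\<psi> dvd b" by (metis dvd_add dvd_mult dvd_triv_right)
    with nb show False by simp
  qed
qed

lemma irreducible_over_root_dvd:
  assumes \<psi>: "irreducible_over F \<psi>" and a: "a \<in> polys_over F"
    and "poly \<psi> z = 0" "poly a z = 0"
  shows "\<psi> dvd a"
proof (rule ccontr)
  assume "\<not> \<psi> dvd a"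
  then obtain u v where "u * \<psi> + v * a = 1" using irreducible_over_bezout[OF \<psi> a] by blast
  then have "poly (u * \<psi> + v * a) z = 1" by simp
  with assms show False by simp
qed

text \<open>Inverses come from evaluating a Bezout identity at \<open>z\<close>, where the multiple
  of \<open>\<psi>\<close> vanishes.\<close>

lemma is_subfield_adjoin:
  assumes \<psi>: "irreducible_over F \<psi>" and z: "poly \<psi> z = 0"
  shows "is_subfield {poly g z | g. g \<in> polys_over F}"
  unfolding is_subfield_def
proof (intro conjI ballI)
  let ?E = "{poly g z | g. g \<in> polys_over F}"
  show "0 \<in> ?E" "1 \<in> ?E" using polys_over_0 polys_over_1 by force+
  fix x assume "x \<in> ?E"
  then obtain g where g: "g \<in> polys_over F" "x = poly g z" by auto
  show "inverse x \<in> ?E"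
  proof (cases "x = 0")
    case False
    then have "\<not> \<psi> dvd g" using g(2) z by (auto elim: dvdE)
    then obtain u v where uv: "v \<in> polys_over F" "u * \<psi> + v * g = 1"
      using irreducible_over_bezout[OF \<psi> g(1)] by blast
    from uv(2) have "poly (u * \<psi> + v * g) z = 1" by simp
    then have "poly v z * x = 1" using z g by simp
    then have "inverse x = poly v z" using inverse_unique[of x "poly v z"] by (simp add: mult.commute)
    with uv(1) show ?thesis by blast
  qed (use \<open>0 \<in> ?E\<close> in simp)
  fix y assume "y \<in> ?E"
  then obtain h where h: "h \<in> polys_over F" "y = poly h z" by auto
  from g h have "x - y = poly (g - h) z" "x * y = poly (g * h) z" by simp_all
  then show "x - y \<in> ?E" "x * y \<in> ?E" using g h polys_over_diff polys_over_mult by blast+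
qed

end

lemma irreducible_over_degree_pos:
  assumes "irreducible_over F \<psi>" "is_subfield F"
  shows "Polynomial.degree \<psi> > 0"
proof (rule ccontr)
  assume "\<not> ?thesis"
  then obtain c where c: "\<psi> = [:c:]" by (auto elim: Polynomial.degree_eq_zeroE)
  have "c \<in> F" "c \<noteq> 0" using assms c unfolding irreducible_over_def polys_over_def
    by (auto dest: spec[of _ 0])
  then have "\<psi> * [:inverse c:] = 1" "[:inverse c:] \<in> polys_over F"
    using c assms(2) by (auto intro: polys_over_const subfield_inverse)
  then show False using assms(1) unfolding irreducible_over_def by blast
qed

lemma is_subfield_UNIV: "is_subfield UNIV"
  by (simp add: is_subfield_def)

section \<open>Valuations\<close>

text \<open>Meant for domains such as \<open>'k[x]\<close>, hence without normalization. The integer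
  at 0 is meaningless, so the ultrametric law is phrased through \<open>val_ge\<close>, which treats
  0 as having infinite value.\<close>

definition is_valuation :: "('a::idom \<Rightarrow> int) \<Rightarrow> bool" where
  "is_valuation v \<longleftrightarrow> (\<forall>x y. x \<noteq> 0 \<and> y \<noteq> 0 \<longrightarrow> v (x * y) = v x + v y) \<and>
     (\<forall>x y N. val_ge v N x \<and> val_ge v N y \<longrightarrow> val_ge v N (x + y))"

lemma discrete_valuation_is_valuation: "discrete_valuation v \<Longrightarrow> is_valuation v"
  by (auto simp: discrete_valuation_def is_valuation_def)

lemma val_ge_0 [simp]: "val_ge v N 0"
  by (simp add: val_ge_def)

lemma val_ge_mono: "val_ge v N x \<Longrightarrow> M \<le> N \<Longrightarrow> val_ge v M x"
  by (auto simp: val_ge_def)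

lemma val_ge_self: "val_ge v (v x) x"
  by (simp add: val_ge_def)

context
  fixes v :: "'a::idom \<Rightarrow> int"
  assumes v: "is_valuation v"
begin

lemma valuation_mult: "x \<noteq> 0 \<Longrightarrow> y \<noteq> 0 \<Longrightarrow> v (x * y) = v x + v y"
  using v by (simp add: is_valuation_def)

lemma val_ge_add: "val_ge v N x \<Longrightarrow> val_ge v N y \<Longrightarrow> val_ge v N (x + y)"
  using v by (simp add: is_valuation_def)

lemma val_ge_mult: "val_ge v N x \<Longrightarrow> val_ge v M y \<Longrightarrow> val_ge v (N + M) (x * y)"
  by (cases "x = 0"; cases "y = 0") (auto simp: val_ge_def valuation_mult)

lemma valuation_1: "v 1 = 0"
  using valuation_mult[of 1 1] by simp

lemma valuation_minus_1: "v (- 1) = 0"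
  using valuation_mult[of "-1" "-1"] valuation_1 by simp

lemma valuation_minus: "v (- x) = v x"
  using valuation_mult[of "-1" x] valuation_minus_1 by (cases "x = 0") simp_all

lemma val_ge_minus: "val_ge v N (- x) \<longleftrightarrow> val_ge v N x"
  by (simp add: val_ge_def valuation_minus)

lemma val_ge_diff: "val_ge v N x \<Longrightarrow> val_ge v N y \<Longrightarrow> val_ge v N (x - y)"
  using val_ge_add[of N x "- y"] by (simp add: val_ge_minus)

lemma val_ge_sum: "(\<And>i. i \<in> I \<Longrightarrow> val_ge v N (f i)) \<Longrightarrow> val_ge v N (sum f I)"
  by (induction I rule: infinite_finite_induct) (auto intro: val_ge_add)

lemma valuation_power: "x \<noteq> 0 \<Longrightarrow> v (x ^ n) = int n * v x"
  by (induction n) (simp_all add: valuation_1 valuation_mult algebra_simps)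

end

lemma valuation_inverse:
  fixes v :: "'a::field \<Rightarrow> int"
  assumes "is_valuation v" "x \<noteq> 0"
  shows "v (inverse x) = - v x"
  using valuation_mult[OF assms(1), of x "inverse x"] assms valuation_1[OF assms(1)] by simp

lemma valuation_powi:
  fixes v :: "'a::field \<Rightarrow> int"
  assumes "is_valuation v" "x \<noteq> 0"
  shows "v (x powi n) = n * v x"
  using assms by (auto simp: power_int_def valuation_power valuation_inverse)

section \<open>Norms on a finite extension of a complete field\<close>

text \<open>\<open>G n a\<close> says that a norm on \<open>'k[x]/(F)\<close>, written additively, is at least \<open>n\<close> at \<open>a\<close>.\<close>

locale quotient_norm =
  fixes v :: "'k::field \<Rightarrow> int" and C :: int and F :: "'k poly" and G :: "int \<Rightarrow> 'k poly \<Rightarrow> bool"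
  assumes val: "discrete_valuation v" and complete: "complete_valuation v" and C: "C > 0"
    and G_add: "\<And>n a b. G n a \<Longrightarrow> G n b \<Longrightarrow> G n (a + b)"
    and G_smult: "\<And>n a c. G n a \<Longrightarrow> c \<noteq> 0 \<Longrightarrow> G (n + C * v c) (Polynomial.smult c a)"
    and G_mono: "\<And>n m a. G n a \<Longrightarrow> m \<le> n \<Longrightarrow> G m a"
    and G_0: "\<And>n. G n 0"
    and G_separated: "\<And>a. (\<And>n. G n a) \<Longrightarrow> F dvd a"
    and G_bounded: "\<And>a. \<exists>n. G n a"
begin

lemmas val' = discrete_valuation_is_valuation[OF val]

lemma G_sum: "(\<And>i. i \<in> I \<Longrightarrow> G n (f i)) \<Longrightarrow> G n (sum f I)"
  by (induction I rule: infinite_finite_induct) (auto intro: G_add G_0)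

lemma G_minus: "G n a \<Longrightarrow> G n (- a)"
  using G_smult[of n a "-1"] by (simp add: valuation_minus_1[OF val'])

lemma G_diff: "G n a \<Longrightarrow> G n b \<Longrightarrow> G n (a - b)"
  using G_add[of n a "- b"] G_minus by simp

text \<open>The easy half of the equivalence of norms: \<open>g\<close> is a combination of
  \<open>d\<close> monomials, each with some lower bound, and \<open>B\<close> absorbs all these
  bounds.\<close>

lemma G_ge_coeffs:
  "\<exists>B. \<forall>n g. (\<forall>i\<ge>d. Polynomial.coeff g i = 0) \<longrightarrow>
     (\<forall>i. Polynomial.coeff g i \<noteq> 0 \<longrightarrow> n \<le> C * v (Polynomial.coeff g i)) \<longrightarrow> G (n - B) g"
proof -
  obtain b where b: "\<And>i. G (b i) (Polynomial.monom 1 i)"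
    using G_bounded[of "Polynomial.monom 1 _"] by metis
  define B where "B = (\<Sum>i<d. \<bar>b i\<bar>)"
  have bB: "- B \<le> b i" if "i < d" for i
    using member_le_sum[of i "{..<d}" "\<lambda>i. \<bar>b i\<bar>"] that unfolding B_def by simp
  have "G (n - B) g" if g: "\<forall>i\<ge>d. Polynomial.coeff g i = 0"
    "\<forall>i. Polynomial.coeff g i \<noteq> 0 \<longrightarrow> n \<le> C * v (Polynomial.coeff g i)" for n g
  proof -
    have *: "G (n - B) (Polynomial.smult (Polynomial.coeff g i) (Polynomial.monom 1 i))" if "i < d" for i
    proof (cases "Polynomial.coeff g i = 0")
      case False
      from g(2) False have "n \<le> C * v (Polynomial.coeff g i)" by blast
      with bB[OF that] have "n - B \<le> b i + C * v (Polynomial.coeff g i)" by linarith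
      with G_smult[OF b False] show ?thesis by (rule G_mono)
    qed (simp add: G_0)
    have "g = (\<Sum>i<d. Polynomial.smult (Polynomial.coeff g i) (Polynomial.monom 1 i))"
      using g(1) by (intro poly_eqI) (auto simp: Polynomial.coeff_sum Polynomial.smult_monom not_less)
    moreover have "G (n - B) (\<Sum>i<d. Polynomial.smult (Polynomial.coeff g i) (Polynomial.monom 1 i))"
      by (rule G_sum) (use * in simp)
    ultimately show ?thesis by simp
  qed
  then show ?thesis by blast
qed

text \<open>The polynomials of degree below \<open>d\<close> form a complete, hence closed, subspace
  by the hypothesis \<open>IH\<close>, so \<open>x^d\<close> keeps a positive distance from it.
  Otherwise polynomials \<open>x^d + \<gamma>\<close> of arbitrarily large \<open>G\<close>-value
  converge coefficientwise to a monic polynomial of degree \<open>d\<close> that \<open>F\<close>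
  would have to divide.\<close>

lemma monic_bounded:
  assumes d: "d < Polynomial.degree F"
    and IH: "\<And>n g i. \<forall>i\<ge>d. Polynomial.coeff g i = 0 \<Longrightarrow> G n g \<Longrightarrow> Polynomial.coeff g i \<noteq> 0
       \<Longrightarrow> n - B0 \<le> C * v (Polynomial.coeff g i)"
  shows "\<exists>T. \<forall>n g. (\<forall>i\<ge>d. Polynomial.coeff g i = 0) \<longrightarrow> G n (Polynomial.monom 1 d + g) \<longrightarrow> n \<le> T"
proof (rule ccontr)
  assume "\<not> ?thesis"
  then have ex: "\<exists>g. (\<forall>i\<ge>d. Polynomial.coeff g i = 0) \<and> G (int m) (Polynomial.monom 1 d + g)" for m
    by (meson G_mono linorder_le_cases)
  then obtain \<gamma> where \<gamma>: "\<And>m i. i \<ge> d \<Longrightarrow> Polynomial.coeff (\<gamma> m) i = 0"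
    "\<And>m. G (int m) (Polynomial.monom 1 d + \<gamma> m)" by metis
  have cauchy: "\<exists>M. \<forall>m\<ge>M. \<forall>n\<ge>M. val_ge v N (Polynomial.coeff (\<gamma> m) i - Polynomial.coeff (\<gamma> n) i)" for i N
  proof (intro exI allI impI)
    define M where "M = nat (C * N + B0)"
    fix m n assume mn: "M \<le> m" "M \<le> n"
    have "G (int M) ((Polynomial.monom 1 d + \<gamma> m) - (Polynomial.monom 1 d + \<gamma> n))"
      using \<gamma>(2)[of m] \<gamma>(2)[of n] mn by (intro G_diff) (auto elim!: G_mono)
    then have G: "G (int M) (\<gamma> m - \<gamma> n)" by simp
    show "val_ge v N (Polynomial.coeff (\<gamma> m) i - Polynomial.coeff (\<gamma> n) i)"
    proof (cases "Polynomial.coeff (\<gamma> m - \<gamma> n) i = 0")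
      case False
      have "int M - B0 \<le> C * v (Polynomial.coeff (\<gamma> m - \<gamma> n) i)"
        using \<gamma>(1) False by (intro IH[OF _ G]) auto
      then have "C * N \<le> C * v (Polynomial.coeff (\<gamma> m - \<gamma> n) i)"
        unfolding M_def by linarith
      with C show ?thesis by (simp add: val_ge_def)
    qed simp
  qed
  have "\<exists>x. \<forall>N. \<forall>\<^sub>F m in sequentially. val_ge v N (Polynomial.coeff (\<gamma> m) i - x)" for i
    using complete cauchy[of _ i] unfolding complete_valuation_def eventually_sequentially by simp
  then obtain c where c: "\<And>i N. \<forall>\<^sub>F m in sequentially. val_ge v N (Polynomial.coeff (\<gamma> m) i - c i)"
    by metis
  define g where "g = (\<Sum>i<d. Polynomial.monom (c i) i)"
  have cg: "Polynomial.coeff g i = (if i < d then c i else 0)" for i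
    by (simp add: g_def Polynomial.coeff_sum)
  obtain B where B: "\<And>n g. \<forall>i\<ge>d. Polynomial.coeff g i = 0 \<Longrightarrow>
     \<forall>i. Polynomial.coeff g i \<noteq> 0 \<longrightarrow> n \<le> C * v (Polynomial.coeff g i) \<Longrightarrow> G (n - B) g"
    using G_ge_coeffs[of d] by blast
  have "G n (Polynomial.monom 1 d + g)" for n
  proof -
    have "\<forall>\<^sub>F m in sequentially. \<forall>i\<in>{..<d}. val_ge v \<bar>n + B\<bar> (Polynomial.coeff (\<gamma> m) i - c i)"
      using c by (intro eventually_ball_finite) auto
    with eventually_ge_at_top[of "nat n"]
    have "\<forall>\<^sub>F m in sequentially. m \<ge> nat n \<and>
      (\<forall>i\<in>{..<d}. val_ge v \<bar>n + B\<bar> (Polynomial.coeff (\<gamma> m) i - c i))"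
      by (rule eventually_conj)
    then obtain m where m: "m \<ge> nat n"
      "\<And>i. i < d \<Longrightarrow> val_ge v \<bar>n + B\<bar> (Polynomial.coeff (\<gamma> m) i - c i)"
      by (auto simp: eventually_sequentially)
    have "G (n + B - B) (\<gamma> m - g)"
    proof (rule B)
      show "\<forall>i\<ge>d. Polynomial.coeff (\<gamma> m - g) i = 0" using \<gamma>(1) cg by simp
      show "\<forall>i. Polynomial.coeff (\<gamma> m - g) i \<noteq> 0 \<longrightarrow> n + B \<le> C * v (Polynomial.coeff (\<gamma> m - g) i)"
      proof (intro allI impI)
        fix i assume nz: "Polynomial.coeff (\<gamma> m - g) i \<noteq> 0"
        then have "i < d" using \<gamma>(1) cg by (cases "i < d") auto
        with m(2)[of i] nz have "\<bar>n + B\<bar> \<le> v (Polynomial.coeff (\<gamma> m - g) i)"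
          by (simp add: val_ge_def cg)
        also from this C have "\<dots> \<le> C * v (Polynomial.coeff (\<gamma> m - g) i)"
          by (intro mult_le_cancel_right1[THEN iffD2]) auto
        finally show "n + B \<le> C * v (Polynomial.coeff (\<gamma> m - g) i)" by linarith
      qed
    qed
    moreover have "G n (Polynomial.monom 1 d + \<gamma> m)" by (rule G_mono[OF \<gamma>(2)[of m]]) (use m(1) in linarith)
    ultimately show ?thesis using G_diff[of n "Polynomial.monom 1 d + \<gamma> m" "\<gamma> m - g"] by simp
  qed
  then have dvd: "F dvd Polynomial.monom 1 d + g" by (rule G_separated)
  have "Polynomial.coeff (Polynomial.monom 1 d + g) d = 1" by (simp add: cg)
  then have "Polynomial.monom 1 d + g \<noteq> 0" by (metis Polynomial.coeff_0 zero_neq_one)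
  with dvd have "Polynomial.degree F \<le> Polynomial.degree (Polynomial.monom 1 d + g)"
    by (rule Polynomial.dvd_imp_degree_le)
  also have "\<dots> \<le> d" by (rule Polynomial.degree_le) (simp add: cg)
  finally show False using d by simp
qed

text \<open>One coordinate is added at a time. Dividing by the coefficient \<open>a\<close> of
  \<open>x^d\<close> makes the polynomial monic, and \<open>monic_bounded\<close> then bounds
  \<open>v a\<close>; after subtracting \<open>a x^d\<close> the induction hypothesis handles the
  remaining coefficients.\<close>

lemma coeffs_ge_G:
  assumes "d \<le> Polynomial.degree F"
  shows "\<exists>B. \<forall>n g i. (\<forall>i\<ge>d. Polynomial.coeff g i = 0) \<longrightarrow> G n g \<longrightarrow> Polynomial.coeff g i \<noteq> 0
       \<longrightarrow> n - B \<le> C * v (Polynomial.coeff g i)"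
  using assms
proof (induction d)
  case 0
  then show ?case by simp
next
  case (Suc d)
  then obtain B0 where B0: "\<And>n g i. \<forall>i\<ge>d. Polynomial.coeff g i = 0 \<Longrightarrow> G n g \<Longrightarrow> Polynomial.coeff g i \<noteq> 0
       \<Longrightarrow> n - B0 \<le> C * v (Polynomial.coeff g i)" by (meson Suc_leD)
  obtain T where T: "\<And>n g. \<forall>i\<ge>d. Polynomial.coeff g i = 0 \<Longrightarrow>
      G n (Polynomial.monom 1 d + g) \<Longrightarrow> n \<le> T"
  proof -
    have "d < Polynomial.degree F" using Suc.prems by simp
    from monic_bounded[OF this B0] show ?thesis using that by blast
  qed
  obtain Y where Y: "G Y (Polynomial.monom 1 d)" using G_bounded by blast
  \<comment> \<open>\<open>T\<close> is the loss for the coefficient of \<open>x^d\<close>,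
    \<open>T - Y\<close> the loss from subtracting that term, and \<open>B0\<close> the loss in
    lower degrees.\<close>
  define B where "B = abs T + abs Y + abs (T - Y) + abs B0"
  have "n - B \<le> C * v (Polynomial.coeff g i)"
    if g: "\<forall>i\<ge>Suc d. Polynomial.coeff g i = 0" "G n g" "Polynomial.coeff g i \<noteq> 0" for n g i
  proof (cases "Polynomial.coeff g d = 0")
    case True
    then have "\<forall>i\<ge>d. Polynomial.coeff g i = 0" using g(1) by (metis le_neq_implies_less Suc_leI)
    from B0[OF this g(2,3)] show ?thesis unfolding B_def by linarith
  next
    case False
    define a where "a = Polynomial.coeff g d"
    have a: "a \<noteq> 0" using False a_def by simp
    define g0 where "g0 = g - Polynomial.smult a (Polynomial.monom 1 d)"
    have g0: "\<forall>i\<ge>d. Polynomial.coeff g0 i = 0"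
      using g(1) by (auto simp: g0_def a_def not_less_eq_eq[symmetric] dest: le_neq_implies_less)
    have "G (n + C * v (inverse a)) (Polynomial.smult (inverse a) g)"
      using g(2) a by (intro G_smult) auto
    also have "Polynomial.smult (inverse a) g = Polynomial.monom 1 d + Polynomial.smult (inverse a) g0"
      using a by (simp add: g0_def Polynomial.smult_diff_right)
    finally have "n + C * v (inverse a) \<le> T" using g0 by (intro T) auto
    then have na: "n - T \<le> C * v a" using valuation_inverse[OF val' a] by simp
    have "G (n - T + Y) (Polynomial.smult a (Polynomial.monom 1 d))"
      using G_smult[OF Y a] by (rule G_mono) (use na in linarith)
    with g(2) have G0: "G (n - abs (T - Y)) g0"
      unfolding g0_def by (intro G_diff) (auto elim!: G_mono)
    show ?thesis
    proof (cases "i = d")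
      case True
      with na show ?thesis unfolding B_def a_def by simp
    next
      case False
      then have "Polynomial.coeff g0 i = Polynomial.coeff g i" by (simp add: g0_def)
      with B0[OF g0 G0, of i] g(3) have "n - abs (T - Y) - B0 \<le> C * v (Polynomial.coeff g i)" by simp
      then show ?thesis unfolding B_def by linarith
    qed
  qed
  then show ?case by blast
qed

end

lemma quotient_norms_equivalent:
  assumes "quotient_norm v C F G" "quotient_norm v C F G'"
  shows "\<exists>B. \<forall>n g. Polynomial.degree g < Polynomial.degree F \<longrightarrow> G n g \<longrightarrow> G' (n - B) g"
proof -
  obtain B where B: "\<And>n g i. \<forall>i\<ge>Polynomial.degree F. Polynomial.coeff g i = 0 \<Longrightarrow> G n g \<Longrightarrow>
      Polynomial.coeff g i \<noteq> 0 \<Longrightarrow> n - B \<le> C * v (Polynomial.coeff g i)"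
    using quotient_norm.coeffs_ge_G[OF assms(1) order_refl] by blast
  obtain B' where B': "\<And>n g. \<forall>i\<ge>Polynomial.degree F. Polynomial.coeff g i = 0 \<Longrightarrow>
     \<forall>i. Polynomial.coeff g i \<noteq> 0 \<longrightarrow> n \<le> C * v (Polynomial.coeff g i) \<Longrightarrow> G' (n - B') g"
    using quotient_norm.G_ge_coeffs[OF assms(2), of "Polynomial.degree F"] by blast
  have "G' (n - (B + B')) g" if "Polynomial.degree g < Polynomial.degree F" "G n g" for n g
  proof -
    have *: "\<forall>i\<ge>Polynomial.degree F. Polynomial.coeff g i = 0"
      using that(1) by (auto intro: Polynomial.coeff_eq_0)
    show ?thesis using B'[OF *, of "n - B"] B[OF * that(2)] by (simp add: algebra_simps)
  qed
  then show ?thesis by blast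
qed

theorem spectral_comparison:
  fixes v :: "'k::field \<Rightarrow> int" and \<mu> w :: "'k poly \<Rightarrow> int" and E ram :: int
  assumes v: "discrete_valuation v" "complete_valuation v"
    and \<mu>: "is_valuation \<mu>" "\<And>c. c \<noteq> 0 \<Longrightarrow> \<mu> [:c:] = E * v c" and E: "E > 0"
    and irr: "irreducible_over UNIV F"
    and w_mult: "\<And>a b. \<not> F dvd a \<Longrightarrow> \<not> F dvd b \<Longrightarrow> w (a * b) = w a + w b"
    and w_add: "\<And>a b n. F dvd a \<or> n \<le> w a \<Longrightarrow> F dvd b \<or> n \<le> w b \<Longrightarrow> F dvd a + b \<or> n \<le> w (a + b)"
    and w_const: "\<And>c. c \<noteq> 0 \<Longrightarrow> w [:c:] = ram * v c" and ram: "ram > 0"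
    and g: "g \<noteq> 0" "\<And>n q. \<not> val_ge \<mu> (int n * \<mu> g + 1) (g ^ n - q * F)"
  shows "\<not> F dvd g" "ram * \<mu> g = E * w g"
proof -
  have prime: "F dvd a * b \<Longrightarrow> F dvd a \<or> F dvd b" for a b
    using irreducible_over_dvd_mult[OF is_subfield_UNIV irr, of a b] by (simp add: polys_over_def)
  have degF: "Polynomial.degree F > 0"
    using irreducible_over_degree_pos[OF irr is_subfield_UNIV] .
  have nconst: "\<not> F dvd [:c:]" if "c \<noteq> 0" for c
    using Polynomial.dvd_imp_degree_le[of F "[:c:]"] that degF by auto
  have C: "E * ram > 0" using E ram by simp
  \<comment> \<open>\<open>w\<close> is scaled by \<open>E\<close> and \<open>\<mu>\<close> by
    \<open>ram\<close>, so that both norms induce \<open>E * ram * v\<close> on constants.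
    Predicates replace functions because the supremum in the quotient norm is not known beforehand
    to be finite.\<close>
  define G1 where "G1 = (\<lambda>n a. F dvd a \<or> n \<le> E * w a)"
  define G2 where "G2 = (\<lambda>n a. \<exists>q. a + q * F = 0 \<or> n \<le> ram * \<mu> (a + q * F))"
  \<comment> \<open>\<open>- ((- n) div K)\<close> is \<open>n / K\<close> rounded up. A bound on a
    multiple thus becomes a bound on the value itself, to which the ultrametric law applies.\<close>
  have scale: "n \<le> K * x \<longleftrightarrow> - ((- n) div K) \<le> x" if "K > 0" for n K x :: int
  proof -
    have "- ((- n) div K) \<le> x \<longleftrightarrow> - x \<le> (- n) div K" by linarith
    also have "\<dots> \<longleftrightarrow> - x * K \<le> - n"
    proof
      assume "- x \<le> - n div K"
      then have "- x * K \<le> - n div K * K" using that by (intro mult_right_mono) auto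
      also have "\<dots> \<le> - n" using that pos_mod_sign[of K "- n"] div_mult_mod_eq[of "- n" K] by linarith
      finally show "- x * K \<le> - n" .
    next
      assume "- x * K \<le> - n"
      from zdiv_mono1[OF this that] that show "- x \<le> - n div K"
        using nonzero_mult_div_cancel_right[of K "- x"] by simp
    qed
    finally show ?thesis by (simp add: algebra_simps)
  qed
  have G1_alt: "G1 n a \<longleftrightarrow> F dvd a \<or> - ((- n) div E) \<le> w a" for n a
    using scale[OF E] by (simp add: G1_def)
  have G2_alt: "G2 n a \<longleftrightarrow> (\<exists>q. val_ge \<mu> (- ((- n) div ram)) (a + q * F))" for n a
    using scale[OF ram] by (simp add: G2_def val_ge_def)
  interpret N1: quotient_norm v "E * ram" F G1
  proof
    show "discrete_valuation v" "complete_valuation v" "E * ram > 0" by fact+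
    show "G1 n (a + b)" if "G1 n a" "G1 n b" for n a b
      using that w_add unfolding G1_alt by blast
    show "G1 (n + E * ram * v c) (Polynomial.smult c a)" if "G1 n a" "c \<noteq> 0" for n a c
    proof (cases "F dvd a")
      case False
      have "w (Polynomial.smult c a) = ram * v c + w a"
        using w_mult[OF nconst[OF that(2)] False] w_const[OF that(2)] by simp
      then show ?thesis using that False by (simp add: G1_def algebra_simps)
    qed (simp add: G1_def dvd_smult)
    show "G1 m a" if "G1 n a" "m \<le> n" for n m a using that by (auto simp: G1_def)
    show "G1 n 0" for n by (simp add: G1_def)
    show "F dvd a" if "\<And>n. G1 n a" for a
      using that[of "E * w a + 1"] by (simp add: G1_def)
    show "\<exists>n. G1 n a" for a by (auto simp: G1_def)
  qed
  have G2_add: "G2 n (a + b)" if ab: "G2 n a" "G2 n b" for n a b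
  proof -
    from ab obtain q q' where "val_ge \<mu> (- ((- n) div ram)) (a + q * F)"
      "val_ge \<mu> (- ((- n) div ram)) (b + q' * F)" unfolding G2_alt by blast
    from val_ge_add[OF \<mu>(1) this]
    have "val_ge \<mu> (- ((- n) div ram)) (a + b + (q + q') * F)" by (simp add: algebra_simps)
    then show ?thesis unfolding G2_alt by blast
  qed
  have G2_mult: "G2 (n + ram * \<mu> b) (b * a)" if a: "G2 n a" "b \<noteq> 0" for n a b
  proof -
    from a obtain q where q: "a + q * F = 0 \<or> n \<le> ram * \<mu> (a + q * F)" unfolding G2_def by blast
    have e: "b * a + (b * q) * F = b * (a + q * F)" by (simp add: algebra_simps)
    have "b * a + (b * q) * F = 0 \<or> n + ram * \<mu> b \<le> ram * \<mu> (b * a + (b * q) * F)"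
      unfolding e
    proof (cases "a + q * F = 0")
      case False
      with q have "n \<le> ram * \<mu> (a + q * F)" by simp
      then show "b * (a + q * F) = 0 \<or> n + ram * \<mu> b \<le> ram * \<mu> (b * (a + q * F))"
        using valuation_mult[OF \<mu>(1) a(2) False] by (simp add: distrib_left)
    qed simp
    then show ?thesis unfolding G2_def by blast
  qed
  have G2_F: "G2 n (a * F)" for n a unfolding G2_def by (intro exI[of _ "- a"]) simp
  interpret N2: quotient_norm v "E * ram" F G2
  proof
    show "discrete_valuation v" "complete_valuation v" "E * ram > 0" by fact+
    show "G2 n (a + b)" if "G2 n a" "G2 n b" for n a b using G2_add that .
    show "G2 (n + E * ram * v c) (Polynomial.smult c a)" if "G2 n a" "c \<noteq> 0" for n a c
      using G2_mult[OF that(1), of "[:c:]"] that(2) \<mu>(2)[OF that(2)] by (simp add: ac_simps)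
    show "G2 m a" if "G2 n a" "m \<le> n" for n m a
      using that unfolding G2_def by (meson order_trans)
    show "G2 n 0" for n unfolding G2_def by (intro exI[of _ 0]) simp
    show "\<exists>n. G2 n a" for a unfolding G2_def by blast
    \<comment> \<open>If \<open>F\<close> did not divide \<open>a\<close>, a Bezout identity would
      transfer the large norm of \<open>a\<close> to 1; the hypothesis on \<open>g ^ n\<close> at
      \<open>n = 0\<close> forbids this.\<close>
    show "F dvd a" if a: "\<And>n. G2 n a" for a
    proof (rule ccontr)
      assume "\<not> F dvd a"
      then obtain u b where ub: "u * F + b * a = 1"
        using irreducible_over_bezout[OF is_subfield_UNIV irr, of a] by (auto simp: polys_over_def)
      have "G2 1 (b * a)"
      proof (cases "b = 0")
        case True then show ?thesis using G2_F[of 1 0] by simp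
      next
        case False
        from G2_mult[OF a[of "1 - ram * \<mu> b"] False] show ?thesis by simp
      qed
      with G2_add[OF G2_F[of 1 u] this] ub have "G2 1 1" by simp
      then obtain q where "1 + q * F = 0 \<or> 1 \<le> ram * \<mu> (1 + q * F)" unfolding G2_def by blast
      moreover have "1 \<le> x" if "1 \<le> ram * x" for x
        using that ram by (metis int_one_le_iff_zero_less zero_less_mult_pos)
      ultimately have "val_ge \<mu> 1 (1 + q * F)" by (auto simp: val_ge_def)
      with g(2)[of 0 "- q"] show False by simp
    qed
  qed
  show nd: "\<not> F dvd g"
  proof
    assume "F dvd g"
    then obtain q where "g = q * F" by (metis dvdE mult.commute)
    with g(2)[of 1 q] show False by simp
  qed
  have ndn: "\<not> F dvd g ^ n" for n
    using nd nconst[of 1] by (induction n) (auto dest: prime)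
  have wn: "w (g ^ n) = int n * w g" for n
  proof (induction n)
    case 0
    show ?case using w_const[of 1] valuation_1[OF discrete_valuation_is_valuation[OF v(1)]]
      by (simp flip: one_pCons)
  next
    case (Suc n)
    then show ?case using w_mult[OF nd ndn[of n]] by (simp add: algebra_simps)
  qed
  have mod1: "G1 n (a mod F) \<longleftrightarrow> G1 n a" for n a
  proof -
    have r: "G1 n (b * F)" for b by (simp add: G1_def)
    show ?thesis
    proof
      assume "G1 n (a mod F)"
      from N1.G_add[OF r this, of "a div F"] show "G1 n a" by simp
    next
      assume "G1 n a"
      from N1.G_diff[OF this r[of "a div F"]] show "G1 n (a mod F)" by (simp add: minus_div_mult_eq_mod)
    qed
  qed
  have mod2: "G2 n (a mod F) \<longleftrightarrow> G2 n a" for n a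
  proof -
    show ?thesis
    proof
      assume "G2 n (a mod F)"
      from N2.G_add[OF G2_F this, of "a div F"] show "G2 n a" by simp
    next
      assume "G2 n a"
      from N2.G_diff[OF this G2_F[of n "a div F"]] show "G2 n (a mod F)" by (simp add: minus_div_mult_eq_mod)
    qed
  qed
  have dm: "Polynomial.degree (a mod F) < Polynomial.degree F" for a
    using degF Polynomial.degree_mod_less'[of F a] by (cases "a mod F = 0"; cases "F = 0") auto
  obtain B1 where B1': "\<And>n a. Polynomial.degree a < Polynomial.degree F \<Longrightarrow> G1 n a \<Longrightarrow> G2 (n - B1) a"
    using quotient_norms_equivalent[OF N1.quotient_norm_axioms N2.quotient_norm_axioms] by blast
  have B1: "G2 (n - B1) a" if "G1 n a" for n a
    using B1'[OF dm, of n a] that unfolding mod1 mod2 .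
  obtain B2 where B2': "\<And>n a. Polynomial.degree a < Polynomial.degree F \<Longrightarrow> G2 n a \<Longrightarrow> G1 (n - B2) a"
    using quotient_norms_equivalent[OF N2.quotient_norm_axioms N1.quotient_norm_axioms] by blast
  have B2: "G1 (n - B2) a" if "G2 n a" for n a
    using B2'[OF dm, of n a] that unfolding mod1 mod2 .
  show "ram * \<mu> g = E * w g"
  proof (rule antisym)
    show "ram * \<mu> g \<le> E * w g"
    proof (rule ccontr)
      assume "\<not> ?thesis"
      then have lt: "ram * \<mu> g \<ge> E * w g + 1" by simp
      \<comment> \<open>A gap of at least 1 between the two scaled values is multiplied by
        \<open>n\<close> on \<open>g ^ n\<close>, whereas the loss stays \<open>B2\<close>; so any
        \<open>n\<close> beyond \<open>B2\<close> is contradictory.\<close>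
      define n where "n = nat (\<bar>B2\<bar> + 1)"
      have "G2 (int n * (ram * \<mu> g)) (g ^ n)"
        unfolding G2_def using valuation_power[OF \<mu>(1) g(1)] by (intro exI[of _ 0]) (simp add: algebra_simps)
      from B2[OF this] have "int n * (ram * \<mu> g) - B2 \<le> E * (int n * w g)"
        using ndn[of n] by (simp add: G1_def wn)
      moreover have "int n * (ram * \<mu> g) \<ge> int n * (E * w g + 1)" using lt by (intro mult_left_mono) auto
      ultimately have "int n \<le> B2" by (simp add: algebra_simps)
      then show False by (simp add: n_def)
    qed
    show "E * w g \<le> ram * \<mu> g"
    proof (rule ccontr)
      assume "\<not> ?thesis"
      then have lt: "E * w g \<ge> ram * \<mu> g + 1" by simp
      define n where "n = nat (\<bar>B1\<bar> + 1)"
      have "G1 (int n * (E * w g)) (g ^ n)" by (simp add: G1_def wn algebra_simps)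
      from B1[OF this] obtain q where
        q: "g ^ n + q * F = 0 \<or> int n * (E * w g) - B1 \<le> ram * \<mu> (g ^ n + q * F)" unfolding G2_def by blast
      moreover have "int n * (E * w g) \<ge> int n * (ram * \<mu> g + 1)" using lt by (intro mult_left_mono) auto
      moreover have "int n * (ram * \<mu> g + 1) - B1 > ram * (int n * \<mu> g)" unfolding n_def
        by (simp add: algebra_simps)
      ultimately have "g ^ n + q * F = 0 \<or> ram * (int n * \<mu> g) < ram * \<mu> (g ^ n + q * F)" by linarith
      then have "val_ge \<mu> (int n * \<mu> g + 1) (g ^ n + q * F)"
        using ram by (auto simp: val_ge_def)
      with g(2)[of n "- q"] show False by simp
    qed
  qed
qed

section \<open>Newton polygons of finite sets of points\<close>

text \<open>A half-plane alone does not control which points of its boundary line belong to a hull.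
  The second linear form breaks ties there and so pins down the end points of sides.\<close>

lemma convex_lex_halfspace:
  fixes L L' :: "'a::real_vector \<Rightarrow> real"
  assumes "linear L" "linear L'"
  shows "convex {p. a < L p \<or> L p = a \<and> b \<le> L' p}"
proof (rule convexI)
  fix p q and u v :: real
  assume p: "p \<in> {p. a < L p \<or> L p = a \<and> b \<le> L' p}" and q: "q \<in> {p. a < L p \<or> L p = a \<and> b \<le> L' p}"
    and uv: "0 \<le> u" "0 \<le> v" "u + v = 1"
  show "u *\<^sub>R p + v *\<^sub>R q \<in> {p. a < L p \<or> L p = a \<and> b \<le> L' p}"
  proof (cases "u = 0 \<or> v = 0")
    case True
    with p q uv show ?thesis by auto
  next
    case False
    with uv have pos: "u > 0" "v > 0" by auto
    have L: "L (u *\<^sub>R p + v *\<^sub>R q) = u * L p + v * L q" "L' (u *\<^sub>R p + v *\<^sub>R q) = u * L' p + v * L' q"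
      using assms by (simp_all add: linear_add linear_scale)
    have a: "a = u * a + v * a" and b: "b = u * b + v * b" using uv by (simp_all flip: distrib_right)
    consider "a < L p" | "a < L q" | "L p = a" "b \<le> L' p" "L q = a" "b \<le> L' q" using p q by auto
    then show ?thesis
    proof cases
      case 1
      have "u * a + v * a < u * L p + v * L q"
        using 1 q pos by (intro add_less_le_mono mult_strict_left_mono mult_left_mono) auto
      then show ?thesis using L a by simp
    next
      case 2
      have "u * a + v * a < u * L p + v * L q"
        using 2 p pos by (intro add_le_less_mono mult_strict_left_mono mult_left_mono) auto
      then show ?thesis using L a by simp
    next
      case 3
      have "u * b + v * b \<le> u * L' p + v * L' q"
        using 3 pos by (intro add_mono mult_left_mono) auto
      then show ?thesis using L a b 3 by auto
    qed
  qed
qed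

lemma linear_height: "linear (\<lambda>p::real \<times> real. snd p - \<mu> * fst p)"
  by (rule linearI) (simp_all add: algebra_simps)

lemma linear_fst': "linear (\<lambda>p::real \<times> real. c * fst p)" and linear_snd': "linear (\<lambda>p::real \<times> real. snd p)"
  by (rule linearI; simp add: algebra_simps)+

locale point_polygon =
  fixes I :: "nat set" and u :: "nat \<Rightarrow> real"
  assumes fin: "finite I" and ne: "I \<noteq> {}"
begin

definition N :: "(real \<times> real) set" where "N = lower_hull ((\<lambda>s. (real s, u s)) ` I)"

text \<open>The intercept at abscissa 0 of the support line of slope \<open>\<mu>\<close>. The set
  \<open>J\<close> below collects the abscissas of the given points on that line; its minimum and
  maximum are the ends of the \<open>\<mu>\<close>-component.\<close>

definition minh :: "real \<Rightarrow> real" where "minh \<mu> = Min ((\<lambda>s. u s - \<mu> * real s) ` I)"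

definition J :: "real \<Rightarrow> nat set" where "J \<mu> = {s \<in> I. u s - \<mu> * real s = minh \<mu>}"

lemma minh_le: "s \<in> I \<Longrightarrow> minh \<mu> \<le> u s - \<mu> * real s"
  unfolding minh_def using fin by (intro Min_le) auto

lemma minh_eqI: "s \<in> I \<Longrightarrow> (\<And>i. i \<in> I \<Longrightarrow> u s - \<mu> * real s \<le> u i - \<mu> * real i) \<Longrightarrow> s \<in> J \<mu>"
  unfolding J_def minh_def using fin by (auto intro!: Min_eqI[symmetric])

lemma finite_J: "finite (J \<mu>)" and J_nonempty: "J \<mu> \<noteq> {}" and J_sub: "J \<mu> \<subseteq> I"
proof -
  have "minh \<mu> \<in> (\<lambda>s. u s - \<mu> * real s) ` I" unfolding minh_def using fin ne by (intro Min_in) auto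
  then show "J \<mu> \<noteq> {}" unfolding J_def by force
qed (use fin in \<open>auto simp: J_def\<close>)

lemma J_height: "s \<in> J \<mu> \<Longrightarrow> u s - \<mu> * real s = minh \<mu>"
  by (simp add: J_def)

lemma hull_height:
  assumes "p \<in> convex hull ((\<lambda>s. (real s, u s)) ` I)"
  shows "minh \<mu> \<le> snd p - \<mu> * fst p"
proof -
  have "convex hull ((\<lambda>s. (real s, u s)) ` I) \<subseteq> {p. minh \<mu> < snd p - \<mu> * fst p \<or> snd p - \<mu> * fst p = minh \<mu> \<and> 0 \<le> 0 * fst p}"
    by (intro hull_minimal convex_lex_halfspace[OF linear_height linear_fst'])
      (use minh_le in \<open>force simp: le_less\<close>)
  with assms show ?thesis by auto
qed

lemma vertex_in_N:
  assumes "s \<in> J \<mu>"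
  shows "(real s, u s) \<in> N"
proof -
  have "(real s, u s) \<in> convex hull ((\<lambda>s. (real s, u s)) ` I)"
    using assms J_sub by (intro hull_inc) auto
  moreover have "u s \<le> y'" if "(real s, y') \<in> convex hull ((\<lambda>s. (real s, u s)) ` I)" for y'
    using hull_height[OF that, of \<mu>] J_height[OF assms] by simp
  ultimately show ?thesis unfolding N_def lower_hull_def by blast
qed

lemma N_height: "p \<in> N \<Longrightarrow> minh \<mu> \<le> snd p - \<mu> * fst p"
  using hull_height[of p \<mu>] by (cases p) (auto simp: N_def lower_hull_def)

lemma component_eq: "component \<mu> N = {(x, y) \<in> N. y - \<mu> * x = minh \<mu>}"
proof -
  obtain s where s: "s \<in> J \<mu>" using J_nonempty by blast
  have "(x, y) \<in> component \<mu> N \<longleftrightarrow> (x, y) \<in> N \<and> y - \<mu> * x = minh \<mu>" for x y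
  proof
    assume "(x, y) \<in> component \<mu> N"
    then have xy: "(x, y) \<in> N" "\<And>x' y'. (x', y') \<in> N \<Longrightarrow> y - \<mu> * x \<le> y' - \<mu> * x'"
      unfolding component_def by auto
    from xy(2)[OF vertex_in_N[OF s]] N_height[OF xy(1), of \<mu>] J_height[OF s] xy(1)
    show "(x, y) \<in> N \<and> y - \<mu> * x = minh \<mu>" by simp
  next
    assume "(x, y) \<in> N \<and> y - \<mu> * x = minh \<mu>"
    then show "(x, y) \<in> component \<mu> N" using N_height[of _ \<mu>] unfolding component_def by force
  qed
  then show ?thesis by auto
qed

lemma vertex_in_component: "s \<in> J \<mu> \<Longrightarrow> (real s, u s) \<in> component \<mu> N"
  using vertex_in_N J_height by (auto simp: component_eq)

lemma component_range:
  assumes "(x, y) \<in> component \<mu> N"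
  shows "real (Min (J \<mu>)) \<le> x" "x \<le> real (Max (J \<mu>))"
proof -
  have h: "(x, y) \<in> convex hull ((\<lambda>s. (real s, u s)) ` I)" "y - \<mu> * x = minh \<mu>"
    using assms[unfolded component_eq] by (auto simp: N_def lower_hull_def)
  have le1: "minh \<mu> < u s - \<mu> * real s \<or>
    u s - \<mu> * real s = minh \<mu> \<and> Min (J \<mu>) \<le> s \<and> s \<le> Max (J \<mu>)" if "s \<in> I" for s
  proof (cases "s \<in> J \<mu>")
    case True
    then show ?thesis using finite_J J_height by simp
  next
    case False
    then show ?thesis using minh_le[OF that, of \<mu>] that by (simp add: J_def less_le)
  qed
  have "convex hull ((\<lambda>s. (real s, u s)) ` I) \<subseteq> {p. minh \<mu> < snd p - \<mu> * fst p \<or>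
      snd p - \<mu> * fst p = minh \<mu> \<and> real (Min (J \<mu>)) \<le> 1 * fst p}"
    by (intro hull_minimal convex_lex_halfspace[OF linear_height linear_fst'])
      (use le1 in force)
  with h show "real (Min (J \<mu>)) \<le> x" by auto
  have "convex hull ((\<lambda>s. (real s, u s)) ` I) \<subseteq> {p. minh \<mu> < snd p - \<mu> * fst p \<or>
      snd p - \<mu> * fst p = minh \<mu> \<and> - real (Max (J \<mu>)) \<le> (-1) * fst p}"
    by (intro hull_minimal convex_lex_halfspace[OF linear_height linear_fst'])
      (use le1 in force)
  with h show "x \<le> real (Max (J \<mu>))" by auto
qed

lemma Min_J: "Min (J \<mu>) \<in> J \<mu>" and Max_J: "Max (J \<mu>) \<in> J \<mu>"
  using finite_J J_nonempty by auto

lemma left_component: "left_abscissa (component \<mu> N) = real (Min (J \<mu>))"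
  unfolding left_abscissa_def
  using vertex_in_component[OF Min_J] component_range(1)
  by (intro cInf_eq_minimum) force+

lemma right_component: "right_abscissa (component \<mu> N) = real (Max (J \<mu>))"
  unfolding right_abscissa_def
  using vertex_in_component[OF Max_J] component_range(2)
  by (intro cSup_eq_maximum) force+

lemma left_N: "left_abscissa N = real (Min I)" and left_vertex_in_N: "(real (Min I), u (Min I)) \<in> N"
proof -
  have le1: "Min I < s \<or> s = Min I" if "s \<in> I" for s using Min_le[OF fin that] by linarith
  have "convex hull ((\<lambda>s. (real s, u s)) ` I) \<subseteq> {p. real (Min I) < 1 * fst p \<or>
      1 * fst p = real (Min I) \<and> u (Min I) \<le> snd p}"
    by (intro hull_minimal convex_lex_halfspace[OF linear_fst' linear_snd'])
      (use le1 in force)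
  then have *: "real (Min I) < x \<or> x = real (Min I) \<and> u (Min I) \<le> y"
    if "(x, y) \<in> convex hull ((\<lambda>s. (real s, u s)) ` I)" for x y using that by auto
  show in_N: "(real (Min I), u (Min I)) \<in> N"
    unfolding N_def lower_hull_def using *[of "real (Min I)"] Min_in[OF fin ne] by (auto intro!: hull_inc)
  show "left_abscissa N = real (Min I)"
    unfolding left_abscissa_def using in_N *
    by (intro cInf_eq_minimum) (force simp: N_def lower_hull_def)+
qed

lemma negative_part_sub: "negative_part N \<subseteq> N"
  unfolding negative_part_def is_side_def component_def by auto

lemma vertex_in_negative_part:
  assumes \<mu>: "\<mu> < 0" and s: "s \<in> J \<mu>"
  shows "(real s, u s) \<in> negative_part N"
proof -
  have side: "(real s, u s) \<in> negative_part N" if "\<nu> < 0" "i \<in> J \<nu>" "s \<in> J \<nu>" "i < s" for \<nu> i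
  proof -
    have "Min (J \<nu>) < Max (J \<nu>)"
      using that Min_le[OF finite_J that(2)] Max_ge[OF finite_J that(3)] by linarith
    then have "is_side N \<nu> (component \<nu> N)" by (simp add: is_side_def left_component right_component)
    with that vertex_in_component[of s \<nu>] show ?thesis unfolding negative_part_def by blast
  qed
  have sI: "s \<in> I" using s J_sub by blast
  show ?thesis
  proof (cases "s = Min I")
    case True
    then show ?thesis using left_N left_vertex_in_N by (simp add: negative_part_def)
  next
    case False
    define I' where "I' = {i \<in> I. i < s}"
    have "Min I < s" using False fin sI Min_le[of I s] by (simp add: order_le_neq_trans)
    then have I': "finite I'" "I' \<noteq> {}" using fin ne unfolding I'_def by (auto intro: Min_in)
    \<comment> \<open>The support line is rotated about the point at \<open>s\<close> until it meets
      a point further left. The largest slope \<open>\<nu>\<close> towards such a point is at most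
      \<open>\<mu>\<close>, hence negative, and the line of slope \<open>\<nu>\<close> carries a
      side through \<open>s\<close>.\<close>
    define sl where "sl i = (u s - u i) / (real s - real i)" for i
    define \<nu> where "\<nu> = Max (sl ` I')"
    have "\<nu> \<in> sl ` I'" unfolding \<nu>_def using I' by (intro Max_in) auto
    then obtain i0 where i0: "i0 \<in> I'" "\<nu> = sl i0" by auto
    have hs: "u s - \<mu> * real s \<le> u i - \<mu> * real i" if "i \<in> I" for i
      using minh_le[OF that, of \<mu>] J_height[OF s] by simp
    have "sl i0 \<le> \<mu>"
      using hs[of i0] i0 unfolding sl_def I'_def by (simp add: divide_le_eq algebra_simps)
    with i0 have \<nu>\<mu>: "\<nu> \<le> \<mu>" by simp
    have sJ: "s \<in> J \<nu>"
    proof (rule minh_eqI[OF sI])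
      fix i assume i: "i \<in> I"
      consider "i < s" | "i = s" | "s < i" by linarith
      then show "u s - \<nu> * real s \<le> u i - \<nu> * real i"
      proof cases
        case 1
        then have "sl i \<le> \<nu>" unfolding \<nu>_def using i I' by (intro Max_ge) (auto simp: I'_def)
        with 1 show ?thesis unfolding sl_def by (simp add: divide_le_eq algebra_simps)
      next
        case 3
        then have "\<nu> * (real i - real s) \<le> \<mu> * (real i - real s)" using \<nu>\<mu> by (intro mult_right_mono) auto
        with hs[OF i] show ?thesis by (simp add: algebra_simps)
      qed simp
    qed
    have "u i0 - \<nu> * real i0 = u s - \<nu> * real s"
      using i0 unfolding sl_def I'_def by (simp add: field_simps)
    then have "i0 \<in> J \<nu>" using sJ i0 unfolding J_def I'_def by simp
    with sJ \<nu>\<mu> \<mu> i0 show ?thesis by (intro side[of \<nu> i0]) (auto simp: I'_def)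
  qed
qed

text \<open>The chord between the two extreme points of the component lies in the hull and bounds
  the polygon from above; the support line bounds it from below.\<close>

lemma N_on_component_range:
  assumes "(x, y) \<in> N" "real (Min (J \<mu>)) \<le> x" "x \<le> real (Max (J \<mu>))"
  shows "y - \<mu> * x = minh \<mu>"
proof -
  let ?a = "Min (J \<mu>)" and ?b = "Max (J \<mu>)"
  let ?H = "convex hull ((\<lambda>s. (real s, u s)) ` I)"
  have ab: "(real ?a, u ?a) \<in> ?H" "(real ?b, u ?b) \<in> ?H"
    using Min_J[of \<mu>] Max_J[of \<mu>] J_sub[of \<mu>] by (auto intro!: hull_inc)
  have ua: "u ?a = minh \<mu> + \<mu> * real ?a" and ub: "u ?b = minh \<mu> + \<mu> * real ?b"
    using J_height[OF Min_J, of \<mu>] J_height[OF Max_J, of \<mu>] by simp_all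
  have "(x, minh \<mu> + \<mu> * x) \<in> ?H"
  proof (cases "?a = ?b")
    case True
    then have "x = real ?a" using assms by simp
    with ab(1) ua show ?thesis by simp
  next
    case False
    with assms have lt: "real ?a < real ?b" by linarith
    define t where "t = (x - real ?a) / (real ?b - real ?a)"
    have t: "0 \<le> t" "t \<le> 1" using assms lt by (simp_all add: t_def divide_le_eq)
    have "t * (real ?b - real ?a) = x - real ?a" using lt by (simp add: t_def)
    then have x: "x = (1 - t) * real ?a + t * real ?b" by (simp add: algebra_simps)
    have "(1 - t) *\<^sub>R (real ?a, u ?a) + t *\<^sub>R (real ?b, u ?b) \<in> ?H"
      using ab t by (intro convexD[OF convex_convex_hull]) auto
    also have "(1 - t) *\<^sub>R (real ?a, u ?a) + t *\<^sub>R (real ?b, u ?b) = (x, minh \<mu> + \<mu> * x)"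
      unfolding ua ub x by (simp add: algebra_simps)
    finally show ?thesis .
  qed
  then have "y \<le> minh \<mu> + \<mu> * x" using assms(1) unfolding N_def lower_hull_def by auto
  with N_height[OF assms(1), of \<mu>] show ?thesis by simp
qed

text \<open>\<open>residual_coeff\<close> tests points against the whole negative polygon. Between
  the ends of one component that test depends only on the component.\<close>

lemma negative_part_iff:
  assumes "\<mu> < 0" "s \<in> I" "Min (J \<mu>) \<le> s" "s \<le> Max (J \<mu>)"
  shows "(real s, u s) \<in> negative_part N \<longleftrightarrow> s \<in> J \<mu>"
  using vertex_in_negative_part[OF assms(1)] N_on_component_range[of "real s" "u s" \<mu>] assms
    negative_part_sub by (auto simp: J_def)

text \<open>The negative part contains a point of the support line of slope \<open>\<mu>\<close>, so
  truncation does not change the minimal height. A component of positive length lies entirely in the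
  negative part; one of length 0 would make \<open>S\<close> a single point.\<close>

lemma side_of_negative_part:
  assumes \<mu>: "\<mu> < 0" and S: "is_side (negative_part N) \<mu> S"
  shows "S = component \<mu> N"
proof -
  obtain s where s: "s \<in> J \<mu>" using J_nonempty by blast
  note sn = vertex_in_negative_part[OF \<mu> s]
  have Seq: "S = component \<mu> N \<inter> negative_part N"
  proof -
    have "(x, y) \<in> S \<longleftrightarrow> (x, y) \<in> component \<mu> N \<inter> negative_part N" for x y
    proof
      assume xy: "(x, y) \<in> S"
      then have *: "(x, y) \<in> negative_part N"
        "\<And>x' y'. (x', y') \<in> negative_part N \<Longrightarrow> y - \<mu> * x \<le> y' - \<mu> * x'"
        using S unfolding is_side_def component_def by auto
      from *(2)[OF sn] J_height[OF s] N_height[of "(x, y)" \<mu>] negative_part_sub *(1)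
      show "(x, y) \<in> component \<mu> N \<inter> negative_part N" by (auto simp: component_eq)
    next
      assume "(x, y) \<in> component \<mu> N \<inter> negative_part N"
      then have xy: "(x, y) \<in> component \<mu> N" "(x, y) \<in> negative_part N" by auto
      have "y - \<mu> * x \<le> y' - \<mu> * x'" if "(x', y') \<in> negative_part N" for x' y'
        using that negative_part_sub N_height[of "(x', y')" \<mu>] xy(1) by (auto simp: component_eq)
      then show "(x, y) \<in> S" using S xy(2) unfolding is_side_def component_def[of _ "negative_part N"] by auto
    qed
    then show ?thesis by auto
  qed
  show ?thesis
  proof (cases "Min (J \<mu>) < Max (J \<mu>)")
    case True
    then have "is_side N \<mu> (component \<mu> N)" by (simp add: is_side_def left_component right_component)
    then have "component \<mu> N \<subseteq> negative_part N" using \<mu> unfolding negative_part_def by blast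
    with Seq show ?thesis by blast
  next
    case False
    moreover have "Min (J \<mu>) \<le> Max (J \<mu>)" using finite_J Max_J by simp
    ultimately have eq: "Min (J \<mu>) = Max (J \<mu>)" by simp
    have "S = {(real s, u s)}"
    proof -
      have "(real s, u s) \<in> S" using Seq sn vertex_in_component[OF s] by blast
      moreover have "p = (real s, u s)" if "p \<in> S" for p
      proof -
        obtain x y where p: "p = (x, y)" by (cases p)
        have "(x, y) \<in> component \<mu> N" "(real s, u s) \<in> component \<mu> N"
          using that p Seq vertex_in_component[OF s] by auto
        from component_range[OF this(1)] component_range[OF this(2)] eq have "x = real s" by simp
        moreover from this \<open>(x, y) \<in> component \<mu> N\<close> J_height[OF s] have "y = u s"
          by (auto simp: component_eq)
        ultimately show ?thesis using p by simp
      qed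
      ultimately show ?thesis by blast
    qed
    then have "left_abscissa S = right_abscissa S" by (simp add: left_abscissa_def right_abscissa_def)
    with S show ?thesis by (simp add: is_side_def)
  qed
qed

end

section \<open>Field embeddings\<close>

locale field_embedding =
  fixes h :: "'a::field \<Rightarrow> 'b::field"
  assumes hom_1: "h 1 = 1" and hom_add: "h (x + y) = h x + h y" and hom_mult: "h (x * y) = h x * h y"
begin

lemma hom_0: "h 0 = 0"
  using hom_add[of 0 0] by (metis add_cancel_right_right add_0)

lemma hom_minus: "h (- x) = - h x"
  using hom_add[of x "- x"] hom_0 by (simp add: eq_neg_iff_add_eq_0 add.commute)

lemma hom_diff: "h (x - y) = h x - h y"
  using hom_add[of x "- y"] by (simp add: hom_minus)

lemma hom_eq_0_iff: "h x = 0 \<longleftrightarrow> x = 0"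
  using hom_mult[of x "inverse x"] hom_0 hom_1 by (cases "x = 0") auto

lemma hom_sum: "h (sum f I) = (\<Sum>i\<in>I. h (f i))"
  by (induction I rule: infinite_finite_induct) (simp_all add: hom_0 hom_add)

lemma hom_power: "h (x ^ n) = h x ^ n"
  by (induction n) (simp_all add: hom_1 hom_mult)

lemma hom_inverse: "h (inverse x) = inverse (h x)"
proof (cases "x = 0")
  case False
  then have "h x * h (inverse x) = 1" by (simp add: hom_1 flip: hom_mult)
  then show ?thesis by (rule inverse_unique[symmetric])
qed (simp add: hom_0)

lemma hom_powi: "h (x powi n) = h x powi n"
  by (simp add: power_int_def hom_power hom_inverse)

lemma coeff_hom: "Polynomial.coeff (map_poly h p) n = h (Polynomial.coeff p n)"
  by (simp add: coeff_map_poly hom_0)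

lemma hom_poly_add: "map_poly h (p + q) = map_poly h p + map_poly h q"
  by (rule poly_eqI) (simp add: coeff_hom hom_add)

lemma hom_poly_mult: "map_poly h (p * q) = map_poly h p * map_poly h q"
  by (rule poly_eqI) (simp add: coeff_hom Polynomial.coeff_mult hom_sum hom_mult)

lemma hom_poly_1: "map_poly h 1 = 1"
  by (simp add: hom_1)

lemma hom_poly_power: "map_poly h (p ^ n) = map_poly h p ^ n"
  by (induction n) (simp_all add: hom_poly_1 hom_poly_mult)

lemma hom_poly_eq_0_iff: "map_poly h p = 0 \<longleftrightarrow> p = 0"
  by (simp add: poly_eq_iff coeff_hom hom_eq_0_iff)

lemma hom_poly_degree: "Polynomial.degree (map_poly h p) = Polynomial.degree p"
  by (rule Polynomial.degree_map_poly) (simp add: hom_eq_0_iff)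

lemma poly_hom: "poly (map_poly h p) (h x) = h (poly p x)"
  by (simp add: poly_altdef hom_poly_degree coeff_hom hom_sum hom_mult hom_power)

lemma hom_pcompose: "map_poly h (pcompose p q) = pcompose (map_poly h p) (map_poly h q)"
proof (induction p)
  case (pCons a p)
  then show ?case
    by (simp add: pcompose_pCons map_poly_pCons hom_0 hom_poly_add hom_poly_mult)
qed simp

lemma hom_poly_div: "map_poly h (p div q) = map_poly h p div map_poly h q"
proof (cases "q = 0")
  case False
  have e: "map_poly h p = map_poly h (p mod q) + map_poly h (p div q) * map_poly h q"
    by (simp flip: hom_poly_mult hom_poly_add)
  have "map_poly h (p mod q) div map_poly h q = 0"
    using Polynomial.degree_mod_less[OF False, of p]
    by (auto simp: hom_poly_degree intro: div_poly_less)
  then show ?thesis using False by (subst e) (simp add: poly_div_add_left hom_poly_eq_0_iff)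
qed simp

end

lemma field_embedding_to_ac: "field_embedding to_ac"
  by unfold_locales simp_all

section \<open>Polynomials supported in one residue class\<close>

lemma pcompose_monom: "pcompose (Polynomial.monom c n) q = Polynomial.smult c (q ^ n)"
  for q :: "'a::comm_ring_1 poly"
  by (simp add: pcompose_altdef map_poly_monom poly_monom)

definition low_order :: "'a::zero poly \<Rightarrow> nat" where
  "low_order p = (LEAST s. Polynomial.coeff p s \<noteq> 0)"

text \<open>The polynomial \<open>q\<close> with \<open>p = y^s q(y^e)\<close>, where
  \<open>s\<close> is the lowest exponent of \<open>p\<close>, provided that all exponents of
  \<open>p\<close> are congruent modulo \<open>e\<close>.\<close>

definition contract :: "nat \<Rightarrow> 'a::comm_ring_1 poly \<Rightarrow> 'a poly" where
  "contract e p = (\<Sum>j\<le>(Polynomial.degree p - low_order p) div e.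
     Polynomial.monom (Polynomial.coeff p (low_order p + j * e)) j)"

lemma coeff_low_order: "p \<noteq> 0 \<Longrightarrow> Polynomial.coeff p (low_order p) \<noteq> 0"
  unfolding low_order_def by (rule LeastI[of _ "Polynomial.degree p"]) simp

lemma low_order_le: "Polynomial.coeff p s \<noteq> 0 \<Longrightarrow> low_order p \<le> s"
  unfolding low_order_def by (rule Least_le)

lemma low_order_le_degree: "p \<noteq> 0 \<Longrightarrow> low_order p \<le> Polynomial.degree p"
  by (rule low_order_le) simp

context
  fixes p :: "'a::field poly" and e :: nat
  assumes p0: "p \<noteq> 0" and e: "e > 0"
    and supp: "\<And>s s'. Polynomial.coeff p s \<noteq> 0 \<Longrightarrow> Polynomial.coeff p s' \<noteq> 0 \<Longrightarrow> int e dvd int s - int s'"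
begin

lemma supp_ex: "Polynomial.coeff p s \<noteq> 0 \<Longrightarrow> \<exists>j. s = low_order p + j * e"
proof -
  assume s: "Polynomial.coeff p s \<noteq> 0"
  from supp[OF s coeff_low_order[OF p0]] low_order_le[OF s]
  have "e dvd s - low_order p" by (metis int_dvd_int_iff of_nat_diff)
  then obtain j where "s - low_order p = e * j" by (auto elim: dvdE)
  with low_order_le[OF s] show ?thesis by (intro exI[of _ j]) (simp add: mult.commute)
qed

lemma coeff_contract: "Polynomial.coeff (contract e p) j = Polynomial.coeff p (low_order p + j * e)"
proof (cases "j \<le> (Polynomial.degree p - low_order p) div e")
  case True
  then show ?thesis by (simp add: contract_def Polynomial.coeff_sum)
next
  case False
  then have "Polynomial.degree p - low_order p < j * e" using e by (simp add: div_less_iff_less_mult not_le)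
  then have "Polynomial.coeff p (low_order p + j * e) = 0" by (intro Polynomial.coeff_eq_0) linarith
  with False show ?thesis by (simp add: contract_def Polynomial.coeff_sum)
qed

lemma degree_contract: "low_order p + Polynomial.degree (contract e p) * e = Polynomial.degree p"
proof -
  obtain d where d: "Polynomial.degree p = low_order p + d * e" using supp_ex p0 by force
  have "Polynomial.degree (contract e p) = d"
  proof (rule antisym)
    show "Polynomial.degree (contract e p) \<le> d"
      using d e by (intro Polynomial.degree_le) (auto simp: coeff_contract intro!: Polynomial.coeff_eq_0)
    show "d \<le> Polynomial.degree (contract e p)"
      using p0 by (intro Polynomial.le_degree) (simp add: coeff_contract flip: d)
  qed
  with d show ?thesis by simp
qed

lemma contract_nonzero: "contract e p \<noteq> 0"
  using coeff_contract[of 0] coeff_low_order[OF p0] by auto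

lemma coeff_contract_0: "Polynomial.coeff (contract e p) 0 \<noteq> 0"
  using coeff_contract[of 0] coeff_low_order[OF p0] by auto

lemma contract_decomp:
  "p = Polynomial.monom 1 (low_order p) * pcompose (contract e p) (Polynomial.monom 1 e)"
proof -
  let ?q = "contract e p"
  have "pcompose ?q (Polynomial.monom 1 e) = (\<Sum>j\<le>Polynomial.degree ?q. Polynomial.monom (Polynomial.coeff ?q j) (j * e))"
    by (subst poly_as_sum_of_monoms[symmetric])
      (simp add: pcompose_sum pcompose_monom Polynomial.monom_power Polynomial.smult_monom mult.commute)
  then have "Polynomial.monom 1 (low_order p) * pcompose ?q (Polynomial.monom 1 e)
     = (\<Sum>j\<le>Polynomial.degree ?q. Polynomial.monom (Polynomial.coeff p (low_order p + j * e)) (low_order p + j * e))"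
    by (simp add: sum_distrib_left Polynomial.mult_monom coeff_contract)
  also have "\<dots> = p"
  proof (rule poly_eqI)
    fix s
    have "Polynomial.coeff (\<Sum>j\<le>Polynomial.degree ?q. Polynomial.monom (Polynomial.coeff p (low_order p + j * e)) (low_order p + j * e)) s
      = (\<Sum>j\<le>Polynomial.degree ?q. if low_order p + j * e = s then Polynomial.coeff p s else 0)"
      by (auto simp: Polynomial.coeff_sum intro!: sum.cong)
    also have "\<dots> = Polynomial.coeff p s"
    proof (cases "Polynomial.coeff p s = 0")
      case False
      then obtain j where j: "s = low_order p + j * e" using supp_ex by blast
      have "s \<le> Polynomial.degree p" using False by (rule Polynomial.le_degree)
      with degree_contract j have "low_order p + j * e \<le> low_order p + Polynomial.degree ?q * e" by simp
      then have "j \<le> Polynomial.degree ?q" using e by simp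
      moreover have "low_order p + i * e = s \<longleftrightarrow> i = j" for i using j e by auto
      ultimately show ?thesis by simp
    qed (auto intro!: sum.neutral)
    finally show "Polynomial.coeff (\<Sum>j\<le>Polynomial.degree ?q. Polynomial.monom (Polynomial.coeff p (low_order p + j * e)) (low_order p + j * e)) s
      = Polynomial.coeff p s" .
  qed
  finally show ?thesis by simp
qed

end

text \<open>Substituting \<open>y^e\<close> multiplies degrees by \<open>e\<close>, so a division
  with remainder remains one and a non-zero remainder would still be too short to be
  divisible.\<close>

lemma pcompose_monom_dvd_cancel:
  fixes p q :: "'a::field poly"
  assumes "e > 0" "pcompose p (Polynomial.monom 1 e) dvd pcompose q (Polynomial.monom 1 e)"
  shows "p dvd q"
proof (cases "p = 0")
  case True
  with assms show ?thesis by (simp add: pcompose_eq_0_iff Polynomial.degree_monom_eq)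
next
  case False
  let ?Y = "Polynomial.monom (1::'a) e"
  have dY: "Polynomial.degree ?Y = e" by (simp add: Polynomial.degree_monom_eq)
  have "pcompose q ?Y = pcompose (q div p) ?Y * pcompose p ?Y + pcompose (q mod p) ?Y"
    by (simp flip: pcompose_mult pcompose_add)
  with assms(2) have d: "pcompose p ?Y dvd pcompose (q mod p) ?Y"
    by (metis dvd_add_right_iff dvd_triv_right)
  have "q mod p = 0"
  proof (rule ccontr)
    assume nz: "q mod p \<noteq> 0"
    then have lt: "Polynomial.degree (q mod p) < Polynomial.degree p" using Polynomial.degree_mod_less'[OF False] by blast
    have "pcompose (q mod p) ?Y \<noteq> 0" using nz dY assms(1) by (simp add: pcompose_eq_0_iff)
    from Polynomial.dvd_imp_degree_le[OF d this] lt assms(1) show False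
      by (simp add: degree_pcompose dY)
  qed
  then show ?thesis by auto
qed

section \<open>Graded residue maps and their augmentation\<close>

text \<open>The residue of the class of \<open>g\<close> in the degree \<open>N\<close> piece of the
  graded algebra of \<open>v\<close>, for \<open>g\<close> of value at least \<open>N\<close>; that
  class is zero when the value is larger. Additivity of \<open>\<rho>\<close> makes sense only
  within one such degree.\<close>

definition residue_at :: "('k::field poly \<Rightarrow> int) \<Rightarrow> ('k poly \<Rightarrow> 'e::field) \<Rightarrow> int \<Rightarrow> 'k poly \<Rightarrow> 'e" where
  "residue_at v \<rho> N g = (if g \<noteq> 0 \<and> v g = N then \<rho> g else 0)"

locale graded_residue =
  fixes v :: "'k::field poly \<Rightarrow> int" and \<rho> :: "'k poly \<Rightarrow> 'e::field" and K :: "'e set"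
  assumes val: "is_valuation v" and K: "is_subfield K"
    and residue_mem: "g \<noteq> 0 \<Longrightarrow> \<rho> g \<in> K"
    and residue_mult: "g \<noteq> 0 \<Longrightarrow> g' \<noteq> 0 \<Longrightarrow> \<rho> (g * g') = \<rho> g * \<rho> g'"
    and residue_add: "val_ge v N g \<Longrightarrow> val_ge v N g' \<Longrightarrow>
       residue_at v \<rho> N (g + g') = residue_at v \<rho> N g + residue_at v \<rho> N g'"

text \<open>The residue map sees \<open>\<phi>\<close> as zero and every shorter polynomial as a
  unit, as for key polynomials of valuations. The constant \<open>\<zeta>\<close> accounts for the
  twist exponent being computed from the value of \<open>a * \<phi> ^ s\<close> rather than of
  \<open>a\<close>.\<close>

locale key_polynomial = graded_residue v \<rho> K
  for v :: "'k::field poly \<Rightarrow> int" and \<rho> :: "'k poly \<Rightarrow> 'e::field" and K :: "'e set" +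
  fixes \<phi> :: "'k poly" and h e :: nat and \<zeta> :: 'e
  assumes degree_pos: "Polynomial.degree \<phi> > 0"
    and residue_key: "\<rho> \<phi> = 0"
    and residue_small: "a \<noteq> 0 \<Longrightarrow> Polynomial.degree a < Polynomial.degree \<phi> \<Longrightarrow> \<rho> a \<noteq> 0"
    and h: "h > 0" and e: "e > 0" and coprime: "coprime h e"
    and \<zeta>: "\<zeta> \<in> K" "\<zeta> \<noteq> 0"
begin

abbreviation ex :: "'k poly \<Rightarrow> nat \<Rightarrow> 'k poly" where "ex \<equiv> expansion_coeff \<phi>"

text \<open>The value of \<open>\<phi>\<close> under the augmented valuation \<open>aug\<close>;
  accordingly \<open>wt s a\<close> is the value of \<open>a * \<phi> ^ s\<close> for non-zero
  \<open>a\<close> shorter than \<open>\<phi>\<close>.\<close>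

definition T :: int where "T = int e * v \<phi> + int h"

definition wt :: "nat \<Rightarrow> 'k poly \<Rightarrow> int" where "wt s a = int e * v a + int s * T"

definition aug :: "'k poly \<Rightarrow> int" where
  "aug g = Min {int e * v (ex g s * \<phi> ^ s) + int s * int h | s. ex g s \<noteq> 0}"

definition ge :: "int \<Rightarrow> 'k poly \<Rightarrow> bool" where
  "ge N g \<longleftrightarrow> (\<forall>s. ex g s \<noteq> 0 \<longrightarrow> N \<le> wt s (ex g s))"

definition initial_coeff :: "int \<Rightarrow> 'k poly \<Rightarrow> nat \<Rightarrow> 'e" where
  "initial_coeff N g s = (if ex g s \<noteq> 0 \<and> wt s (ex g s) = N then \<rho> (ex g s) * \<zeta> ^ s else 0)"

text \<open>The homogeneous part of degree \<open>N\<close>, with \<open>y\<close> standing for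
  \<open>\<phi>\<close>. In contrast to a residual polynomial it keeps the abscissas
  \<open>s\<close> themselves, so that multiplication needs no bookkeeping of starting
  points.\<close>

definition initial :: "int \<Rightarrow> 'k poly \<Rightarrow> 'e poly" where
  "initial N g = (\<Sum>s\<le>Polynomial.degree g. Polynomial.monom (initial_coeff N g s) s)"

section \<open>Expansions in powers of the key polynomial and their homogeneous parts\<close>

lemma \<phi>_nonzero: "\<phi> \<noteq> 0"
  using degree_pos by auto

lemma wt_eq: "a \<noteq> 0 \<Longrightarrow> int e * v (a * \<phi> ^ s) + int s * int h = wt s a"
  using \<phi>_nonzero by (simp add: valuation_mult[OF val] valuation_power[OF val] wt_def T_def algebra_simps)

lemma ex_add: "ex (g + g') s = ex g s + ex g' s"
  by (simp add: expansion_coeff_def poly_div_add_left poly_mod_add_left)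

lemma ex_0 [simp]: "ex 0 s = 0"
  by (simp add: expansion_coeff_def)

lemma ex_degree: "Polynomial.degree (ex g s) < Polynomial.degree \<phi>"
  by (rule expansion_coeff_degree[OF degree_pos])

lemma ex_nonzero_degree: "ex g s \<noteq> 0 \<Longrightarrow> s * Polynomial.degree \<phi> \<le> Polynomial.degree g"
proof (rule ccontr)
  assume "ex g s \<noteq> 0" "\<not> s * Polynomial.degree \<phi> \<le> Polynomial.degree g"
  then have "g div \<phi> ^ s = 0" using \<phi>_nonzero
    by (intro div_poly_less) (simp add: Polynomial.degree_power_eq)
  with \<open>ex g s \<noteq> 0\<close> show False by (simp add: expansion_coeff_def)
qed

lemma ex_nonzero_le: "ex g s \<noteq> 0 \<Longrightarrow> s \<le> Polynomial.degree g"
  using ex_nonzero_degree[of g s] mult_le_mono2[of 1 "Polynomial.degree \<phi>" s] degree_pos by linarith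

lemma ex_term:
  assumes "Polynomial.degree a < Polynomial.degree \<phi>"
  shows "ex (a * \<phi> ^ s) t = (if t = s then a else 0)"
proof -
  have a: "a mod \<phi> = a" "a div \<phi> = 0" using assms by (simp_all add: mod_poly_less div_poly_less)
  consider "t < s" | "t = s" | "s < t" by linarith
  then show ?thesis
  proof cases
    case 1
    then obtain k where "s = t + Suc k" using less_imp_Suc_add by auto
    then have "a * \<phi> ^ s = (a * \<phi> ^ k * \<phi>) * \<phi> ^ t" by (simp add: power_add ac_simps)
    then have "(a * \<phi> ^ s) div \<phi> ^ t = a * \<phi> ^ k * \<phi>"
      using nonzero_mult_div_cancel_right[of "\<phi> ^ t" "a * \<phi> ^ k * \<phi>"] \<phi>_nonzero by (simp only: power_not_zero not_False_eq_True)
    then show ?thesis using 1 by (simp add: expansion_coeff_def)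
  next
    case 2
    then show ?thesis using \<phi>_nonzero a by (simp add: expansion_coeff_def)
  next
    case 3
    then obtain k where "t = s + Suc k" using less_imp_Suc_add by auto
    then have t: "\<phi> ^ t = \<phi> ^ s * (\<phi> * \<phi> ^ k)" by (simp add: power_add)
    have "(a * \<phi> ^ s) div \<phi> ^ t = (a div \<phi>) div \<phi> ^ k"
      unfolding t poly_div_mult_right using \<phi>_nonzero by simp
    then show ?thesis using 3 a by (simp add: expansion_coeff_def)
  qed
qed

lemma ex_quotient: "ex (g div \<phi> ^ s) t = ex g (s + t)"
  by (simp add: expansion_coeff_def power_add poly_div_mult_right)

lemma expansion: "g = (\<Sum>s\<le>Polynomial.degree g. ex g s * \<phi> ^ s)"
proof -
  let ?n = "Suc (Polynomial.degree g)"
  have "?n * 1 \<le> ?n * Polynomial.degree \<phi>" using degree_pos by (intro mult_le_mono2) simp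
  then have "g div \<phi> ^ ?n = 0" using \<phi>_nonzero
    by (intro div_poly_less) (simp add: Polynomial.degree_power_eq del: power_Suc)
  with expansion_coeff_sum[of g \<phi> ?n] show ?thesis by (simp add: lessThan_Suc_atMost del: power_Suc)
qed

lemma ex_exists: "g \<noteq> 0 \<Longrightarrow> \<exists>s. ex g s \<noteq> 0"
  using expansion[of g] by (metis (no_types, lifting) mult_zero_left sum.neutral)

lemma coeff_initial: "Polynomial.coeff (initial N g) s = initial_coeff N g s"
  using ex_nonzero_le[of g s]
  by (auto simp: initial_def Polynomial.coeff_sum initial_coeff_def not_le)

lemma ge_0 [simp]: "ge N 0" and initial_0 [simp]: "initial N 0 = 0"
  by (simp_all add: ge_def initial_def initial_coeff_def)

text \<open>Each weight bound is solved for the value of the coefficient, rounding up; in this form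
  closure under addition is inherited from \<open>v\<close>.\<close>

lemma ge_alt: "ge N g \<longleftrightarrow> (\<forall>s. val_ge v (- ((- (N - int s * T)) div int e)) (ex g s))"
proof -
  have "n \<le> int e * x \<longleftrightarrow> - ((- n) div int e) \<le> x" for n x
  proof
    assume "n \<le> int e * x"
    then have "int e * (- x) \<le> - n" by simp
    then have "(int e * (- x)) div int e \<le> (- n) div int e" using e by (intro zdiv_mono1) auto
    then show "- ((- n) div int e) \<le> x"
      using e nonzero_mult_div_cancel_left[of "int e" "- x"] by simp
  next
    assume "- ((- n) div int e) \<le> x"
    then have "int e * (- x) \<le> int e * ((- n) div int e)" by (intro mult_left_mono) auto
    also have "\<dots> \<le> - n" using e pos_mod_sign[of "int e" "- n"] mult_div_mod_eq[of "int e" "- n"] by linarith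
    finally show "n \<le> int e * x" by simp
  qed
  from this[of "N - int _ * T" "v _"]
  have "N \<le> wt s a \<longleftrightarrow> - ((- (N - int s * T)) div int e) \<le> v a" for s a
    by (simp only: wt_def diff_le_eq)
  then show ?thesis unfolding ge_def val_ge_def by blast
qed

lemma initial_coeff_alt:
  "initial_coeff N g s = (if int e dvd N - int s * T
     then residue_at v \<rho> ((N - int s * T) div int e) (ex g s) * \<zeta> ^ s else 0)"
proof (cases "int e dvd N - int s * T")
  case True
  then obtain k where "N - int s * T = int e * k" by (auto elim: dvdE)
  then show ?thesis using e by (auto simp: initial_coeff_def residue_at_def wt_def)
next
  case False
  have "wt s a \<noteq> N" for a
  proof
    assume "wt s a = N"
    then have "N - int s * T = int e * v a" by (simp add: wt_def)
    with False show False by simp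
  qed
  with False show ?thesis by (simp add: initial_coeff_def)
qed

lemma ge_add: "ge N g \<Longrightarrow> ge N g' \<Longrightarrow> ge N (g + g')"
  unfolding ge_alt ex_add using val_ge_add[OF val] by blast

lemma initial_add:
  assumes "ge N g" "ge N g'"
  shows "initial N (g + g') = initial N g + initial N g'"
proof (rule poly_eqI)
  fix s
  show "Polynomial.coeff (initial N (g + g')) s = Polynomial.coeff (initial N g + initial N g') s"
  proof (cases "int e dvd N - int s * T")
    case True
    then obtain k where k: "N - int s * T = int e * k" by (auto elim: dvdE)
    have "- ((- (N - int s * T)) div int e) = (N - int s * T) div int e"
      using e unfolding k by (metis minus_minus mult_minus_right nonzero_mult_div_cancel_left of_nat_0_less_iff less_irrefl)
    then have "val_ge v ((N - int s * T) div int e) (ex g s)" "val_ge v ((N - int s * T) div int e) (ex g' s)"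
      using assms unfolding ge_alt by metis+
    then show ?thesis using True
      by (simp add: coeff_initial initial_coeff_alt ex_add residue_add distrib_right)
  qed (simp add: coeff_initial initial_coeff_alt)
qed

lemma ge_sum: "(\<And>i. i \<in> I \<Longrightarrow> ge N (f i)) \<Longrightarrow> ge N (sum f I)"
  by (induction I rule: infinite_finite_induct) (auto intro: ge_add)

lemma initial_sum: "(\<And>i. i \<in> I \<Longrightarrow> ge N (f i)) \<Longrightarrow> initial N (sum f I) = (\<Sum>i\<in>I. initial N (f i))"
  by (induction I rule: infinite_finite_induct) (auto simp: initial_add ge_sum)

lemma ge_term: "Polynomial.degree a < Polynomial.degree \<phi> \<Longrightarrow> ge N (a * \<phi> ^ s) \<longleftrightarrow> a = 0 \<or> N \<le> wt s a"
  by (auto simp: ge_def ex_term)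

lemma initial_term: "Polynomial.degree a < Polynomial.degree \<phi> \<Longrightarrow>
   initial N (a * \<phi> ^ s) = Polynomial.monom (if a \<noteq> 0 \<and> wt s a = N then \<rho> a * \<zeta> ^ s else 0) s"
  by (rule poly_eqI) (auto simp: coeff_initial initial_coeff_def ex_term)

text \<open>The \<open>\<phi>\<close>-initial term of a product of small polynomials survives division by \<open>\<phi>\<close>, because
  \<open>\<rho>\<close> kills the multiples of \<open>\<phi>\<close> but no small polynomial.\<close>

lemma small_product:
  assumes a: "a \<noteq> 0" "Polynomial.degree a < Polynomial.degree \<phi>"
    and b: "b \<noteq> 0" "Polynomial.degree b < Polynomial.degree \<phi>"
  defines "r \<equiv> a * b mod \<phi>" and "c \<equiv> a * b div \<phi>"
  shows "r \<noteq> 0" "v r = v (a * b)" "\<rho> r = \<rho> (a * b)" "c = 0 \<or> v (a * b) \<le> v c + v \<phi>"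
proof -
  have ab: "a * b = r + c * \<phi>" by (simp add: r_def c_def)
  have ab0: "a * b \<noteq> 0" using a b by simp
  have \<rho>ab: "\<rho> (a * b) \<noteq> 0" using residue_mult a b residue_small by simp
  have dr: "Polynomial.degree r < Polynomial.degree \<phi>"
    unfolding r_def using degree_pos Polynomial.degree_mod_less'[OF \<phi>_nonzero] by (cases "a * b mod \<phi> = 0") auto
  have \<rho>c: "\<rho> (c * \<phi>) = 0" if "c \<noteq> 0" using that \<phi>_nonzero residue_mult[of c \<phi>] residue_key by simp
  have res: "residue_at v \<rho> N (a * b) = residue_at v \<rho> N r" if "val_ge v N r" "val_ge v N (c * \<phi>)" for N
    using residue_add[OF that] \<rho>c ab by (auto simp: residue_at_def split: if_splits)
  show r0: "r \<noteq> 0"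
  proof
    assume "r = 0"
    then have "a * b = c * \<phi>" "c \<noteq> 0" using ab ab0 by auto
    with \<rho>ab \<rho>c show False by simp
  qed
  have \<rho>r: "\<rho> r \<noteq> 0" using residue_small[OF r0 dr] .
  have "v r = v (a * b) \<and> \<rho> r = \<rho> (a * b) \<and> val_ge v (v (a * b)) (c * \<phi>)"
  proof (cases "val_ge v (v r) (c * \<phi>)")
    case True
    from res[OF val_ge_self True] \<rho>r r0 have "v (a * b) = v r" "\<rho> (a * b) = \<rho> r"
      by (auto simp: residue_at_def split: if_splits)
    with True show ?thesis by simp
  next
    case False
    \<comment> \<open>In this case the multiple of \<open>\<phi>\<close> determines the value of
      \<open>a * b\<close>. The residue of the product in degree \<open>N\<close> then equals that
      of \<open>r\<close>, which is 0 because \<open>v r > N\<close>, against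
      \<open>\<rho> (a * b) \<noteq> 0\<close>.\<close>
    define N where "N = v (c * \<phi>)"
    from False have lt: "N < v r" "c * \<phi> \<noteq> 0" by (auto simp: val_ge_def N_def)
    have N: "val_ge v N r" "val_ge v N (c * \<phi>)" using lt by (auto simp: val_ge_def N_def)
    have "val_ge v N (a * b)" using val_ge_add[OF val N] ab by simp
    moreover have "\<not> val_ge v (N + 1) (a * b)"
    proof
      assume "val_ge v (N + 1) (a * b)"
      moreover have "val_ge v (N + 1) r" using lt by (auto simp: val_ge_def)
      ultimately have "val_ge v (N + 1) (a * b - r)" by (rule val_ge_diff[OF val])
      with ab lt show False by (simp add: val_ge_def N_def)
    qed
    ultimately have "v (a * b) = N" using ab0 by (simp add: val_ge_def)
    with res[OF N] \<rho>ab ab0 lt show ?thesis by (auto simp: residue_at_def)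
  qed
  moreover have "v (c * \<phi>) = v c + v \<phi>" if "c \<noteq> 0" using valuation_mult[OF val that \<phi>_nonzero] .
  ultimately show "v r = v (a * b)" "\<rho> r = \<rho> (a * b)" "c = 0 \<or> v (a * b) \<le> v c + v \<phi>"
    using \<phi>_nonzero by (cases "c = 0"; force simp: val_ge_def)+
qed

lemma initial_mult_term:
  assumes a: "Polynomial.degree a < Polynomial.degree \<phi>" "ge N (a * \<phi> ^ s)"
    and b: "Polynomial.degree b < Polynomial.degree \<phi>" "ge M (b * \<phi> ^ t)"
  shows "ge (N + M) (a * \<phi> ^ s * (b * \<phi> ^ t)) \<and>
    initial (N + M) (a * \<phi> ^ s * (b * \<phi> ^ t)) = initial N (a * \<phi> ^ s) * initial M (b * \<phi> ^ t)"
proof (cases "a = 0 \<or> b = 0")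
  case False
  then have ab: "a \<noteq> 0" "b \<noteq> 0" by auto
  define r c where "r = a * b mod \<phi>" and "c = a * b div \<phi>"
  note small = small_product[OF ab(1) a(1) ab(2) b(1), folded r_def c_def]
  have wts: "N \<le> wt s a" "M \<le> wt t b" using a b ab by (auto simp: ge_term)
  have vab: "v (a * b) = v a + v b" using valuation_mult[OF val ab] .
  have wr: "wt (s + t) r = wt s a + wt t b" using small(2) vab by (simp add: wt_def algebra_simps)
  have dr: "Polynomial.degree r < Polynomial.degree \<phi>"
    unfolding r_def using degree_pos Polynomial.degree_mod_less'[OF \<phi>_nonzero] by (cases "a * b mod \<phi> = 0") auto
  have dc: "Polynomial.degree c < Polynomial.degree \<phi>"
  proof (cases "c = 0")
    case False
    have "Polynomial.degree (a * b - r) \<le> max (Polynomial.degree (a * b)) (Polynomial.degree r)"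
      by (rule Polynomial.degree_diff_le_max)
    also have "a * b - r = c * \<phi>" by (simp add: r_def c_def minus_mod_eq_div_mult)
    also have "Polynomial.degree (c * \<phi>) = Polynomial.degree c + Polynomial.degree \<phi>"
      using False \<phi>_nonzero by (rule Polynomial.degree_mult_eq)
    also have "Polynomial.degree (a * b) = Polynomial.degree a + Polynomial.degree b"
      using ab by (rule Polynomial.degree_mult_eq)
    finally show ?thesis using a(1) b(1) dr by linarith
  qed (use degree_pos in simp)
  \<comment> \<open>The carry into the next power of \<open>\<phi>\<close> is heavier by at least
    \<open>h\<close>. This is where a strictly negative slope matters: carries never reach the
    initial form.\<close>
  have wc: "N + M < wt (Suc (s + t)) c" if "c \<noteq> 0"
  proof -
    have "int e * (v a + v b) \<le> int e * (v c + v \<phi>)" using small(4) that vab by (intro mult_left_mono) auto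
    then show ?thesis using wts h by (simp add: wt_def T_def algebra_simps)
  qed
  have eq: "a * \<phi> ^ s * (b * \<phi> ^ t) = r * \<phi> ^ (s + t) + c * \<phi> ^ Suc (s + t)"
  proof -
    have "a * \<phi> ^ s * (b * \<phi> ^ t) = (a * b) * \<phi> ^ (s + t)" by (simp add: power_add ac_simps)
    also have "a * b = r + c * \<phi>" by (simp add: r_def c_def)
    finally show ?thesis by (simp add: algebra_simps)
  qed
  have gr: "ge (N + M) (r * \<phi> ^ (s + t))" unfolding ge_term[OF dr] wr using wts by simp
  have gc: "ge (N + M) (c * \<phi> ^ Suc (s + t))" unfolding ge_term[OF dc] using wc by fastforce
  have ic: "initial (N + M) (c * \<phi> ^ Suc (s + t)) = 0"
    unfolding initial_term[OF dc] using wc by auto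
  have "initial (N + M) (r * \<phi> ^ (s + t)) = initial N (a * \<phi> ^ s) * initial M (b * \<phi> ^ t)"
    unfolding initial_term[OF dr] initial_term[OF a(1)] initial_term[OF b(1)] wr
    using small(1,3) ab wts residue_mult[OF ab] by (auto simp: Polynomial.mult_monom power_add)
  then show ?thesis unfolding eq using gr gc ic by (simp add: ge_add initial_add)
qed auto

lemma ge_terms: "ge N g \<Longrightarrow> ge N (ex g s * \<phi> ^ s)"
  unfolding ge_term[OF ex_degree] by (auto simp: ge_def)

lemma initial_mult:
  assumes g: "ge N g" and g': "ge M g'"
  shows ge_mult: "ge (N + M) (g * g')" and "initial (N + M) (g * g') = initial N g * initial M g'"
proof -
  let ?a = "\<lambda>s. ex g s * \<phi> ^ s" and ?b = "\<lambda>t. ex g' t * \<phi> ^ t"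
  let ?S = "{..Polynomial.degree g}" and ?T = "{..Polynomial.degree g'}"
  have t: "ge (N + M) (?a s * ?b t)" "initial (N + M) (?a s * ?b t) = initial N (?a s) * initial M (?b t)" for s t
    using initial_mult_term[OF ex_degree ge_terms[OF g] ex_degree ge_terms[OF g']] by blast+
  have eq: "g * g' = (\<Sum>s\<in>?S. \<Sum>t\<in>?T. ?a s * ?b t)"
    by (subst expansion[of g], subst expansion[of g']) (simp add: sum_product)
  show "ge (N + M) (g * g')" unfolding eq by (intro ge_sum t)
  have "initial (N + M) (g * g') = (\<Sum>s\<in>?S. \<Sum>t\<in>?T. initial N (?a s) * initial M (?b t))"
    unfolding eq by (simp add: initial_sum ge_sum t)
  also have "\<dots> = (\<Sum>s\<in>?S. initial N (?a s)) * (\<Sum>t\<in>?T. initial M (?b t))" by (simp add: sum_product)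
  also have "(\<Sum>s\<in>?S. initial N (?a s)) = initial N g"
    by (subst (2) expansion[of g]) (simp add: initial_sum ge_terms[OF g])
  also have "(\<Sum>t\<in>?T. initial M (?b t)) = initial M g'"
    by (subst (2) expansion[of g']) (simp add: initial_sum ge_terms[OF g'])
  finally show "initial (N + M) (g * g') = initial N g * initial M g'" .
qed

section \<open>The augmented valuation and multiplicativity of initial forms\<close>

lemma finite_support: "finite {s. ex g s \<noteq> 0}"
  by (rule finite_subset[of _ "{..Polynomial.degree g}"]) (use ex_nonzero_le in auto)

lemma aug_alt: "aug g = Min ((\<lambda>s. wt s (ex g s)) ` {s. ex g s \<noteq> 0})"
  unfolding aug_def by (rule arg_cong[of _ _ Min]) (auto simp: wt_eq[symmetric])

lemma aug_le: "ex g s \<noteq> 0 \<Longrightarrow> aug g \<le> wt s (ex g s)"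
  unfolding aug_alt using finite_support by (intro Min_le) auto

lemma aug_attained: "g \<noteq> 0 \<Longrightarrow> \<exists>s. ex g s \<noteq> 0 \<and> wt s (ex g s) = aug g"
  using Min_in[of "(\<lambda>s. wt s (ex g s)) ` {s. ex g s \<noteq> 0}"] finite_support ex_exists[of g]
  unfolding aug_alt by fastforce

lemma ge_iff: "ge N g \<longleftrightarrow> val_ge aug N g"
proof (cases "g = 0")
  case False
  from aug_attained[OF this] obtain s where "ex g s \<noteq> 0" "wt s (ex g s) = aug g" by blast
  with aug_le[of g] False show ?thesis unfolding ge_def val_ge_def by (metis order.trans)
qed simp

lemma ge_aug: "ge (aug g) g"
  by (simp add: ge_iff val_ge_self)

lemma initial_coeff_nonzero: "Polynomial.coeff (initial N g) s \<noteq> 0 \<longleftrightarrow> ex g s \<noteq> 0 \<and> wt s (ex g s) = N"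
  using residue_small[OF _ ex_degree] \<zeta> by (simp add: coeff_initial initial_coeff_def)

lemma initial_aug_nonzero: "g \<noteq> 0 \<Longrightarrow> initial (aug g) g \<noteq> 0"
  using aug_attained[of g] initial_coeff_nonzero[of "aug g" g] by fastforce

lemma initial_eq_0: "val_ge aug (N + 1) g \<Longrightarrow> initial N g = 0"
  using initial_coeff_nonzero[of N g] unfolding ge_iff[symmetric] ge_def
  by (intro poly_eqI) force

lemma aug_eqI: "ge N g \<Longrightarrow> initial N g \<noteq> 0 \<Longrightarrow> g \<noteq> 0 \<and> aug g = N"
  using initial_eq_0[of N g] by (cases "aug g = N") (auto simp: ge_iff val_ge_def)

text \<open>Polynomials over a field have no zero divisors, so the product of two initial forms is
  non-zero and the values add exactly.\<close>

lemma aug_valuation: "is_valuation aug"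
  unfolding is_valuation_def
proof (intro conjI allI impI)
  fix g g' :: "'k poly" assume "g \<noteq> 0 \<and> g' \<noteq> 0"
  then show "aug (g * g') = aug g + aug g'"
    using initial_mult[OF ge_aug ge_aug, of g g'] aug_eqI initial_aug_nonzero by (metis mult_eq_0_iff)
next
  fix g g' N assume "val_ge aug N g \<and> val_ge aug N g'"
  then show "val_ge aug N (g + g')" using ge_add by (simp add: ge_iff)
qed

lemma initial_aug_mult:
  "g \<noteq> 0 \<Longrightarrow> g' \<noteq> 0 \<Longrightarrow> initial (aug (g * g')) (g * g') = initial (aug g) g * initial (aug g') g'"
  using initial_mult(2)[OF ge_aug ge_aug, of g g'] valuation_mult[OF aug_valuation, of g g'] by simp

lemma initial_aug_power: "g \<noteq> 0 \<Longrightarrow> initial (aug (g ^ n)) (g ^ n) = initial (aug g) g ^ n"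
proof (induction n)
  case 0
  have "ex (1 * \<phi> ^ 0) s = (if s = 0 then 1 else 0)" for s using degree_pos by (intro ex_term) simp
  then have "ex 1 s = (if s = 0 then 1 else 0)" for s by simp
  moreover have "v 1 = 0" using valuation_1[OF val] .
  moreover have "aug 1 = 0" using valuation_1[OF aug_valuation] .
  moreover have "\<rho> 1 = 1"
    using residue_mult[of 1 1] residue_small[of 1] degree_pos by simp
  ultimately show ?case
    by (intro poly_eqI) (auto simp: coeff_initial initial_coeff_def wt_def Polynomial.coeff_1)
qed (simp add: initial_aug_mult)

lemma initial_support:
  assumes "Polynomial.coeff (initial N g) s \<noteq> 0"
  shows "int e dvd N - int s * int h"
proof -
  from assms have "N = wt s (ex g s)" by (simp add: initial_coeff_nonzero)
  then have "N - int s * int h = int e * (v (ex g s) + int s * v \<phi>)" by (simp add: wt_def T_def algebra_simps)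
  then show ?thesis by simp
qed

text \<open>Every exponent \<open>s\<close> satisfies \<open>s * h = N\<close> modulo
  \<open>e\<close>, and \<open>h\<close> is invertible modulo \<open>e\<close>.\<close>

lemma initial_supp:
  assumes "Polynomial.coeff (initial N g) s \<noteq> 0" "Polynomial.coeff (initial N g) s' \<noteq> 0"
  shows "int e dvd int s - int s'"
proof -
  have "int e dvd (N - int s' * int h) - (N - int s * int h)"
    using initial_support[OF assms(1)] initial_support[OF assms(2)] by (rule dvd_diff[rotated])
  then have "int e dvd (int s - int s') * int h" by (simp add: algebra_simps)
  then show ?thesis using coprime by (simp add: coprime_dvd_mult_left_iff coprime_commute)
qed

lemma initial_mem: "initial N g \<in> polys_over K"
  using residue_mem \<zeta>(1) unfolding polys_over_def
  by (auto simp: coeff_initial initial_coeff_def intro!: subfield_mult[OF K] subfield_power[OF K] subfield_0[OF K])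

section \<open>Residual polynomials as contracted initial forms\<close>

definition residual :: "'k poly \<Rightarrow> 'e poly" where
  "residual g = contract e (initial (aug g) g)"

lemma residual_mem: "residual g \<in> polys_over K"
  using initial_mem[of "aug g" g] unfolding residual_def contract_def polys_over_def[of K]
  by (auto simp: Polynomial.coeff_sum intro!: subfield_sum[OF K] subfield_0[OF K])

context
  fixes g :: "'k poly"
  assumes g: "g \<noteq> 0"
begin

lemma residual_decomp: "initial (aug g) g =
    Polynomial.monom 1 (low_order (initial (aug g) g)) * pcompose (residual g) (Polynomial.monom 1 e)"
  unfolding residual_def by (rule contract_decomp[OF initial_aug_nonzero[OF g] e initial_supp])

lemma residual_nonzero: "residual g \<noteq> 0"
  unfolding residual_def by (rule contract_nonzero[OF initial_aug_nonzero[OF g] e initial_supp])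

lemma residual_coeff_0: "Polynomial.coeff (residual g) 0 \<noteq> 0"
  unfolding residual_def by (rule coeff_contract_0[OF initial_aug_nonzero[OF g] e initial_supp])

lemma residual_degree: "low_order (initial (aug g) g) + Polynomial.degree (residual g) * e
    = Polynomial.degree (initial (aug g) g)"
  unfolding residual_def by (rule degree_contract[OF initial_aug_nonzero[OF g] e initial_supp])

end

section \<open>Reading the ends of a component from the initial form\<close>

lemma point_polygon: "g \<noteq> 0 \<Longrightarrow> point_polygon {s. ex g s \<noteq> 0}"
  using finite_support ex_exists by unfold_locales auto

context
  fixes g :: "'k poly"
  assumes g: "g \<noteq> 0"
begin

interpretation point_polygon "{s. ex g s \<noteq> 0}" "\<lambda>s. real_of_int (v (ex g s * \<phi> ^ s))"
  by (rule point_polygon[OF g])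

text \<open>Up to the factor \<open>e\<close>, the height over a line of slope \<open>-h/e\<close>
  is the weight. Points of minimal height are therefore the terms of the initial form.\<close>

lemma point_height:
  assumes "ex g s \<noteq> 0"
  shows "real_of_int (v (ex g s * \<phi> ^ s)) - slope h e * real s = real_of_int (wt s (ex g s)) / real e"
proof -
  define n where "n = v (ex g s * \<phi> ^ s)"
  have "wt s (ex g s) = int e * n + int s * int h" using wt_eq[OF assms] by (simp add: n_def)
  then have "real_of_int (wt s (ex g s)) / real e = (real e * real_of_int n + real s * real h) / real e"
    by (simp only: of_int_add of_int_mult of_int_of_nat_eq)
  then show ?thesis using e unfolding n_def[symmetric] by (simp add: slope_def add_divide_distrib)
qed

lemma minh_eq: "minh (slope h e) = real_of_int (aug g) / real e"
  and J_eq: "J (slope h e) = {s. Polynomial.coeff (initial (aug g) g) s \<noteq> 0}"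
proof -
  obtain s where s: "ex g s \<noteq> 0" "wt s (ex g s) = aug g" using aug_attained[OF g] by blast
  have "s \<in> J (slope h e)"
    using s aug_le[of g] e by (intro minh_eqI) (auto simp: point_height divide_right_mono)
  then show m: "minh (slope h e) = real_of_int (aug g) / real e"
    using J_height[of s] point_height[OF s(1)] s(2) by simp
  show "J (slope h e) = {s. Polynomial.coeff (initial (aug g) g) s \<noteq> 0}"
    using e by (auto simp: J_def m initial_coeff_nonzero point_height)
qed

lemma Min_J_eq: "Min (J (slope h e)) = low_order (initial (aug g) g)"
  using Min_J[of "slope h e"] finite_J[of "slope h e"] coeff_low_order[OF initial_aug_nonzero[OF g]] low_order_le
  by (intro antisym) (auto simp: J_eq)

lemma Max_J_eq: "Max (J (slope h e)) = Polynomial.degree (initial (aug g) g)"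
  using Max_J[of "slope h e"] finite_J[of "slope h e"] initial_aug_nonzero[OF g]
  by (intro antisym) (auto simp: J_eq intro: Polynomial.le_degree)

end

text \<open>Exactness of the division in the twist exponent: the lowest exponent times
  \<open>h\<close> is congruent to \<open>aug g\<close> modulo \<open>e\<close>, and
  \<open>\<l>\<close> inverts \<open>h\<close>.\<close>

lemma low_order_congruence:
  assumes "g \<noteq> 0" "int e dvd \<l> * int h - 1"
  shows "int e dvd int (low_order (initial (aug g) g)) - \<l> * aug g"
proof -
  let ?s = "low_order (initial (aug g) g)"
  have "int e dvd aug g - int ?s * int h"
    using coeff_low_order[OF initial_aug_nonzero[OF assms(1)]] by (rule initial_support)
  then have "int e dvd - \<l> * (aug g - int ?s * int h) - int ?s * (\<l> * int h - 1)"
    by (rule dvd_diff[OF dvd_mult dvd_mult[OF assms(2)]])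
  then show ?thesis by (simp add: algebra_simps)
qed

section \<open>The residue map of the next order\<close>

definition next_residue :: "'e \<Rightarrow> int \<Rightarrow> 'k poly \<Rightarrow> 'e" where
  "next_residue z \<l> g = z powi ((int (low_order (initial (aug g) g)) - \<l> * aug g) div int e) * poly (residual g) z"

text \<open>Formally \<open>next_residue z \<l> g\<close> is \<open>\<eta>\<close> to the power \<open>- \<l> * aug g\<close> times the initial polynomial
  evaluated at \<open>\<eta>\<close>, for an \<open>e\<close>-th root \<open>\<eta>\<close> of \<open>z\<close>; this makes its multiplicativity evident.\<close>

lemma graded_residue_next:
  assumes irr: "irreducible_over K \<psi>" and z: "poly \<psi> z = 0" "z \<noteq> 0"
    and \<l>: "int e dvd \<l> * int h - 1"
  shows "graded_residue aug (next_residue z \<l>) {poly g z | g. g \<in> polys_over K}"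
proof -
  interpret A: field_embedding "to_ac :: 'e \<Rightarrow> 'e alg_closure" by (rule field_embedding_to_ac)
  obtain \<eta> where \<eta>: "\<eta> ^ e = to_ac z" using nth_root_exists[of e "to_ac z"] e by blast
  have \<eta>0: "\<eta> \<noteq> 0" using \<eta> z(2) e by (auto simp: power_0_left)
  have next_value: "to_ac (next_residue z \<l> g) =
    \<eta> powi (- (\<l> * aug g)) * poly (map_poly to_ac (initial (aug g) g)) \<eta>" if g: "g \<noteq> 0" for g
  proof -
    let ?s = "low_order (initial (aug g) g)"
    obtain k where k: "int ?s - \<l> * aug g = int e * k"
      using low_order_congruence[OF g \<l>] by (auto elim: dvdE)
    have "to_ac z powi k = \<eta> powi (int e * k)"
      unfolding \<eta>[symmetric] by (simp add: power_int_mult)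
    also have "int e * k = - (\<l> * aug g) + int ?s" using k by simp
    also have "\<eta> powi \<dots> = \<eta> powi (- (\<l> * aug g)) * \<eta> ^ ?s" using power_int_add[of \<eta> "- (\<l> * aug g)" "int ?s"] \<eta>0 by (simp only: power_int_of_nat simp_thms)
    finally have zk: "to_ac z powi k = \<eta> powi (- (\<l> * aug g)) * \<eta> ^ ?s" .
    have "poly (map_poly to_ac (initial (aug g) g)) \<eta> = \<eta> ^ ?s * poly (map_poly to_ac (residual g)) (\<eta> ^ e)"
      unfolding arg_cong[OF residual_decomp[OF g], of "map_poly to_ac"] A.hom_poly_mult A.hom_pcompose
      by (simp add: poly_pcompose map_poly_monom poly_monom)
    then show ?thesis using k e
      by (simp add: next_residue_def A.hom_powi A.poly_hom \<eta> zk)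
  qed
  have next_value_at: "to_ac (residue_at aug (next_residue z \<l>) N g) =
    \<eta> powi (- (\<l> * N)) * poly (map_poly to_ac (initial N g)) \<eta>" if "val_ge aug N g" for N g
  proof (cases "g \<noteq> 0 \<and> aug g = N")
    case True
    then show ?thesis using next_value[of g] by (simp add: residue_at_def)
  next
    case False
    with that have "val_ge aug (N + 1) g" by (auto simp: val_ge_def)
    then show ?thesis using False initial_eq_0[of N g] by (auto simp: residue_at_def)
  qed
  let ?K = "{poly g z | g. g \<in> polys_over K}"
  have K': "is_subfield ?K" using is_subfield_adjoin[OF K irr z(1)] .
  have "[:0, 1:] \<in> polys_over K" by (rule polys_over_X[OF K])
  then have zK: "z \<in> ?K" by (force intro: exI[of _ "[:0, 1:]"])
  show ?thesis
  proof
    show "is_valuation aug" by (rule aug_valuation)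
    show "is_subfield ?K" by (rule K')
    show "next_residue z \<l> g \<in> ?K" for g
      unfolding next_residue_def using residual_mem
      by (intro subfield_mult[OF K'] subfield_powi[OF K'] zK) blast
    show "next_residue z \<l> (g * g') = next_residue z \<l> g * next_residue z \<l> g'" if "g \<noteq> 0" "g' \<noteq> 0" for g g'
    proof -
      have "\<eta> powi (- (\<l> * (aug g + aug g'))) = \<eta> powi (- (\<l> * aug g)) * \<eta> powi (- (\<l> * aug g'))"
        using \<eta>0 by (simp add: distrib_left power_int_diff power_int_minus field_simps)
      moreover have "g * g' \<noteq> 0" using that by simp
      ultimately have "to_ac (next_residue z \<l> (g * g')) = to_ac (next_residue z \<l> g * next_residue z \<l> g')"
        using that next_value[of "g * g'"] next_value[of g] next_value[of g'] initial_aug_mult[OF that]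
        by (simp add: A.hom_poly_mult valuation_mult[OF aug_valuation])
      then show ?thesis by (simp only: to_ac_eq_iff)
    qed
    show "residue_at aug (next_residue z \<l>) N (g + g') =
        residue_at aug (next_residue z \<l>) N g + residue_at aug (next_residue z \<l>) N g'"
      if gg: "val_ge aug N g" "val_ge aug N g'" for N g g'
    proof -
      have "to_ac (residue_at aug (next_residue z \<l>) N (g + g')) =
        to_ac (residue_at aug (next_residue z \<l>) N g + residue_at aug (next_residue z \<l>) N g')"
        using next_value_at[OF val_ge_add[OF aug_valuation gg]] next_value_at[OF gg(1)] next_value_at[OF gg(2)] gg
        by (simp add: initial_add ge_iff A.hom_poly_add distrib_left)
      then show ?thesis by (simp only: to_ac_eq_iff)
    qed
  qed
qed

text \<open>Counting degrees through the expansion and the contraction leaves a residual polynomial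
  shorter than \<open>\<psi>\<close>, which cannot vanish at a root of
  \<open>\<psi>\<close>.\<close>

lemma next_residue_small:
  assumes irr: "irreducible_over K \<psi>" and z: "poly \<psi> z = 0" "z \<noteq> 0"
    and a: "a \<noteq> 0" "Polynomial.degree a < e * Polynomial.degree \<psi> * Polynomial.degree \<phi>"
  shows "next_residue z \<l> a \<noteq> 0"
proof -
  let ?p = "initial (aug a) a"
  have "ex a (Polynomial.degree ?p) \<noteq> 0"
    using initial_aug_nonzero[OF a(1)] initial_coeff_nonzero[of "aug a" a "Polynomial.degree ?p"] by simp
  from ex_nonzero_degree[OF this] a(2)
  have "Polynomial.degree ?p * Polynomial.degree \<phi> < e * Polynomial.degree \<psi> * Polynomial.degree \<phi>" by linarith
  then have "Polynomial.degree ?p < e * Polynomial.degree \<psi>" by simp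
  with residual_degree[OF a(1)] have "Polynomial.degree (residual a) * e < Polynomial.degree \<psi> * e"
    using mult.commute[of e "Polynomial.degree \<psi>"] by linarith
  then have lt: "Polynomial.degree (residual a) < Polynomial.degree \<psi>" by simp
  have "poly (residual a) z \<noteq> 0"
  proof
    assume "poly (residual a) z = 0"
    from irreducible_over_root_dvd[OF K irr residual_mem z(1) this]
    have "Polynomial.degree \<psi> \<le> Polynomial.degree (residual a)"
      using residual_nonzero[OF a(1)] by (rule Polynomial.dvd_imp_degree_le)
    with lt show False by simp
  qed
  then show ?thesis using z(2) by (simp add: next_residue_def)
qed

text \<open>The degree of \<open>\<phi>'\<close> is just enough for a residual polynomial of degree
  \<open>Polynomial.degree \<psi>\<close> starting at abscissa 0. The constant term of the initial
  form is thus non-zero, which makes \<open>e\<close> divide the value; this divisibility lets the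
  twist of the following order be a power \<open>\<zeta> ^ s\<close>.\<close>

lemma representative_aug:
  assumes \<phi>': "Polynomial.degree \<phi>' = e * Polynomial.degree \<psi> * Polynomial.degree \<phi>" "\<phi>' \<noteq> 0"
    and "residual \<phi>' = Polynomial.smult c \<psi>" "c \<noteq> 0" and z: "poly \<psi> z = 0"
  shows "next_residue z \<l> \<phi>' = 0" "int e dvd aug \<phi>'"
proof -
  show "next_residue z \<l> \<phi>' = 0" using assms by (simp add: next_residue_def)
  let ?p = "initial (aug \<phi>') \<phi>'"
  have "ex \<phi>' (Polynomial.degree ?p) \<noteq> 0"
    using initial_aug_nonzero[OF \<phi>'(2)] initial_coeff_nonzero[of "aug \<phi>'" \<phi>' "Polynomial.degree ?p"] by simp
  from ex_nonzero_degree[OF this] \<phi>'(1) degree_pos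
  have "Polynomial.degree ?p \<le> e * Polynomial.degree \<psi>" by simp
  with residual_degree[OF \<phi>'(2)] assms(3,4) have "low_order ?p = 0" by (simp add: mult.commute)
  then have "Polynomial.coeff ?p 0 \<noteq> 0" using coeff_low_order[OF initial_aug_nonzero[OF \<phi>'(2)]] by metis
  from initial_support[OF this] show "int e dvd aug \<phi>'" by simp
qed

end

text \<open>Guarantees that \<open>z\<close> is non-zero, so that the negative powers of it in the
  twist are genuine inverses.\<close>

lemma irreducible_over_root_nonzero:
  assumes K: "is_subfield K" and irr: "irreducible_over K \<psi>" and "Polynomial.lead_coeff \<psi> = 1" "\<psi> \<noteq> [:0, 1:]"
  shows "poly \<psi> 0 \<noteq> 0"
proof
  assume z: "poly \<psi> 0 = 0"
  have "[:0, 1:] \<in> polys_over K" by (rule polys_over_X[OF K])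
  from irreducible_over_root_dvd[OF K irr this z] have "\<psi> dvd [:0, 1:]" by simp
  then have "Polynomial.degree \<psi> \<le> 1" using Polynomial.dvd_imp_degree_le[of \<psi> "[:0, 1:]"] by simp
  with irreducible_over_degree_pos[OF irr K] have d: "Polynomial.degree \<psi> = 1" by simp
  have "\<psi> = [:0, 1:]"
    using d z assms(3) Polynomial.coeff_eq_0[of \<psi>]
    by (intro poly_eqI) (auto simp: Polynomial.coeff_pCons poly_0_coeff_0 numeral_2_eq_2 split: nat.splits)
  with assms(4) show False by simp
qed

section \<open>Types\<close>

lemma graded_residue_cong:
  assumes "graded_residue v \<rho> K" "\<And>g. g \<noteq> 0 \<Longrightarrow> \<rho> g = \<rho>' g"
  shows "graded_residue v \<rho>' K"
proof -
  interpret graded_residue v \<rho> K by fact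
  have "residue_at v \<rho>' = residue_at v \<rho>" using assms(2) by (auto simp: residue_at_def fun_eq_iff)
  then show ?thesis
    using assms(2) by unfold_locales (simp_all add: val K residue_add residue_mem residue_mult flip: assms(2))
qed

locale residue_data =
  fixes D :: "('k::field, 'e::field) type_data"
  assumes val0: "discrete_valuation (val0 D)" and unif: "val0 D (unif D) = 1" "unif D \<noteq> 0"
    and reduction: "reduction_map (val0 D) (red D)"
begin

lemmas val0' = discrete_valuation_is_valuation[OF val0]

abbreviation "res_field \<equiv> red D ` valuation_ring (val0 D)"

lemma red_hom:
  shows red_add: "val_ge (val0 D) 0 x \<Longrightarrow> val_ge (val0 D) 0 y \<Longrightarrow> red D (x + y) = red D x + red D y"
    and red_mult: "val_ge (val0 D) 0 x \<Longrightarrow> val_ge (val0 D) 0 y \<Longrightarrow> red D (x * y) = red D x * red D y"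
    and red_1: "red D 1 = 1"
    and red_eq_0: "val_ge (val0 D) 0 x \<Longrightarrow> red D x = 0 \<longleftrightarrow> val_ge (val0 D) 1 x"
  using reduction unfolding reduction_map_def ring_hom_def valuation_ring_def ring_of_type_algebra_def
  by auto

lemma red_0: "red D 0 = 0"
  using red_eq_0[of 0] by simp

lemma red_sum: "(\<And>i. i \<in> I \<Longrightarrow> val_ge (val0 D) 0 (f i)) \<Longrightarrow> red D (sum f I) = (\<Sum>i\<in>I. red D (f i))"
  by (induction I rule: infinite_finite_induct) (auto simp: red_0 red_add val_ge_sum[OF val0'])

lemma res_field: "is_subfield res_field"
proof -
  have mem: "red D x \<in> res_field" if "val_ge (val0 D) 0 x" for x
    using that by (auto simp: valuation_ring_def)
  have "val_ge (val0 D) 0 1" by (simp add: val_ge_def valuation_1[OF val0'])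
  show ?thesis
    unfolding is_subfield_def
  proof (intro conjI ballI)
    show "0 \<in> res_field" "1 \<in> res_field" using mem[of 0] mem[OF \<open>val_ge (val0 D) 0 1\<close>] by (simp_all add: red_0 red_1)
    fix r assume "r \<in> res_field"
    then obtain x where x: "r = red D x" "val_ge (val0 D) 0 x" by (auto simp: valuation_ring_def)
    show "inverse r \<in> res_field"
    proof (cases "r = 0")
      case True
      then show ?thesis using \<open>0 \<in> res_field\<close> by simp
    next
      case False
      with x red_eq_0[of x] have v: "x \<noteq> 0" "val0 D x = 0" by (auto simp: val_ge_def)
      then have i: "val_ge (val0 D) 0 (inverse x)" using valuation_inverse[OF val0', of x] by (simp add: val_ge_def)
      have "r * red D (inverse x) = 1" using v red_mult[OF x(2) i] x by (simp add: red_1)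
      then have "inverse r = red D (inverse x)" by (rule inverse_unique)
      with mem[OF i] show ?thesis by simp
    qed
    fix r' assume "r' \<in> res_field"
    then obtain y where y: "r' = red D y" "val_ge (val0 D) 0 y" by (auto simp: valuation_ring_def)
    have "red D (x - y) + red D y = red D x" using red_add[OF val_ge_diff[OF val0' x(2) y(2)] y(2)] by simp
    then have "r - r' = red D (x - y)" using x y by (simp add: algebra_simps)
    then show "r - r' \<in> res_field" using mem[OF val_ge_diff[OF val0' x(2) y(2)]] by simp
    show "r * r' \<in> res_field" using mem[OF val_ge_mult[OF val0' x(2) y(2), simplified]] red_mult[OF x(2) y(2)] x y by simp
  qed
qed

section \<open>The Gauss valuation, for types of order 0\<close>

definition gauss :: "'k poly \<Rightarrow> int" where
  "gauss g = Min {val0 D (Polynomial.coeff g n) | n. Polynomial.coeff g n \<noteq> 0}"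

definition reduct :: "int \<Rightarrow> 'k poly \<Rightarrow> 'e poly" where
  "reduct N g = map_poly (red D) (Polynomial.smult (unif D powi (- N)) g)"

lemma coeff_reduct: "Polynomial.coeff (reduct N g) n = red D (unif D powi (- N) * Polynomial.coeff g n)"
  by (simp add: reduct_def coeff_map_poly red_0)

lemma gauss_set: "{val0 D (Polynomial.coeff g n) | n. Polynomial.coeff g n \<noteq> 0}
    = (\<lambda>n. val0 D (Polynomial.coeff g n)) ` {n. Polynomial.coeff g n \<noteq> 0}"
  "finite {n. Polynomial.coeff g n \<noteq> 0}"
  using Polynomial.MOST_coeff_eq_0[of g] by (auto simp: eventually_cofinite)

lemma gauss_le: "Polynomial.coeff g n \<noteq> 0 \<Longrightarrow> gauss g \<le> val0 D (Polynomial.coeff g n)"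
  unfolding gauss_def gauss_set(1) using gauss_set(2) by (intro Min_le) auto

lemma gauss_attained: "g \<noteq> 0 \<Longrightarrow> \<exists>n. Polynomial.coeff g n \<noteq> 0 \<and> val0 D (Polynomial.coeff g n) = gauss g"
  using Min_in[of "(\<lambda>n. val0 D (Polynomial.coeff g n)) ` {n. Polynomial.coeff g n \<noteq> 0}"] gauss_set(2)[of g]
    Polynomial.leading_coeff_0_iff[of g]
  unfolding gauss_def gauss_set(1) by fastforce

lemma gauss_ge_iff: "val_ge gauss N g \<longleftrightarrow> (\<forall>n. val_ge (val0 D) N (Polynomial.coeff g n))"
proof (cases "g = 0")
  case False
  from gauss_attained[OF this] obtain n where "Polynomial.coeff g n \<noteq> 0" "val0 D (Polynomial.coeff g n) = gauss g" by blast
  with gauss_le[of g] False show ?thesis unfolding val_ge_def by (metis order.trans)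
qed simp

lemma unif_powi: "unif D powi n \<noteq> 0" "val0 D (unif D powi n) = n"
  using unif valuation_powi[OF val0', of "unif D" n] by simp_all

lemma val_ge_scaled: "val_ge (val0 D) M (unif D powi (- N) * x) \<longleftrightarrow> val_ge (val0 D) (N + M) x"
  using valuation_mult[OF val0' unif_powi(1), of x "- N"] unif
  by (cases "x = 0") (auto simp: val_ge_def unif_powi)

lemma reduct_add:
  assumes "val_ge gauss N g" "val_ge gauss N g'"
  shows "reduct N (g + g') = reduct N g + reduct N g'"
  using assms by (intro poly_eqI)
    (simp add: coeff_reduct distrib_left red_add val_ge_scaled gauss_ge_iff)

lemma reduct_mult:
  assumes g: "val_ge gauss N g" and g': "val_ge gauss M g'"
  shows "val_ge gauss (N + M) (g * g')" "reduct (N + M) (g * g') = reduct N g * reduct M g'"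
proof -
  show "val_ge gauss (N + M) (g * g')"
    using assms unfolding gauss_ge_iff
    by (auto simp: Polynomial.coeff_mult intro!: val_ge_sum[OF val0'] val_ge_mult[OF val0'])
  show "reduct (N + M) (g * g') = reduct N g * reduct M g'"
  proof (rule poly_eqI)
    fix n
    let ?c = "\<lambda>i. unif D powi (- N) * Polynomial.coeff g i" and ?d = "\<lambda>i. unif D powi (- M) * Polynomial.coeff g' i"
    have O: "val_ge (val0 D) 0 (?c i)" "val_ge (val0 D) 0 (?d i)" for i
      using assms by (simp_all add: val_ge_scaled gauss_ge_iff)
    have "unif D powi (- (N + M)) = unif D powi (- N) * unif D powi (- M)"
      using power_int_add[of "unif D" "- N" "- M"] unif by simp
    then have "unif D powi (- (N + M)) * Polynomial.coeff (g * g') n = (\<Sum>i\<le>n. ?c i * ?d (n - i))"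
      by (simp add: Polynomial.coeff_mult sum_distrib_left ac_simps)
    then show "Polynomial.coeff (reduct (N + M) (g * g')) n = Polynomial.coeff (reduct N g * reduct M g') n"
      using val_ge_mult[OF val0' O(1) O(2)]
      by (simp only: coeff_reduct Polynomial.coeff_mult red_sum red_mult O add_0)
  qed
qed

lemma reduct_eq_0_iff:
  assumes "val_ge gauss N g"
  shows "reduct N g = 0 \<longleftrightarrow> val_ge gauss (N + 1) g"
  using assms by (auto simp: poly_eq_iff coeff_reduct red_eq_0 val_ge_scaled gauss_ge_iff)

lemma reduct_gauss_nonzero: "g \<noteq> 0 \<Longrightarrow> reduct (gauss g) g \<noteq> 0"
  using reduct_eq_0_iff[OF val_ge_self, of g] by (simp add: val_ge_def)

lemma gauss_valuation: "is_valuation gauss"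
  unfolding is_valuation_def
proof (intro conjI allI impI)
  fix g g' :: "'k poly" assume g: "g \<noteq> 0 \<and> g' \<noteq> 0"
  let ?N = "gauss g + gauss g'"
  note m = reduct_mult[OF val_ge_self val_ge_self, of g g']
  have "reduct ?N (g * g') \<noteq> 0" using m(2) g reduct_gauss_nonzero by simp
  then have "\<not> val_ge gauss (?N + 1) (g * g')" using reduct_eq_0_iff[OF m(1)] by simp
  with m(1) show "gauss (g * g') = ?N" by (auto simp: val_ge_def)
next
  fix g g' N assume "val_ge gauss N g \<and> val_ge gauss N g'"
  then show "val_ge gauss N (g + g')" by (simp add: gauss_ge_iff val_ge_add[OF val0'])
qed

lemma gauss_const: "c \<noteq> 0 \<Longrightarrow> gauss [:c:] = val0 D c"
proof -
  assume "c \<noteq> 0"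
  then obtain n where "Polynomial.coeff [:c:] n \<noteq> 0" "val0 D (Polynomial.coeff [:c:] n) = gauss [:c:]"
    using gauss_attained[of "[:c:]"] by auto
  then show ?thesis by (cases n) auto
qed

lemma reduct_mem: "val_ge gauss N g \<Longrightarrow> reduct N g \<in> polys_over res_field"
  by (auto simp: polys_over_def coeff_reduct valuation_ring_def val_ge_scaled gauss_ge_iff)

lemma degree_reduct: "Polynomial.degree (reduct N g) \<le> Polynomial.degree g"
  by (rule Polynomial.degree_le) (simp add: coeff_reduct Polynomial.coeff_eq_0 red_0)

lemma graded_residue_gauss:
  assumes irr: "irreducible_over res_field \<psi>" and z: "poly \<psi> z = 0"
  shows "graded_residue gauss (\<lambda>g. poly (reduct (gauss g) g) z) {poly g z | g. g \<in> polys_over res_field}"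
    and "\<And>a. a \<noteq> 0 \<Longrightarrow> Polynomial.degree a < Polynomial.degree \<psi> \<Longrightarrow> poly (reduct (gauss a) a) z \<noteq> 0"
proof -
  let ?\<rho> = "\<lambda>g. poly (reduct (gauss g) g) z"
  have at: "residue_at gauss ?\<rho> N g = poly (reduct N g) z" if "val_ge gauss N g" for N g
  proof (cases "g \<noteq> 0 \<and> gauss g = N")
    case False
    with that have "val_ge gauss (N + 1) g" by (auto simp: val_ge_def)
    then have "reduct N g = 0" using reduct_eq_0_iff[OF that] by simp
    with False show ?thesis by (auto simp: residue_at_def)
  qed (auto simp: residue_at_def)
  show "graded_residue gauss ?\<rho> {poly g z | g. g \<in> polys_over res_field}"
  proof
    show "is_valuation gauss" by (rule gauss_valuation)
    show "is_subfield {poly g z | g. g \<in> polys_over res_field}" using is_subfield_adjoin[OF res_field irr z] .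
    show "?\<rho> g \<in> {poly g z | g. g \<in> polys_over res_field}" for g using reduct_mem[OF val_ge_self] by blast
    show "?\<rho> (g * g') = ?\<rho> g * ?\<rho> g'" if "g \<noteq> 0" "g' \<noteq> 0" for g g'
      using reduct_mult(2)[OF val_ge_self val_ge_self, of g g'] valuation_mult[OF gauss_valuation that] by simp
    show "residue_at gauss ?\<rho> N (g + g') = residue_at gauss ?\<rho> N g + residue_at gauss ?\<rho> N g'"
      if "val_ge gauss N g" "val_ge gauss N g'" for N g g'
      using at[OF val_ge_add[OF gauss_valuation that]] at[OF that(1)] at[OF that(2)] reduct_add[OF that] by simp
  qed
  show "poly (reduct (gauss a) a) z \<noteq> 0" if a: "a \<noteq> 0" "Polynomial.degree a < Polynomial.degree \<psi>" for a
  proof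
    assume "poly (reduct (gauss a) a) z = 0"
    from irreducible_over_root_dvd[OF res_field irr reduct_mem[OF val_ge_self] z this]
    have "Polynomial.degree \<psi> \<le> Polynomial.degree (reduct (gauss a) a)"
      using reduct_gauss_nonzero[OF a(1)] by (rule Polynomial.dvd_imp_degree_le)
    with degree_reduct[of "gauss a" a] a(2) show False by simp
  qed
qed

text \<open>The factor \<open>c\<^sub>s\<close> attached to a coefficient \<open>a\<close> in the residual polynomial of the next level
  is \<open>type_residue D t a\<close> times \<open>\<zeta>\<^sup>s\<close>, where \<open>\<zeta>\<close> is a power of \<open>z\<^bsub>i-1\<^esub>\<close>.\<close>

definition type_residue :: "('k, 'e) om_type \<Rightarrow> 'k poly \<Rightarrow> 'e" where
  "type_residue t g = zc D (type_order t) powi (case t of Type0 _ \<Rightarrow> 0 | Extend t' \<phi>' h' e' _ \<Rightarrow>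
     (\<lfloor>left_abscissa (component (slope h' e') (newton_polygon D t' \<phi>' g))\<rfloor>
       - ell D (type_order t) * type_val D t g) div int e') *
   poly (type_residual D t g) (zc D (type_order t))"

text \<open>The induction invariant over the order of a type. Its last clause provides what
  \<open>key_polynomial\<close> demands of a representative; in particular one constant
  \<open>\<zeta>\<close>, independent of \<open>g\<close> and \<open>s\<close>, must account for the
  difference between the twist at \<open>a * \<phi> ^ s\<close> and at \<open>a\<close>.\<close>

definition regular :: "('k, 'e) om_type \<Rightarrow> bool" where
  "regular t \<longleftrightarrow> graded_residue (type_val D t) (type_residue t) (type_field D t) \<and> type_deg t > 0 \<and>
     (\<forall>a. a \<noteq> 0 \<and> Polynomial.degree a < type_deg t \<longrightarrow> type_residue t a \<noteq> 0) \<and>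
     (\<forall>c. c \<noteq> 0 \<longrightarrow> type_val D t [:c:] = int (type_eprod t) * val0 D c) \<and> type_eprod t > 0 \<and>
     (\<forall>\<phi>. is_representative D t \<phi> \<longrightarrow> type_residue t \<phi> = 0 \<and>
        (\<exists>\<zeta>\<in>type_field D t. \<zeta> \<noteq> 0 \<and> (\<forall>g s. expansion_coeff \<phi> g s \<noteq> 0 \<longrightarrow>
           zc D (type_order t) powi twist_exponent D t \<phi> g s *
             poly (type_residual D t (expansion_coeff \<phi> g s)) (zc D (type_order t))
           = type_residue t (expansion_coeff \<phi> g s) * \<zeta> ^ s)))"

lemma regular_Type0:
  assumes "is_type D (Type0 \<psi>)"
  shows "regular (Type0 \<psi>)"
proof -
  have irr: "irreducible_over res_field \<psi>" and z: "poly \<psi> (zc D 0) = 0" using assms by auto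
  have tv: "type_val D (Type0 \<psi>) = gauss" by (simp add: gauss_def fun_eq_iff)
  have tr: "type_residual D (Type0 \<psi>) = (\<lambda>g. reduct (gauss g) g)" by (simp add: gauss_def reduct_def fun_eq_iff)
  have \<rho>: "type_residue (Type0 \<psi>) = (\<lambda>g. poly (reduct (gauss g) g) (zc D 0))"
    unfolding type_residue_def tr by simp
  note G = graded_residue_gauss[OF irr z]
  interpret G: graded_residue gauss "\<lambda>g. poly (reduct (gauss g) g) (zc D 0)" "{poly g (zc D 0) | g. g \<in> polys_over res_field}"
    by (rule G(1))
  have rep: "type_residue (Type0 \<psi>) \<phi> = 0" if "is_representative D (Type0 \<psi>) \<phi>" for \<phi>
    using that z unfolding is_representative_def tr \<rho> by auto
  have one: "1 \<in> {poly g (zc D 0) | g. g \<in> polys_over res_field}" using subfield_1[OF G.K] .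
  show ?thesis
    unfolding regular_def tv
  proof (intro conjI allI impI)
    show "graded_residue gauss (type_residue (Type0 \<psi>)) (type_field D (Type0 \<psi>))" using G(1) by (simp add: \<rho>)
    show "type_deg (Type0 \<psi>) > 0" using irreducible_over_degree_pos[OF irr res_field] by simp
    show "type_residue (Type0 \<psi>) a \<noteq> 0" if "a \<noteq> 0 \<and> Polynomial.degree a < type_deg (Type0 \<psi>)" for a
      using that G(2) by (simp add: \<rho>)
    show "gauss [:c:] = int (type_eprod (Type0 \<psi>)) * val0 D c" if "c \<noteq> 0" for c using gauss_const[OF that] by simp
    show "type_residue (Type0 \<psi>) \<phi> = 0" if "is_representative D (Type0 \<psi>) \<phi>" for \<phi> using rep[OF that] .
    show "\<exists>\<zeta>\<in>type_field D (Type0 \<psi>). \<zeta> \<noteq> 0 \<and> (\<forall>g s. expansion_coeff \<phi> g s \<noteq> 0 \<longrightarrow>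
           zc D (type_order (Type0 \<psi>)) powi twist_exponent D (Type0 \<psi>) \<phi> g s *
             poly (type_residual D (Type0 \<psi>) (expansion_coeff \<phi> g s)) (zc D (type_order (Type0 \<psi>)))
           = type_residue (Type0 \<psi>) (expansion_coeff \<phi> g s) * \<zeta> ^ s)" for \<phi>
      using one by (intro bexI[of _ 1]) (simp_all add: type_residue_def)
  qed simp
qed

end

section \<open>Concrete residual operators as instances of the abstract ones, and the induction
  step\<close>

locale type_level = residue_data D
  for D :: "('k::field, 'e::field) type_data" +
  fixes t :: "('k, 'e) om_type" and \<phi> :: "'k poly" and h e :: nat
  assumes reg: "regular t" and rep: "is_representative D t \<phi>"
    and h_pos: "h > 0" and e_pos: "e > 0" and cop: "coprime h e"
begin

definition \<zeta> :: 'e where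
  "\<zeta> = (SOME \<zeta>. \<zeta> \<in> type_field D t \<and> \<zeta> \<noteq> 0 \<and> (\<forall>g s. expansion_coeff \<phi> g s \<noteq> 0 \<longrightarrow>
           zc D (type_order t) powi twist_exponent D t \<phi> g s *
             poly (type_residual D t (expansion_coeff \<phi> g s)) (zc D (type_order t))
           = type_residue t (expansion_coeff \<phi> g s) * \<zeta> ^ s))"

lemma zeta: "\<zeta> \<in> type_field D t" "\<zeta> \<noteq> 0"
  "expansion_coeff \<phi> g s \<noteq> 0 \<Longrightarrow> zc D (type_order t) powi twist_exponent D t \<phi> g s *
     poly (type_residual D t (expansion_coeff \<phi> g s)) (zc D (type_order t))
     = type_residue t (expansion_coeff \<phi> g s) * \<zeta> ^ s"
proof -
  have "\<exists>\<zeta>. \<zeta> \<in> type_field D t \<and> \<zeta> \<noteq> 0 \<and> (\<forall>g s. expansion_coeff \<phi> g s \<noteq> 0 \<longrightarrow>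
           zc D (type_order t) powi twist_exponent D t \<phi> g s *
             poly (type_residual D t (expansion_coeff \<phi> g s)) (zc D (type_order t))
           = type_residue t (expansion_coeff \<phi> g s) * \<zeta> ^ s)"
    using reg rep unfolding regular_def by blast
  from someI_ex[OF this, folded \<zeta>_def]
  show "\<zeta> \<in> type_field D t" "\<zeta> \<noteq> 0" "expansion_coeff \<phi> g s \<noteq> 0 \<Longrightarrow> zc D (type_order t) powi twist_exponent D t \<phi> g s *
     poly (type_residual D t (expansion_coeff \<phi> g s)) (zc D (type_order t))
     = type_residue t (expansion_coeff \<phi> g s) * \<zeta> ^ s" by blast+
qed

lemma degree_rep: "Polynomial.degree \<phi> = type_deg t"
  using rep by (simp add: is_representative_def)

sublocale key_polynomial "type_val D t" "type_residue t" "type_field D t" \<phi> h e \<zeta>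
proof -
  interpret graded_residue "type_val D t" "type_residue t" "type_field D t"
    using reg by (simp add: regular_def)
  show "key_polynomial (type_val D t) (type_residue t) (type_field D t) \<phi> h e \<zeta>"
    using reg rep zeta h_pos e_pos cop
    by unfold_locales (auto simp: regular_def is_representative_def)
qed

lemma slope_neg: "slope h e < 0"
  using h_pos e_pos by (simp add: slope_def)

lemma type_val_Extend: "type_val D (Extend t \<phi> h e \<psi>) = aug"
  by (simp add: aug_def fun_eq_iff)

lemma newton_polygon_eq:
  "newton_polygon D t \<phi> g = point_polygon.N {s. ex g s \<noteq> 0} (\<lambda>s. real_of_int (type_val D t (ex g s * \<phi> ^ s)))"
  if "g \<noteq> 0"
  unfolding newton_polygon_def point_polygon.N_def[OF point_polygon[OF that]]
  by (rule arg_cong[of _ _ lower_hull]) auto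

context
  fixes g :: "'k poly"
  assumes g: "g \<noteq> 0"
begin

interpretation P: point_polygon "{s. ex g s \<noteq> 0}" "\<lambda>s. real_of_int (type_val D t (ex g s * \<phi> ^ s))"
  by (rule point_polygon[OF g])

lemma left_component_polygon:
  "left_abscissa (component (slope h e) (newton_polygon D t \<phi> g)) = real (low_order (initial (aug g) g))"
  using P.left_component[of "slope h e"] by (simp add: newton_polygon_eq[OF g] Min_J_eq[OF g])

lemma right_component_polygon:
  "right_abscissa (component (slope h e) (newton_polygon D t \<phi> g)) = real (Polynomial.degree (initial (aug g) g))"
  using P.right_component[of "slope h e"] by (simp add: newton_polygon_eq[OF g] Max_J_eq[OF g])

text \<open>Within the range of the component, lying on the negative polygon means having minimal
  weight, and \<open>zeta\<close> rewrites the twisted coefficient as \<open>\<rho>\<close> times a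
  power of \<open>\<zeta>\<close>.\<close>

lemma residual_coeff_eq:
  assumes "low_order (initial (aug g) g) \<le> s" "s \<le> Polynomial.degree (initial (aug g) g)"
  shows "residual_coeff D t (type_residual D t) \<phi> g s = Polynomial.coeff (initial (aug g) g) s"
proof (cases "ex g s \<noteq> 0")
  case True
  have "(real s, of_int (type_val D t (ex g s * \<phi> ^ s))) \<in> neg_newton_polygon D t \<phi> g
    \<longleftrightarrow> Polynomial.coeff (initial (aug g) g) s \<noteq> 0"
    unfolding newton_polygon_eq[OF g]
    using P.negative_part_iff[OF slope_neg, of s, unfolded Min_J_eq[OF g] Max_J_eq[OF g]] True assms
    by (simp add: J_eq[OF g])
  moreover have "Polynomial.coeff (initial (aug g) g) s \<noteq> 0 \<Longrightarrow>
     Polynomial.coeff (initial (aug g) g) s = type_residue t (ex g s) * \<zeta> ^ s"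
    unfolding coeff_initial initial_coeff_def by (auto split: if_splits)
  ultimately show ?thesis using zeta(3)[OF True] True by (auto simp: residual_coeff_def Let_def)
next
  case False
  then show ?thesis by (simp add: residual_coeff_def coeff_initial initial_coeff_def)
qed

lemma slope_residual_eq: "slope_residual D t (type_residual D t) \<phi> h e g = residual g"
proof -
  let ?p = "initial (aug g) g"
  have p: "?p \<noteq> 0" using initial_aug_nonzero[OF g] .
  have d: "nat \<lfloor>(real (Polynomial.degree ?p) - real (low_order ?p)) / real e\<rfloor> = (Polynomial.degree ?p - low_order ?p) div e"
    using low_order_le_degree[OF p] by (simp add: floor_divide_of_nat_eq flip: of_nat_diff)
  have "residual_coeff D t (type_residual D t) \<phi> g (low_order ?p + j * e) = Polynomial.coeff ?p (low_order ?p + j * e)"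
    if "j \<le> (Polynomial.degree ?p - low_order ?p) div e" for j
  proof (rule residual_coeff_eq)
    have "j * e \<le> (Polynomial.degree ?p - low_order ?p) div e * e" using that by (rule mult_le_mono1)
    also have "\<dots> \<le> Polynomial.degree ?p - low_order ?p" by simp
    finally show "low_order ?p + j * e \<le> Polynomial.degree ?p" using low_order_le_degree[OF p] by linarith
  qed simp
  then show ?thesis
    unfolding slope_residual_def Let_def left_component_polygon right_component_polygon d residual_def contract_def
    by (intro sum.cong) auto
qed

end

lemma aug_const:
  assumes "c \<noteq> 0"
  shows "aug [:c:] = int (type_eprod t) * int e * val0 D c"
proof -
  have "ex ([:c:] * \<phi> ^ 0) s = (if s = 0 then [:c:] else 0)" for s using degree_pos by (intro ex_term) simp
  then have "ex [:c:] s = (if s = 0 then [:c:] else 0)" for s by simp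
  moreover from aug_attained[of "[:c:]"] assms obtain s where "ex [:c:] s \<noteq> 0" "wt s (ex [:c:] s) = aug [:c:]" by auto
  ultimately have "aug [:c:] = int e * type_val D t [:c:]" by (auto simp: wt_def split: if_splits)
  then show ?thesis using reg assms by (simp add: regular_def)
qed

lemma regular_Extend:
  assumes t': "is_type D (Extend t \<phi> h e \<psi>)"
  shows "regular (Extend t \<phi> h e \<psi>)"
proof -
  let ?t = "Extend t \<phi> h e \<psi>" and ?z = "zc D (Suc (type_order t))" and ?l = "ell D (Suc (type_order t))"
  have irr: "irreducible_over (type_field D t) \<psi>" and z: "poly \<psi> ?z = 0" and
    lead: "Polynomial.lead_coeff \<psi> = 1" "\<psi> \<noteq> [:0, 1:]" and
    bez: "?l * int h - ell' D (Suc (type_order t)) * int e = 1"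
    using t' by auto
  have z0: "?z \<noteq> 0" using irreducible_over_root_nonzero[OF K irr lead] z by auto
  have "?l * int h - 1 = int e * ell' D (Suc (type_order t))" using bez by (simp add: algebra_simps)
  then have l: "int e dvd ?l * int h - 1" by simp
  have tres: "type_residual D ?t g = residual g" if "g \<noteq> 0" for g using slope_residual_eq[OF that] by simp
  have res: "next_residue ?z ?l g = type_residue ?t g" if "g \<noteq> 0" for g
    unfolding type_residue_def[of ?t] tres[OF that] type_val_Extend next_residue_def
    by (simp add: left_component_polygon[OF that])
  have G: "graded_residue aug (type_residue ?t) (type_field D ?t)"
    using graded_residue_cong[OF graded_residue_next[OF irr z z0 l] res] by simp
  interpret G: graded_residue aug "type_residue ?t" "type_field D ?t" by (rule G)
  have zmem: "?z \<in> type_field D ?t"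
  proof -
    have "[:0, 1:] \<in> polys_over (type_field D t)" by (rule polys_over_X[OF K])
    then show ?thesis by (force intro: exI[of _ "[:0, 1:]"])
  qed
  have degpos: "type_deg ?t > 0"
    using irreducible_over_degree_pos[OF irr K] e_pos reg by (simp add: regular_def)
  show ?thesis
    unfolding regular_def type_val_Extend
  proof (intro conjI allI impI)
    show "graded_residue aug (type_residue ?t) (type_field D ?t)" by (rule G)
    show "type_deg ?t > 0" by (rule degpos)
    show "type_residue ?t a \<noteq> 0" if "a \<noteq> 0 \<and> Polynomial.degree a < type_deg ?t" for a
      using that next_residue_small[OF irr z z0, of a ?l] res[of a] degree_rep by simp
    show "aug [:c:] = int (type_eprod ?t) * val0 D c" if "c \<noteq> 0" for c using aug_const[OF that] by simp
    show "type_eprod ?t > 0" using reg e_pos by (simp add: regular_def)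
    fix \<phi>' assume r: "is_representative D ?t \<phi>'"
    then have \<phi>'0: "\<phi>' \<noteq> 0" unfolding is_representative_def using degpos by auto
    from r obtain c where c: "c \<noteq> 0" "residual \<phi>' = Polynomial.smult c \<psi>"
      "Polynomial.degree \<phi>' = e * Polynomial.degree \<psi> * Polynomial.degree \<phi>"
      unfolding is_representative_def tres[OF \<phi>'0] degree_rep by auto
    note ra = representative_aug[OF c(3) \<phi>'0 c(2,1) z]
    show "type_residue ?t \<phi>' = 0" using ra(1) res[OF \<phi>'0] by simp
    obtain k where k: "aug \<phi>' = int e * k" using ra(2) by (auto elim: dvdE)
    \<comment> \<open>Passing from \<open>a\<close> to \<open>a * \<phi>' ^ s\<close> raises the
      value by \<open>s * e * k\<close>; the twist exponent, after division by \<open>e\<close>,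
      drops by \<open>?l * k * s\<close>.\<close>
    define \<zeta>' where "\<zeta>' = ?z powi (- (?l * k))"
    show "\<exists>\<zeta>\<in>type_field D ?t. \<zeta> \<noteq> 0 \<and> (\<forall>g s. expansion_coeff \<phi>' g s \<noteq> 0 \<longrightarrow>
           zc D (type_order ?t) powi twist_exponent D ?t \<phi>' g s *
             poly (type_residual D ?t (expansion_coeff \<phi>' g s)) (zc D (type_order ?t))
           = type_residue ?t (expansion_coeff \<phi>' g s) * \<zeta> ^ s)"
    proof (intro bexI conjI allI impI)
      show "\<zeta>' \<in> type_field D ?t" unfolding \<zeta>'_def by (rule subfield_powi[OF G.K zmem])
      show "\<zeta>' \<noteq> 0" using z0 by (simp add: \<zeta>'_def)
      fix g s
      let ?a = "expansion_coeff \<phi>' g s"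
      assume a: "?a \<noteq> 0"
      define n where "n = int (low_order (initial (aug ?a) ?a)) - ?l * aug ?a"
      have "aug (?a * \<phi>' ^ s) = aug ?a + int s * (int e * k)"
        using a \<phi>'0 by (simp add: valuation_mult[OF aug_valuation] valuation_power[OF aug_valuation] k)
      then have "int (low_order (initial (aug ?a) ?a)) - ?l * aug (?a * \<phi>' ^ s) = n + (- (?l * k) * int s) * int e"
        by (simp add: n_def algebra_simps)
      then have "twist_exponent D ?t \<phi>' g s = n div int e + (- (?l * k) * int s)"
        using e_pos unfolding twist_exponent.simps type_val_Extend left_component_polygon[OF a]
        by (simp del: mult_minus_left add: div_mult_self1)
      then have "?z powi twist_exponent D ?t \<phi>' g s = ?z powi (n div int e) * \<zeta>' ^ s"
        using z0 by (simp only: power_int_add power_int_mult power_int_of_nat \<zeta>'_def simp_thms)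
      moreover have "type_residue ?t ?a = ?z powi (n div int e) * poly (residual ?a) ?z"
        using res[OF a] by (simp add: next_residue_def n_def)
      ultimately show "zc D (type_order ?t) powi twist_exponent D ?t \<phi>' g s *
             poly (type_residual D ?t ?a) (zc D (type_order ?t)) = type_residue ?t ?a * \<zeta>' ^ s"
        unfolding tres[OF a] type_order.simps by simp
    qed
  qed
qed

end

lemma (in residue_data) regular_type: "is_type D t \<Longrightarrow> regular t"
proof (induction t)
  case (Type0 \<psi>)
  then show ?case by (rule regular_Type0)
next
  case (Extend t \<phi> h e \<psi>)
  then interpret type_level D t \<phi> h e by unfold_locales auto
  show ?case using Extend.prems by (rule regular_Extend)
qed

section \<open>The valuation at a prime of a Dedekind domain\<close>

lemma ring_of_type_algebra_simps [simp]:
  fixes x y :: "'a::comm_ring_1"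
  shows "x \<otimes>\<^bsub>ring_of_type_algebra\<^esub> y = x * y" "x \<oplus>\<^bsub>ring_of_type_algebra\<^esub> y = x + y"
    "\<one>\<^bsub>ring_of_type_algebra\<^esub> = (1::'a)" "\<zero>\<^bsub>ring_of_type_algebra\<^esub> = (0::'a)"
    "carrier (ring_of_type_algebra :: 'a ring) = UNIV"
  by (simp_all add: ring_of_type_algebra_def)

lemma ring_on_simps [simp]:
  "carrier (ring_on A) = A" "x \<otimes>\<^bsub>ring_on A\<^esub> y = x * y" "x \<oplus>\<^bsub>ring_on A\<^esub> y = x + y"
  "\<one>\<^bsub>ring_on A\<^esub> = 1" "\<zero>\<^bsub>ring_on A\<^esub> = 0"
  by (simp_all add: ring_of_type_algebra_def)

lemma ring_on_uminus:
  assumes "ring (ring_on A)" "x \<in> A"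
  shows "- x \<in> A"
proof -
  interpret R: ring "ring_on A" by fact
  have "\<ominus>\<^bsub>ring_on A\<^esub> x \<in> A" using R.a_inv_closed[of x] assms(2) by simp
  moreover have "x + \<ominus>\<^bsub>ring_on A\<^esub> x = 0" using R.r_neg[of x] assms(2) by simp
  ultimately show ?thesis by (simp add: add_eq_0_iff)
qed

lemma ideal_ring_onI:
  assumes R: "ring (ring_on A)" and "I \<subseteq> A" "0 \<in> I" and add: "\<And>x y. x \<in> I \<Longrightarrow> y \<in> I \<Longrightarrow> x + y \<in> I"
    and mult: "\<And>a x. a \<in> A \<Longrightarrow> x \<in> I \<Longrightarrow> a * x \<in> I"
  shows "ideal I (ring_on A)"
proof -
  interpret R: ring "ring_on A" by fact
  have "1 \<in> A" using R.one_closed by simp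
  from mult[OF ring_on_uminus[OF R this]] have neg: "x \<in> I \<Longrightarrow> - x \<in> I" for x by simp
  show ?thesis
  proof (rule idealI[OF R])
    show "subgroup I (add_monoid (ring_on A))"
    proof (rule group.subgroupI)
      show "group (add_monoid (ring_on A))" by (rule R.add.is_group)
      show "inv\<^bsub>add_monoid (ring_on A)\<^esub> x \<in> I" if "x \<in> I" for x
      proof -
        have "inv\<^bsub>add_monoid (ring_on A)\<^esub> x = - x"
          using that assms(2) neg[OF that] R.minus_equality[of "- x" x] unfolding a_inv_def by auto
        with neg[OF that] show ?thesis by simp
      qed
    qed (use assms(2,3) add in auto)
    show "a \<otimes>\<^bsub>ring_on A\<^esub> x \<in> I" "x \<otimes>\<^bsub>ring_on A\<^esub> a \<in> I" if "x \<in> I" "a \<in> carrier (ring_on A)" for a x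
      using mult[of a x] that by (simp_all add: mult.commute)
  qed
qed

text \<open>Serves to show that \<open>\<pi>\<close>, given as a generator of the maximal ideal of
  the localization, has value 1 for \<open>prime_val\<close>, which is defined by powers of
  \<open>p\<close> inside \<open>A\<close>.\<close>

locale dedekind_prime =
  fixes A p :: "'a::field set" and \<pi> :: 'a
  assumes dedekind: "dedekind_domain_of_fractions A" and prime: "primeideal p (ring_on A)"
    and p_nonzero: "p \<noteq> {0}" and \<pi>: "\<pi> \<in> A" and gen: "generates_max_ideal A p \<pi>"
begin

sublocale R: noetherian_domain "ring_on A"
  using dedekind by (simp add: dedekind_domain_of_fractions_def)

lemma A_0: "0 \<in> A" and A_1: "1 \<in> A" and A_add: "x \<in> A \<Longrightarrow> y \<in> A \<Longrightarrow> x + y \<in> A"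
  and A_mult: "x \<in> A \<Longrightarrow> y \<in> A \<Longrightarrow> x * y \<in> A"
  using R.zero_closed R.one_closed R.a_closed[of x y] R.m_closed[of x y]
  by simp_all

lemma A_power: "x \<in> A \<Longrightarrow> x ^ n \<in> A"
  by (induction n) (auto intro: A_1 A_mult)

lemma p_ideal: "ideal p (ring_on A)"
  using prime by (rule primeideal.axioms(1))

lemma p_sub: "x \<in> p \<Longrightarrow> x \<in> A" and p_0: "0 \<in> p" and p_add: "x \<in> p \<Longrightarrow> y \<in> p \<Longrightarrow> x + y \<in> p"
  and p_mult: "a \<in> A \<Longrightarrow> x \<in> p \<Longrightarrow> a * x \<in> p"
  and p_prime: "a \<in> A \<Longrightarrow> b \<in> A \<Longrightarrow> a * b \<in> p \<Longrightarrow> a \<in> p \<or> b \<in> p" and p_1: "1 \<notin> p"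
proof -
  interpret p: primeideal p "ring_on A" by (rule prime)
  show "x \<in> p \<Longrightarrow> x \<in> A" "0 \<in> p" "x \<in> p \<Longrightarrow> y \<in> p \<Longrightarrow> x + y \<in> p"
    using p.a_subset p.zero_closed p.a_closed[of x y] by auto
  show "a \<in> A \<Longrightarrow> x \<in> p \<Longrightarrow> a * x \<in> p" "a \<in> A \<Longrightarrow> b \<in> A \<Longrightarrow> a * b \<in> p \<Longrightarrow> a \<in> p \<or> b \<in> p"
    using p.I_l_closed[of x a] p.I_prime[of a b] by auto
  show "1 \<notin> p" using p.one_imp_carrier p.I_notcarr by auto
qed

lemma unit_mult: "u \<in> A - p \<Longrightarrow> w \<in> A - p \<Longrightarrow> u * w \<in> A - p"
  using p_prime A_mult by auto

lemma unit_nonzero: "w \<in> A - p \<Longrightarrow> w \<noteq> 0"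
  using p_0 by auto

lemma coprime_p:
  assumes "w \<in> A - p"
  shows "\<exists>u\<in>A. \<exists>q\<in>p. u * w + q = 1"
proof -
  let ?J = "{u * w + q | u q. u \<in> A \<and> q \<in> p}"
  have "ideal ?J (ring_on A)"
  proof (rule ideal_ring_onI[OF R.ring_axioms])
    show "?J \<subseteq> A" using assms p_sub by (auto intro: A_add A_mult)
    show "0 \<in> ?J" using A_0 p_0 by force
    show "x + y \<in> ?J" if "x \<in> ?J" "y \<in> ?J" for x y
    proof -
      from that obtain u q u' q' where "u \<in> A" "q \<in> p" "u' \<in> A" "q' \<in> p" "x = u * w + q" "y = u' * w + q'" by blast
      moreover from this have "x + y = (u + u') * w + (q + q')" by (simp add: algebra_simps)
      ultimately show ?thesis using A_add p_add by blast
    qed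
    show "a * x \<in> ?J" if "a \<in> A" "x \<in> ?J" for a x
    proof -
      from that obtain u q where "u \<in> A" "q \<in> p" "x = u * w + q" by blast
      moreover from this have "a * x = (a * u) * w + (a * q)" by (simp add: algebra_simps)
      ultimately show ?thesis using A_mult p_mult that(1) by blast
    qed
  qed
  moreover have "p \<subseteq> ?J"
  proof
    fix q assume "q \<in> p"
    then have "q = 0 * w + q" "0 \<in> A" using A_0 by simp_all
    with \<open>q \<in> p\<close> show "q \<in> ?J" by blast
  qed
  moreover have "?J \<subseteq> carrier (ring_on A)" using assms p_sub by (auto intro: A_add A_mult)
  moreover have "maximalideal p (ring_on A)"
    using dedekind prime p_nonzero by (auto simp: dedekind_domain_of_fractions_def)
  ultimately have "?J = p \<or> ?J = A" using maximalideal.I_maximal[of p "ring_on A" ?J] by simp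
  moreover have "w = 1 * w + 0" by simp
  then have "w \<in> ?J" using A_1 p_0 by blast
  ultimately have J: "?J = A" using assms by blast
  have "1 \<in> ?J" unfolding J by (rule A_1)
  then obtain u q where "1 = u * w + q" "u \<in> A" "q \<in> p" by blast
  then show ?thesis by (intro bexI[of _ u] bexI[of _ q]) simp_all
qed

lemma \<pi>_mem: "\<pi> \<in> p"
proof -
  have "1 = 1 / (1::'a)" by simp
  then have "1 \<in> localization_at A p" unfolding localization_at_def using A_1 p_1 by blast
  then have "\<pi> * 1 \<in> {a / b | a b. a \<in> p \<and> b \<in> A - p}"
    using gen unfolding generates_max_ideal_def by blast
  then obtain a b where ab: "a \<in> p" "b \<in> A - p" "\<pi> = a / b" by auto
  then have "\<pi> * b = a" using unit_nonzero[of b] by auto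
  with ab p_prime[OF \<pi>, of b] show ?thesis by auto
qed

lemma p_generated:
  assumes "a \<in> p"
  shows "\<exists>c\<in>A. \<exists>w\<in>A - p. a * w = \<pi> * c"
proof -
  have "a = a / 1" by simp
  then have "a \<in> {a / b | a b. a \<in> p \<and> b \<in> A - p}" using assms A_1 p_1 by blast
  then obtain x where "x \<in> localization_at A p" "a = \<pi> * x" using gen unfolding generates_max_ideal_def by auto
  then obtain c w where cw: "c \<in> A" "w \<in> A - p" "a = \<pi> * (c / w)" unfolding localization_at_def by auto
  with unit_nonzero[of w] have "a * w = \<pi> * c" by auto
  with cw show ?thesis by blast
qed

lemma \<pi>_nonzero: "\<pi> \<noteq> 0"
proof
  assume "\<pi> = 0"
  then have "a = 0" if "a \<in> p" for a using p_generated[OF that] unit_nonzero by auto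
  with p_nonzero p_0 show False by blast
qed

section \<open>Powers of the prime ideal, described locally\<close>

abbreviation P :: "nat \<Rightarrow> 'a set" where "P \<equiv> ideal_power (ring_on A) p"

lemma P_ideal: "ideal (P n) (ring_on A)"
  by (induction n) (use R.oneideal R.ideal_prod_is_ideal[OF _ p_ideal] in simp_all)

lemma P_sub: "x \<in> P n \<Longrightarrow> x \<in> A" and P_add: "x \<in> P n \<Longrightarrow> y \<in> P n \<Longrightarrow> x + y \<in> P n"
  and P_mult: "a \<in> A \<Longrightarrow> x \<in> P n \<Longrightarrow> a * x \<in> P n"
proof -
  interpret P: ideal "P n" "ring_on A" by (rule P_ideal)
  show "x \<in> P n \<Longrightarrow> x \<in> A" "x \<in> P n \<Longrightarrow> y \<in> P n \<Longrightarrow> x + y \<in> P n" "a \<in> A \<Longrightarrow> x \<in> P n \<Longrightarrow> a * x \<in> P n"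
    using P.a_subset P.a_closed[of x y] P.I_l_closed[of x a] by auto
qed

lemma P_Suc: "x \<in> P n \<Longrightarrow> q \<in> p \<Longrightarrow> x * q \<in> P (Suc n)"
  using ideal_prod.prod[of x "P n" q p "ring_on A"] by simp

lemma \<pi>_power_mem: "\<pi> ^ n \<in> P n"
proof (induction n)
  case 0
  then show ?case by (simp add: A_1)
next
  case (Suc n)
  from P_Suc[OF this \<pi>_mem] show ?case by (simp only: power_Suc2)
qed

lemma P_local: "x \<in> P n \<Longrightarrow> \<exists>c\<in>A. \<exists>w\<in>A - p. x * w = \<pi> ^ n * c"
proof (induction n arbitrary: x)
  case 0
  then have "x * 1 = \<pi> ^ 0 * x" "x \<in> A" by simp_all
  then show ?case using A_1 p_1 by blast
next
  case (Suc n)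
  then have "x \<in> ideal_prod (ring_on A) (P n) p" by simp
  then show ?case
  proof (induction rule: ideal_prod.induct)
    case (prod i q)
    from Suc.IH[OF prod(1)] obtain c w where 1: "c \<in> A" "w \<in> A - p" "i * w = \<pi> ^ n * c" by blast
    from p_generated[OF prod(2)] obtain c' w' where 2: "c' \<in> A" "w' \<in> A - p" "q * w' = \<pi> * c'" by blast
    have "(i * q) * (w * w') = (i * w) * (q * w')" by (simp add: ac_simps)
    also have "\<dots> = \<pi> ^ Suc n * (c * c')" using 1 2 by (simp add: ac_simps)
    finally show ?case using A_mult[OF 1(1) 2(1)] unit_mult[OF 1(2) 2(2)] by auto
  next
    case (sum x y)
    then obtain c w c' w' where 1: "c \<in> A" "w \<in> A - p" "x * w = \<pi> ^ Suc n * c"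
      and 2: "c' \<in> A" "w' \<in> A - p" "y * w' = \<pi> ^ Suc n * c'" by blast
    have "(x + y) * (w * w') = (x * w) * w' + (y * w') * w" by (simp add: algebra_simps)
    also have "\<dots> = \<pi> ^ Suc n * (c * w' + c' * w)" using 1 2 by (simp add: algebra_simps)
    finally have "(x + y) * (w * w') = \<pi> ^ Suc n * (c * w' + c' * w)" .
    moreover have "c * w' + c' * w \<in> A" using 1 2 by (intro A_add A_mult) auto
    ultimately show ?case unfolding ring_on_simps using unit_mult[OF 1(2) 2(2)] by blast
  qed
qed

text \<open>Multiplying the Bezout identity for \<open>p^n\<close> with the one for \<open>p\<close>
  leaves a single product outside the multiples of \<open>w\<close>, and it lies in the next
  power.\<close>

lemma coprime_P:
  assumes "w \<in> A - p"
  shows "\<exists>u\<in>A. \<exists>q\<in>P n. u * w + q = 1"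
proof (induction n)
  case 0
  show ?case using A_0 A_1 by (intro bexI[of _ 0] bexI[of _ 1]) simp_all
next
  case (Suc n)
  then obtain u q where 1: "u \<in> A" "q \<in> P n" "u * w + q = 1" by blast
  obtain u' q' where 2: "u' \<in> A" "q' \<in> p" "u' * w + q' = 1" using coprime_p[OF assms] by blast
  have "(u * w + q) * (u' * w + q') = 1" using 1 2 by simp
  then have "(u * u' * w + u * q' + q * u') * w + q * q' = 1" by (simp add: algebra_simps)
  moreover have "u * u' * w + u * q' + q * u' \<in> A"
    using 1 2 assms P_sub p_sub by (intro A_add A_mult) auto
  ultimately show ?case using P_Suc[OF 1(2) 2(2)] by blast
qed

text \<open>\<open>p^n\<close> is the contraction to \<open>A\<close> of the ideal generated by
  \<open>\<pi> ^ n\<close> in the localization; the denominator \<open>w\<close> is cleared with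
  \<open>coprime_P\<close>.\<close>

lemma P_iff:
  assumes "a \<in> A"
  shows "a \<in> P n \<longleftrightarrow> (\<exists>c\<in>A. \<exists>w\<in>A - p. a * w = \<pi> ^ n * c)"
proof
  assume "\<exists>c\<in>A. \<exists>w\<in>A - p. a * w = \<pi> ^ n * c"
  then obtain c w where cw: "c \<in> A" "w \<in> A - p" "a * w = \<pi> ^ n * c" by blast
  obtain u q where uq: "u \<in> A" "q \<in> P n" "u * w + q = 1" using coprime_P[OF cw(2)] by blast
  have "a = a * (u * w + q)" using uq(3) by simp
  also have "\<dots> = u * (a * w) + a * q" by (simp add: algebra_simps)
  also have "\<dots> = (u * c) * \<pi> ^ n + a * q" using cw(3) by (simp add: ac_simps)
  also have "\<dots> \<in> P n" using uq cw assms by (intro P_add P_mult A_mult \<pi>_power_mem)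
  finally show "a \<in> P n" .
qed (rule P_local)

text \<open>The Krull intersection \<open>\<Inter>n. P n\<close> is zero: the ideals \<open>(\<pi>\<^sup>-\<^sup>n a A\<^sub>p) \<inter> A\<close> form an ascending chain.\<close>

lemma not_in_all_P:
  assumes a: "a \<in> A" "a \<noteq> 0"
  shows "\<exists>n. a \<notin> P n"
proof (rule ccontr)
  assume "\<not> ?thesis"
  then have all: "\<exists>c\<in>A. \<exists>w\<in>A - p. a * w = \<pi> ^ n * c" for n using P_iff[OF a(1)] by blast
  define I where "I n = {x \<in> A. \<exists>w\<in>A - p. \<exists>c\<in>A. \<pi> ^ n * x * w = c * a}" for n
  have ideal: "ideal (I n) (ring_on A)" for n
  proof (rule ideal_ring_onI[OF R.ring_axioms])
    have "\<pi> ^ n * 0 * 1 = 0 * a" by simp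
    then show "0 \<in> I n" using A_0 A_1 p_1 unfolding I_def by blast
    show "x + y \<in> I n" if "x \<in> I n" "y \<in> I n" for x y
    proof -
      from that obtain w c w' c' where 1: "w \<in> A - p" "c \<in> A" "\<pi> ^ n * x * w = c * a" "x \<in> A"
        and 2: "w' \<in> A - p" "c' \<in> A" "\<pi> ^ n * y * w' = c' * a" "y \<in> A" unfolding I_def by blast
      have "\<pi> ^ n * (x + y) * (w * w') = (\<pi> ^ n * x * w) * w' + (\<pi> ^ n * y * w') * w" by (simp add: algebra_simps)
      also have "\<dots> = (c * w' + c' * w) * a" unfolding 1(3) 2(3) by (simp add: algebra_simps)
      finally have "\<pi> ^ n * (x + y) * (w * w') = (c * w' + c' * w) * a" .
      moreover have "c * w' + c' * w \<in> A" using 1 2 by (intro A_add A_mult) auto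
      ultimately show ?thesis using A_add[OF 1(4) 2(4)] unit_mult[OF 1(1) 2(1)] unfolding I_def by blast
    qed
    show "b * x \<in> I n" if "b \<in> A" "x \<in> I n" for b x
    proof -
      from that obtain w c where 1: "w \<in> A - p" "c \<in> A" "\<pi> ^ n * x * w = c * a" "x \<in> A" unfolding I_def by blast
      have "\<pi> ^ n * (b * x) * w = b * (\<pi> ^ n * x * w)" by (simp add: algebra_simps)
      also have "\<dots> = (b * c) * a" unfolding 1(3) by simp
      finally show ?thesis using 1 that(1) A_mult unfolding I_def by blast
    qed
  qed (auto simp: I_def)
  have Suc: "I n \<subseteq> I (Suc n)" for n
  proof
    fix x assume "x \<in> I n"
    then obtain w c where 1: "w \<in> A - p" "c \<in> A" "\<pi> ^ n * x * w = c * a" "x \<in> A" unfolding I_def by blast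
    have "\<pi> ^ Suc n * x * w = \<pi> * (\<pi> ^ n * x * w)" by (simp add: ac_simps)
    also have "\<dots> = (\<pi> * c) * a" unfolding 1(3) by simp
    finally show "x \<in> I (Suc n)" using 1 A_mult[OF \<pi> 1(2)] unfolding I_def by blast
  qed
  then have mono: "I m \<subseteq> I n \<or> I n \<subseteq> I m" for m n
    using lift_Suc_mono_le[of I m n] lift_Suc_mono_le[of I n m] by (meson linear)
  have "subset.chain {I. ideal I (ring_on A)} (range I)"
    unfolding pred_on.chain_def using ideal mono by auto
  from R.ideal_chain_is_trivial[OF _ this] obtain N where N: "I (Suc N) \<subseteq> I N" by auto
  \<comment> \<open>Up to \<open>w\<close>, the element \<open>c\<close> is \<open>a\<close> divided
    by \<open>\<pi> ^ Suc N\<close>. Stationarity allows one factor \<open>\<pi>\<close> fewer, and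
    cancelling \<open>a\<close> puts a product of elements outside \<open>p\<close> into
    \<open>p\<close>.\<close>
  obtain c w where cw: "c \<in> A" "w \<in> A - p" "a * w = \<pi> ^ Suc N * c" using all by blast
  have "\<pi> ^ Suc N * c * 1 = w * a" using cw(3) by (simp add: mult.commute)
  then have "c \<in> I (Suc N)" unfolding I_def using cw(1,2) A_1 p_1 by blast
  with N obtain w' c' where 2: "w' \<in> A - p" "c' \<in> A" "\<pi> ^ N * c * w' = c' * a" unfolding I_def by blast
  have "a * (w * w') = \<pi> * (\<pi> ^ N * c * w')" using cw(3) by (simp flip: mult.assoc)
  also have "\<dots> = a * (c' * \<pi>)" unfolding 2(3) by simp
  finally have "w * w' = c' * \<pi>" using a(2) by simp
  with p_mult[OF 2(2) \<pi>_mem] unit_mult[OF cw(2) 2(1)] show False by simp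
qed

lemma factorization:
  assumes a: "a \<in> A" "a \<noteq> 0"
  shows "\<exists>u\<in>A - p. \<exists>w\<in>A - p. a * w = \<pi> ^ ideal_exponent A p {a} * u"
proof -
  have dec: "P (Suc n) \<subseteq> P n" for n
  proof
    fix x assume x: "x \<in> P (Suc n)"
    from P_local[OF this] obtain c w where "c \<in> A" "w \<in> A - p" "x * w = \<pi> ^ n * (\<pi> * c)" by auto
    with P_iff[OF P_sub[OF x]] A_mult[OF \<pi>] show "x \<in> P n" by blast
  qed
  have antimono: "P n \<subseteq> P m" if "m \<le> n" for m n using lift_Suc_antimono_le[of P m n] dec that by blast
  obtain N where N: "a \<notin> P N" using not_in_all_P[OF a] by blast
  define n where "n = ideal_exponent A p {a}"
  have bound: "\<forall>m. {a} \<subseteq> P m \<longrightarrow> m \<le> N" using N antimono by (meson insert_subset linear subsetD)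
  have "{a} \<subseteq> P 0" using a by simp
  from GreatestI_nat[where P = "\<lambda>m. {a} \<subseteq> P m", OF this bound[rule_format]]
  have an: "a \<in> P n" unfolding n_def ideal_exponent_def by simp
  have notSuc: "a \<notin> P (Suc n)"
    using Greatest_le_nat[where P = "\<lambda>m. {a} \<subseteq> P m", of "Suc n" N] bound unfolding n_def ideal_exponent_def by auto
  obtain u w where uw: "u \<in> A" "w \<in> A - p" "a * w = \<pi> ^ n * u" using P_local[OF an] by blast
  have "u \<notin> p"
  proof
    assume "u \<in> p"
    then obtain c w' where cw: "c \<in> A" "w' \<in> A - p" "u * w' = \<pi> * c" using p_generated by blast
    have "a * (w * w') = \<pi> ^ n * (u * w')" using uw(3) by (simp flip: mult.assoc)
    also have "\<dots> = \<pi> ^ Suc n * c" unfolding cw(3) by simp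
    finally have "a \<in> P (Suc n)" using P_iff[OF a(1)] cw(1) unit_mult[OF uw(2) cw(2)] by blast
    with notSuc show False by simp
  qed
  with uw show ?thesis unfolding n_def by blast
qed

lemma exponent_unique:
  assumes "\<pi> ^ m * u = \<pi> ^ n * w" "u \<in> A - p" "w \<in> A - p"
  shows "m = n"
proof -
  have *: "\<not> m < n" if "\<pi> ^ m * u = \<pi> ^ n * w" "u \<in> A - p" "w \<in> A - p" for m n u w
  proof
    assume "m < n"
    then obtain k where "n = m + Suc k" using less_imp_Suc_add by auto
    with that(1) have "\<pi> ^ m * u = \<pi> ^ m * (\<pi> ^ k * w * \<pi>)" by (simp add: power_add ac_simps)
    then have "u = \<pi> ^ k * w * \<pi>" using \<pi>_nonzero by simp
    moreover have "\<pi> ^ k * w * \<pi> \<in> p" using that(3) by (intro p_mult A_mult A_power \<pi> \<pi>_mem) auto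
    ultimately show False using that(2) by simp
  qed
  from *[OF assms] *[OF assms(1)[symmetric] assms(3,2)] show ?thesis by simp
qed

lemma ideal_exponent_\<pi>: "ideal_exponent A p {\<pi>} = 1" and ideal_exponent_1: "ideal_exponent A p {1} = 0"
proof -
  obtain u w where "u \<in> A - p" "w \<in> A - p" "\<pi> * w = \<pi> ^ ideal_exponent A p {\<pi>} * u"
    using factorization[OF \<pi> \<pi>_nonzero] by blast
  with exponent_unique[of 1 w "ideal_exponent A p {\<pi>}" u] show "ideal_exponent A p {\<pi>} = 1" by simp
  obtain u w where "u \<in> A - p" "w \<in> A - p" "1 * w = \<pi> ^ ideal_exponent A p {1} * u"
    using factorization[OF A_1] by auto
  with exponent_unique[of 0 w "ideal_exponent A p {1}" u] show "ideal_exponent A p {1} = 0" by simp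
qed

text \<open>\<open>prime_val\<close> is a definite description, so all fractions representing
  \<open>\<pi>\<close> must give 1. Cross-multiplying the factorizations of numerator and
  denominator compares powers of \<open>\<pi>\<close> up to elements outside
  \<open>p\<close>.\<close>

lemma prime_val_generator: "prime_val A p \<pi> = 1"
  unfolding prime_val_def
proof (rule the_equality)
  show "\<exists>b\<in>A. \<exists>c\<in>A. b \<noteq> 0 \<and> c \<noteq> 0 \<and> \<pi> = b / c \<and>
        1 = int (ideal_exponent A p {b}) - int (ideal_exponent A p {c})"
    using \<pi> A_1 \<pi>_nonzero ideal_exponent_\<pi> ideal_exponent_1 by (intro bexI[of _ \<pi>] bexI[of _ 1]) auto
next
  fix k assume "\<exists>b\<in>A. \<exists>c\<in>A. b \<noteq> 0 \<and> c \<noteq> 0 \<and> \<pi> = b / c \<and>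
        k = int (ideal_exponent A p {b}) - int (ideal_exponent A p {c})"
  then obtain b c where bc: "b \<in> A" "c \<in> A" "b \<noteq> 0" "c \<noteq> 0" "b = \<pi> * c"
    and k: "k = int (ideal_exponent A p {b}) - int (ideal_exponent A p {c})" by (metis nonzero_divide_eq_eq)
  let ?m = "ideal_exponent A p {b}" and ?n = "ideal_exponent A p {c}"
  obtain u w where 1: "u \<in> A - p" "w \<in> A - p" "b * w = \<pi> ^ ?m * u" using factorization[OF bc(1,3)] by blast
  obtain u' w' where 2: "u' \<in> A - p" "w' \<in> A - p" "c * w' = \<pi> ^ ?n * u'" using factorization[OF bc(2,4)] by blast
  have "\<pi> ^ ?m * (u * w') = (b * w) * w'" using 1 by (simp add: ac_simps)
  also have "\<dots> = \<pi> * w * (c * w')" unfolding bc(5) by (simp add: ac_simps)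
  also have "\<dots> = \<pi> ^ Suc ?n * (u' * w)" unfolding 2(3) by (simp add: ac_simps)
  finally have "?m = Suc ?n" by (rule exponent_unique[OF _ unit_mult[OF 1(1) 2(2)] unit_mult[OF 2(1) 1(2)]])
  with k show "k = 1" by simp
qed

end

section \<open>Quotients\<close>

lemma pcompose_power: "pcompose (p ^ n) q = pcompose p q ^ n" for p q :: "'a::comm_ring_1 poly"
  by (induction n) (simp_all add: pcompose_1 pcompose_mult)

context key_polynomial
begin

text \<open>Dropping the first \<open>s\<close> terms of the expansion and shifting lowers each
  weight by \<open>s * T\<close>. The right end of the component has abscissa at least
  \<open>s\<close>, so it survives and still attains the minimum.\<close>

lemma quotient_initial:
  assumes g: "g \<noteq> 0" and s: "s \<le> Polynomial.degree (initial (aug g) g)"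
  shows "g div \<phi> ^ s \<noteq> 0" "aug (g div \<phi> ^ s) = aug g - int s * T"
    "Polynomial.degree (initial (aug (g div \<phi> ^ s)) (g div \<phi> ^ s)) \<le> Polynomial.degree (initial (aug g) g) - s"
proof -
  let ?Q = "g div \<phi> ^ s" and ?p = "initial (aug g) g"
  define N where "N = aug g - int s * T"
  have shift: "wt i a = wt (s + i) a - int s * T" for i a by (simp add: wt_def algebra_simps)
  have "ge N ?Q"
    unfolding ge_def ex_quotient
  proof (intro allI impI)
    fix i assume "ex g (s + i) \<noteq> 0"
    from aug_le[OF this] show "N \<le> wt i (ex g (s + i))" using shift[of i] by (simp add: N_def)
  qed
  have coeff: "Polynomial.coeff (initial N ?Q) i \<noteq> 0 \<longleftrightarrow> Polynomial.coeff ?p (s + i) \<noteq> 0" for i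
    using shift[of i "ex g (s + i)"] by (auto simp: initial_coeff_nonzero ex_quotient N_def)
  have "Polynomial.coeff (initial N ?Q) (Polynomial.degree ?p - s) \<noteq> 0"
    using coeff[of "Polynomial.degree ?p - s"] s initial_aug_nonzero[OF g] by simp
  then have "initial N ?Q \<noteq> 0" by auto
  from aug_eqI[OF \<open>ge N ?Q\<close> this] show "?Q \<noteq> 0" "aug ?Q = aug g - int s * T" by (simp_all add: N_def)
  then have N: "aug ?Q = N" by (simp add: N_def)
  show "Polynomial.degree (initial (aug ?Q) ?Q) \<le> Polynomial.degree ?p - s"
    unfolding N
  proof (rule Polynomial.degree_le, intro allI impI)
    fix i assume "Polynomial.degree ?p - s < i"
    then have "Polynomial.coeff ?p (s + i) = 0" by (intro Polynomial.coeff_eq_0) linarith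
    with coeff[of i] show "Polynomial.coeff (initial N ?Q) i = 0" by blast
  qed
qed

lemma irreducible_over_dvd_power:
  assumes irr: "irreducible_over K \<psi>" and a: "a \<in> polys_over K" and "\<psi> dvd a ^ n"
  shows "\<psi> dvd a"
  using assms(3)
proof (induction n)
  case 0
  have "Polynomial.degree \<psi> > 0" using irreducible_over_degree_pos[OF irr K] .
  moreover have "Polynomial.degree \<psi> \<le> Polynomial.degree (1 :: 'e poly)"
    using 0 by (intro Polynomial.dvd_imp_degree_le) simp_all
  ultimately show ?case by simp
next
  case (Suc n)
  then show ?case using irreducible_over_dvd_mult[OF K irr a, of "a ^ n"] by auto
qed

text \<open>If \<open>g ^ n - q * F\<close> had larger value, then \<open>q * F\<close> and
  \<open>g ^ n\<close> would share their initial form. Multiplicativity would make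
  \<open>\<psi>\<close> divide a power of the residual polynomial of \<open>g\<close>, which is
  non-zero and shorter than \<open>\<psi>\<close>.\<close>

lemma initial_form_not_divisible:
  assumes irr: "irreducible_over K \<psi>" and y: "\<not> \<psi> dvd [:0, 1:]"
    and F: "F \<noteq> 0" "\<psi> dvd residual F"
    and g: "g \<noteq> 0" "Polynomial.degree (initial (aug g) g) < e * Polynomial.degree \<psi>"
  shows "\<not> val_ge aug (int n * aug g + 1) (g ^ n - q * F)"
proof
  assume d: "val_ge aug (int n * aug g + 1) (g ^ n - q * F)"
  let ?Y = "Polynomial.monom 1 e :: 'e poly" and ?p = "initial (aug g) g"
  define N where "N = int n * aug g"
  have gn: "g ^ n \<noteq> 0" "aug (g ^ n) = N" using g(1) valuation_power[OF aug_valuation, of g n] by (simp_all add: N_def)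
  have geN: "ge N (g ^ n)" "ge N (g ^ n - q * F)"
    using gn d unfolding ge_iff by (auto simp: val_ge_def N_def)
  have "ge N (q * F)" using val_ge_diff[OF aug_valuation geN[unfolded ge_iff]] by (simp add: ge_iff)
  from initial_add[OF geN(2) this] have init: "initial N (q * F) = ?p ^ n"
    using initial_eq_0[of N] d initial_aug_power[OF g(1), of n] gn(2) by (simp add: N_def)
  have "initial N (q * F) \<noteq> 0" unfolding init using initial_aug_nonzero[OF g(1)] by simp
  from aug_eqI[OF \<open>ge N (q * F)\<close> this] have qF: "q \<noteq> 0" "aug (q * F) = N" by auto
  have "initial (aug F) F dvd ?p ^ n"
    using initial_aug_mult[OF qF(1) F(1)] unfolding qF(2) init by simp
  moreover obtain r where r: "residual F = \<psi> * r" using F(2) by blast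
  have "pcompose \<psi> ?Y dvd initial (aug F) F"
    unfolding arg_cong[OF residual_decomp[OF F(1)], of "\<lambda>x. pcompose \<psi> ?Y dvd x"] r pcompose_mult by simp
  ultimately have dv: "pcompose \<psi> ?Y dvd ?p ^ n" by (rule dvd_trans[rotated])
  let ?l = "low_order ?p"
  have "?p ^ n = (Polynomial.monom 1 ?l * pcompose (residual g) ?Y) ^ n"
    by (rule arg_cong[OF residual_decomp[OF g(1)]])
  also have "\<dots> = Polynomial.monom 1 (?l * n) * pcompose (residual g ^ n) ?Y"
    by (simp add: power_mult_distrib Polynomial.monom_power pcompose_power)
  \<comment> \<open>The monomial \<open>y^(l n)\<close> need not be a polynomial in
    \<open>y^e\<close>. Padding it to \<open>y^(l n e)\<close> makes the whole product one, so that
    the substitution can be cancelled.\<close>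
  finally have "Polynomial.monom 1 (?l * n * (e - 1)) * ?p ^ n
      = (Polynomial.monom 1 (?l * n * (e - 1)) * Polynomial.monom 1 (?l * n)) * pcompose (residual g ^ n) ?Y" by simp
  also have "Polynomial.monom 1 (?l * n * (e - 1)) * Polynomial.monom 1 (?l * n) = (Polynomial.monom 1 (?l * n * e) :: 'e poly)"
    using e by (cases e) (simp_all add: Polynomial.mult_monom add.commute)
  also have "\<dots> = pcompose (Polynomial.monom 1 (?l * n)) ?Y"
    by (simp add: pcompose_monom Polynomial.monom_power mult.commute)
  finally have "pcompose \<psi> ?Y dvd pcompose (Polynomial.monom 1 (?l * n) * residual g ^ n) ?Y"
    using dv by (metis dvd_mult pcompose_mult)
  then have "\<psi> dvd Polynomial.monom 1 (?l * n) * residual g ^ n"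
    using pcompose_monom_dvd_cancel[OF e] by blast
  then have "\<psi> dvd [:0, 1:] ^ (?l * n) \<or> \<psi> dvd residual g ^ n"
    using irreducible_over_dvd_mult[OF K irr polys_over_monom[OF K subfield_1[OF K]]]
    by (simp add: Polynomial.monom_altdef)
  moreover have "[:0, 1:] \<in> polys_over K" by (rule polys_over_X[OF K])
  ultimately have "\<psi> dvd residual g"
    using y irreducible_over_dvd_power[OF irr] residual_mem by blast
  then have "Polynomial.degree \<psi> \<le> Polynomial.degree (residual g)"
    using residual_nonzero[OF g(1)] by (rule Polynomial.dvd_imp_degree_le)
  then have "e * Polynomial.degree \<psi> \<le> Polynomial.degree (residual g) * e" by simp
  with residual_degree[OF g(1)] g(2) show False by linarith
qed

end

section \<open>Embeddings into the completions\<close>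

lemma ring_hom_field_embedding:
  assumes "f \<in> ring_hom (ring_of_type_algebra :: 'a::field ring) (ring_of_type_algebra :: 'b::field ring)"
  shows "field_embedding f"
  using assms by unfold_locales (auto simp: ring_hom_def)

lemma (in field_embedding) irreducible_over_min_poly:
  assumes F: "is_min_poly h \<alpha> F"
  shows "irreducible_over UNIV F" and "F dvd g \<longleftrightarrow> poly (map_poly h g) \<alpha> = 0"
proof -
  have lead: "Polynomial.lead_coeff F = 1" and root: "poly (map_poly h F) \<alpha> = 0"
    and min: "\<And>g. poly (map_poly h g) \<alpha> = 0 \<Longrightarrow> F dvd g" using F by (auto simp: is_min_poly_def)
  have F0: "F \<noteq> 0" using lead by auto
  show dvd: "F dvd g \<longleftrightarrow> poly (map_poly h g) \<alpha> = 0" for g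
    using min root by (auto elim!: dvdE simp: hom_poly_mult)
  have unit: "(\<exists>u. b * u = 1)" if "F = a * b" "F dvd a" for a b
  proof -
    from that(2) obtain c where c: "a = F * c" by (rule dvdE)
    have "F * (b * c) = a * b" unfolding c by (simp add: ac_simps)
    then have "F * 1 = F * (b * c)" using that(1) by (simp only: mult_1_right)
    then have "b * c = 1" using F0 by (metis mult_left_cancel)
    then show ?thesis by blast
  qed
  show "irreducible_over UNIV F"
    unfolding irreducible_over_def
  proof (intro conjI ballI impI notI)
    show "F \<in> polys_over UNIV" by (simp add: polys_over_def)
    show False if "F = 0" using F0 that by simp
    show False if "\<exists>u\<in>polys_over UNIV. F * u = 1"
    proof -
      from that have "F dvd 1" by (metis dvd_triv_left)
      then show False by (simp only: dvd hom_poly_1 poly_1 one_neq_zero)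
    qed
    fix a b assume ab: "F = a * b"
    then have "poly (map_poly h a) \<alpha> = 0 \<or> poly (map_poly h b) \<alpha> = 0" using root by (simp add: hom_poly_mult)
    then have "F dvd a \<or> F dvd b" by (simp add: dvd)
    then show "(\<exists>u\<in>polys_over UNIV. a * u = 1) \<or> (\<exists>u\<in>polys_over UNIV. b * u = 1)"
      using unit[of a b] unit[of b a] ab by (auto simp: polys_over_def mult.commute)
  qed
qed

lemma (in field_embedding) is_subfield_simple_extension:
  assumes F: "is_min_poly h \<alpha> F"
  shows "is_subfield {poly (map_poly h g) \<alpha> | g. True}"
proof -
  note irr = irreducible_over_min_poly[OF F]
  let ?M = "{poly (map_poly h g) \<alpha> | g. True}"
  have mem: "poly (map_poly h g) \<alpha> \<in> ?M" for g by blast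
  show ?thesis
    unfolding is_subfield_def
  proof (intro conjI ballI)
    show "0 \<in> ?M" "1 \<in> ?M" using mem[of 0] mem[of 1] by (simp_all add: hom_poly_1)
    fix x assume "x \<in> ?M"
    then obtain g where g: "x = poly (map_poly h g) \<alpha>" by blast
    show "inverse x \<in> ?M"
    proof (cases "x = 0")
      case False
      then have "\<not> F dvd g" using irr(2) g by simp
      then obtain u b where "u * F + b * g = 1"
        using irreducible_over_bezout[OF is_subfield_UNIV irr(1), of g] by (auto simp: polys_over_def)
      then have "poly (map_poly h (u * F + b * g)) \<alpha> = 1" by (simp add: hom_poly_1)
      moreover have "poly (map_poly h F) \<alpha> = 0" using F by (simp add: is_min_poly_def)
      ultimately have "x * poly (map_poly h b) \<alpha> = 1" by (simp add: hom_poly_add hom_poly_mult g mult.commute)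
      then have "inverse x = poly (map_poly h b) \<alpha>" by (rule inverse_unique)
      with mem[of b] show ?thesis by simp
    qed (use \<open>0 \<in> ?M\<close> in simp)
    fix y assume "y \<in> ?M"
    then obtain g' where g': "y = poly (map_poly h g') \<alpha>" by blast
    have "map_poly h (g - g') = map_poly h g - map_poly h g'"
      by (rule poly_eqI) (simp add: coeff_hom hom_diff)
    then show "x - y \<in> ?M" "x * y \<in> ?M" using mem[of "g - g'"] mem[of "g * g'"] g g' by (simp_all add: hom_poly_mult)
  qed
qed

text \<open>A minimal equation with coefficients of value 0 makes \<open>\<alpha>\<close> integral,
  so all polynomials in \<open>\<alpha>\<close> have value at least 0; these form a field, and the
  same bound for inverses forces value 0.\<close>

lemma (in field_embedding) valuation_trivial_on_extension:
  assumes v: "is_valuation v" and triv: "\<And>x. x \<noteq> 0 \<Longrightarrow> v (h x) = 0"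
    and F: "is_min_poly h \<alpha> F" and x: "x \<in> {poly (map_poly h g) \<alpha> | g. True}" "x \<noteq> 0"
  shows "v x = 0"
proof -
  let ?M = "{poly (map_poly h g) \<alpha> | g. True}"
  have lead: "Polynomial.lead_coeff F = 1" and root: "poly (map_poly h F) \<alpha> = 0" using F by (auto simp: is_min_poly_def)
  let ?n = "Polynomial.degree F"
  have n: "?n > 0"
    using irreducible_over_degree_pos[OF irreducible_over_min_poly(1)[OF F] is_subfield_UNIV] .
  have summand: "val_ge v N (h c * \<alpha> ^ i)" if "\<alpha> \<noteq> 0 \<Longrightarrow> N \<le> int i * v \<alpha>" "N \<le> 0" for N c i
  proof (cases "c = 0 \<or> \<alpha> = 0")
    case True
    then show ?thesis using that(2) triv[of c]
      by (cases "c = 0"; cases i) (auto simp: val_ge_def hom_0)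
  next
    case False
    then show ?thesis using that triv[of c]
      by (auto simp: val_ge_def valuation_mult[OF v] valuation_power[OF v] hom_eq_0_iff)
  qed
  have \<alpha>: "v \<alpha> \<ge> 0" if "\<alpha> \<noteq> 0"
  proof (rule ccontr)
    assume neg: "\<not> ?thesis"
    \<comment> \<open>With \<open>v \<alpha>\<close> negative, all terms of degree below
      \<open>?n\<close> have value at least \<open>?N\<close>, which is strictly larger than the
      value of \<open>\<alpha> ^ ?n\<close>.\<close>
    let ?N = "(int ?n - 1) * v \<alpha>"
    have "poly (map_poly h F) \<alpha> = (\<Sum>i\<le>?n. h (Polynomial.coeff F i) * \<alpha> ^ i)"
      by (simp add: poly_altdef hom_poly_degree coeff_hom)
    also have "\<dots> = (\<Sum>i<?n. h (Polynomial.coeff F i) * \<alpha> ^ i) + \<alpha> ^ ?n"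
      using lead by (simp add: hom_1 flip: lessThan_Suc_atMost)
    finally have eq: "\<alpha> ^ ?n = - (\<Sum>i<?n. h (Polynomial.coeff F i) * \<alpha> ^ i)"
      using root by (simp add: eq_neg_iff_add_eq_0 add.commute)
    have "val_ge v ?N (h (Polynomial.coeff F i) * \<alpha> ^ i)" if "i < ?n" for i
    proof (rule summand)
      show "?N \<le> int i * v \<alpha>" using that neg by (intro mult_right_mono_neg) auto
      show "?N \<le> 0" using n neg by (intro mult_nonneg_nonpos) auto
    qed
    then have "val_ge v ?N (\<alpha> ^ ?n)" unfolding eq val_ge_minus[OF v] by (intro val_ge_sum[OF v]) auto
    then have "?N \<le> int ?n * v \<alpha>" using that by (simp add: val_ge_def valuation_power[OF v])
    with neg show False by (simp add: algebra_simps)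
  qed
  have nonneg: "val_ge v 0 y" if "y \<in> ?M" for y
  proof -
    from that obtain g where "y = (\<Sum>i\<le>Polynomial.degree g. h (Polynomial.coeff g i) * \<alpha> ^ i)"
      by (auto simp: poly_altdef hom_poly_degree coeff_hom)
    moreover have "val_ge v 0 (h (Polynomial.coeff g i) * \<alpha> ^ i)" for i by (rule summand) (use \<alpha> in auto)
    ultimately show ?thesis by (simp add: val_ge_sum[OF v])
  qed
  from nonneg[OF x(1)] x(2) have "v x \<ge> 0" by (simp add: val_ge_def)
  moreover have "inverse x \<in> ?M" using subfield_inverse[OF is_subfield_simple_extension[OF F] x(1)] .
  from nonneg[OF this] x(2) have "- v x \<ge> 0" by (simp add: val_ge_def valuation_inverse[OF v])
  ultimately show ?thesis by simp
qed

text \<open>As \<open>(s, y)\<close> lies on \<open>S\<close>, \<open>e * y = aug f - h * s\<close>;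
  subtracting the weight shift \<open>s * T\<close> from \<open>aug f\<close> makes \<open>h\<close>
  disappear. The bound on the distance to the right end of \<open>S\<close> keeps the initial form
  of \<open>Q\<close> too short for \<open>\<psi>\<close>.\<close>

lemma (in type_level) quotient_value:
  assumes "irreducible_over (type_field D t) \<psi>" "Polynomial.lead_coeff \<psi> = 1"
    and f: "f \<noteq> 0" and \<psi>f: "\<psi> dvd slope_residual D t (type_residual D t) \<phi> h e f"
    and side: "is_side (neg_newton_polygon D t \<phi> f) (slope h e) S"
    and s: "left_abscissa S < real s" "real s \<le> right_abscissa S"
    and y: "(real s, y) \<in> neg_newton_polygon D t \<phi> f"
    and small: "right_abscissa S - real s < real (e * Polynomial.degree \<psi>)"
    and F: "F \<noteq> 0" "type_dvd D (Extend t \<phi> h e \<psi>) F"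
  defines "Q \<equiv> f div \<phi> ^ s"
  shows "Q \<noteq> 0" "real_of_int (aug Q) = real e * (y - real s * of_int (type_val D t \<phi>))"
    "\<not> val_ge aug (int n * aug Q + 1) (Q ^ n - q * F)"
proof -
  interpret P: point_polygon "{s. ex f s \<noteq> 0}" "\<lambda>s. real_of_int (type_val D t (ex f s * \<phi> ^ s))"
    by (rule point_polygon[OF f])
  let ?p = "initial (aug f) f"
  have S: "S = component (slope h e) (newton_polygon D t \<phi> f)"
    using P.side_of_negative_part[OF slope_neg] side by (simp add: newton_polygon_eq[OF f])
  have lr: "left_abscissa S = real (low_order ?p)" "right_abscissa S = real (Polynomial.degree ?p)"
    unfolding S by (rule left_component_polygon[OF f], rule right_component_polygon[OF f])
  have sd: "s \<le> Polynomial.degree ?p" "low_order ?p \<le> s" using s by (simp_all add: lr)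
  have "y - slope h e * real s = real_of_int (aug f) / real e"
    using P.N_on_component_range[of "real s" y "slope h e", unfolded Min_J_eq[OF f] Max_J_eq[OF f] minh_eq[OF f]]
      P.negative_part_sub y sd by (auto simp: newton_polygon_eq[OF f])
  then have y': "real e * y = real_of_int (aug f) - real h * real s"
    using e_pos by (simp add: slope_def eq_divide_eq distrib_left mult.commute)
  note Q = quotient_initial[OF f sd(1), folded Q_def]
  show Q0: "Q \<noteq> 0" by (rule Q(1))
  show "real_of_int (aug Q) = real e * (y - real s * of_int (type_val D t \<phi>))"
    using y' by (simp add: Q(2) T_def algebra_simps)
  have \<psi>0: "\<psi> \<noteq> 0" and deg\<psi>: "Polynomial.degree \<psi> > 0"
    using assms(2) irreducible_over_degree_pos[OF assms(1) K] by auto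
  \<comment> \<open>A divisor of \<open>y\<close> of positive degree vanishes at 0, but
    \<open>\<psi>\<close> divides the residual polynomial of \<open>f\<close>, whose constant term
    is non-zero.\<close>
  have ny: "\<not> \<psi> dvd [:0, 1:]"
  proof
    assume "\<psi> dvd [:0, 1:]"
    then obtain c where c: "[:0, 1:] = \<psi> * c" by (rule dvdE)
    have c0: "c \<noteq> 0" using c by auto
    have "Polynomial.degree \<psi> + Polynomial.degree c = 1"
      using Polynomial.degree_mult_eq[OF \<psi>0 c0] by (simp flip: c)
    with deg\<psi> have "Polynomial.degree c = 0" by simp
    then obtain a where a: "c = [:a:]" by (auto elim: Polynomial.degree_eq_zeroE)
    have "poly \<psi> 0 * a = 0" using arg_cong[OF c, of "\<lambda>p. poly p 0"] by (auto simp: a)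
    then have "poly \<psi> 0 = 0" using c0 unfolding a by auto
    moreover obtain r where "residual f = \<psi> * r" using \<psi>f slope_residual_eq[OF f] by auto
    ultimately show False using residual_coeff_0[OF f] by (simp add: Polynomial.coeff_mult flip: poly_0_coeff_0)
  qed
  have "\<psi> dvd residual F"
  proof -
    have tr: "type_residual D (Extend t \<phi> h e \<psi>) F = residual F" using slope_residual_eq[OF F(1)] by simp
    \<comment> \<open>\<open>GREATEST\<close> yields an actual exponent only for a bounded set; the
      degree of the non-zero residual polynomial is the bound.\<close>
    let ?m = "GREATEST n. \<psi> ^ n dvd residual F"
    have m: "?m > 0" using F(2) unfolding type_dvd_def type_ord_def tr by simp
    have "n \<le> Polynomial.degree (residual F)" if "\<psi> ^ n dvd residual F" for n
    proof -
      have "n * 1 \<le> n * Polynomial.degree \<psi>" using deg\<psi> by (intro mult_le_mono2) simp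
      also have "\<dots> = Polynomial.degree (\<psi> ^ n)" using \<psi>0 by (simp add: Polynomial.degree_power_eq)
      also have "\<dots> \<le> Polynomial.degree (residual F)"
        using that residual_nonzero[OF F(1)] by (rule Polynomial.dvd_imp_degree_le)
      finally show ?thesis by simp
    qed
    then have "\<psi> ^ ?m dvd residual F"
      using GreatestI_nat[of "\<lambda>n. \<psi> ^ n dvd residual F" 0 "Polynomial.degree (residual F)"] by simp
    then show ?thesis using m by (meson dvd_power dvd_trans)
  qed
  moreover have "Polynomial.degree (initial (aug Q) Q) < e * Polynomial.degree \<psi>"
  proof -
    have "real (Polynomial.degree ?p - s) < real (e * Polynomial.degree \<psi>)"
      using small sd(1) by (simp add: lr of_nat_diff)
    with Q(3) show ?thesis by linarith
  qed
  ultimately show "\<not> val_ge aug (int n * aug Q + 1) (Q ^ n - q * F)"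
    by (rule initial_form_not_divisible[OF assms(1) ny F(1) _ Q0])
qed

text \<open>Evaluation at \<open>\<theta>\<close> is moved into the completion, where
  \<open>spectral_comparison\<close> gives \<open>ram * aug Q' = E * w Q'\<close> with
  \<open>E\<close> the product of all \<open>e_i\<close> up to \<open>e_r\<close>. Since
  \<open>aug\<close> itself carries a factor \<open>e_r\<close>, only \<open>e_0 ... e_{r-1}\<close>
  remains in the denominator of \<open>H\<close>.\<close>

theorem corollary3p8:
  fixes A p :: "'K::field set"
    and \<pi> :: 'K
    and f \<phi> Q :: "'K poly"
    and \<theta> :: "'K alg_closure"
    and L B P :: "'K alg_closure set"
    and D :: "('k::field, 'e::field) type_data"
    and \<iota> :: "'K \<Rightarrow> 'k"
    and \<iota>\<^sub>L :: "'K alg_closure \<Rightarrow> 'l::field"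
    and v\<^sub>L :: "'l \<Rightarrow> int"
    and j :: "'k \<Rightarrow> 'l"
    and F f\<^sub>k \<phi>\<^sub>k :: "'k poly"
    and t :: "('k, 'e) om_type"
    and S :: "(real \<times> real) set"
    and s h e ram :: nat
    and y H :: real
    and \<psi> :: "'e poly"
  assumes "dedekind_domain_of_fractions A"
    and "global_field TYPE('K)"
    and "f \<in> polys_over A" and "lead_coeff f = 1" and "irreducible_over A f"
    and "rsquarefree (map_poly to_ac f)" and "degree f > 1"
    and "poly (map_poly to_ac f) \<theta> = 0"
    and "L = generate_field ring_of_type_algebra (insert \<theta> (range to_ac))"
    and "B = integral_closure (to_ac ` A) L"
    \<comment> \<open>the prime \<open>p\<close> and the completion of \<open>K\<close> at \<open>p\<close>\<close>
    and "primeideal p (ring_on A)" and "p \<noteq> {0}"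
    and "\<pi> \<in> A" and "generates_max_ideal A p \<pi>"
    and "is_completion UNIV (prime_val A p) \<iota> (val0 D)"
    and "unif D = \<iota> \<pi>"
    and "reduction_map (val0 D) (red D)"
    and "f\<^sub>k = map_poly \<iota> f"
    \<comment> \<open>the type, its representative, and the side of the polygon\<close>
    and "is_type D t" and "type_dvd D t f\<^sub>k"
    and "\<phi>\<^sub>k = map_poly \<iota> \<phi>"
    and "is_representative D t \<phi>\<^sub>k"
    and "\<phi> \<in> polys_over A" and "type_phis t \<subseteq> map_poly \<iota> ` polys_over A"
    and "1 \<le> s" and "real s \<le> right_abscissa (neg_newton_polygon D t \<phi>\<^sub>k f\<^sub>k)"
    and "h > 0" and "e > 0" and "coprime h e"
    and "is_side (neg_newton_polygon D t \<phi>\<^sub>k f\<^sub>k) (slope h e) S"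
    and "left_abscissa S < real s" and "real s \<le> right_abscissa S"
    and "Q = f div \<phi> ^ s"
    and "(real s, y) \<in> neg_newton_polygon D t \<phi>\<^sub>k f\<^sub>k"
    and "H = (y - real s * of_int (type_val D t \<phi>\<^sub>k)) / real (type_eprod t)"
    and "lead_coeff \<psi> = 1" and "irreducible_over (type_field D t) \<psi>"
    and "\<psi> dvd slope_residual D t (type_residual D t) \<phi>\<^sub>k h e f\<^sub>k"
    \<comment> \<open>the prime \<open>P\<close> over \<open>p\<close>, the completion of \<open>L\<close> at \<open>P\<close> as an extension of that of \<open>K\<close>,
      and the local factor \<open>F\<close> of \<open>f\<close> corresponding to \<open>P\<close>\<close>
    and "primeideal P (ring_on B)" and "P \<inter> to_ac ` A = to_ac ` p"
    and "ram = ideal_exponent B P (to_ac ` p)"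
    and "is_completion L (prime_val B P) \<iota>\<^sub>L v\<^sub>L"
    and "j \<in> ring_hom ring_of_type_algebra ring_of_type_algebra"
    and "\<forall>x. j (\<iota> x) = \<iota>\<^sub>L (to_ac x)"
    and "\<forall>x. x \<noteq> 0 \<longrightarrow> v\<^sub>L (j x) = int ram * val0 D x"
    and "is_min_poly j (\<iota>\<^sub>L \<theta>) F"
    and "type_dvd D (Extend t \<phi>\<^sub>k h e \<psi>) F"
    and "right_abscissa S - real s < real (e * degree \<psi>)"
  shows "scaled_val ram (prime_val B P) (poly (map_poly to_ac Q) \<theta>) = ereal H"
proof -
  note P_def = assms(9) and compl = assms(15) and complL = assms(42) and minF = assms(46)
  have \<iota>: "\<iota> \<in> ring_hom (ring_on UNIV) ring_of_type_algebra" and valk: "discrete_valuation (val0 D)"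
    "complete_valuation (val0 D)" and val0_\<iota>: "\<And>x. x \<noteq> 0 \<Longrightarrow> val0 D (\<iota> x) = prime_val A p x"
    using compl by (auto simp: is_completion_def)
  interpret i: field_embedding \<iota>
    using \<iota> by unfold_locales (auto simp: ring_hom_def)
  interpret j: field_embedding j by (rule ring_hom_field_embedding) (rule assms(43))
  interpret dp: dedekind_prime A p \<pi>
    using assms(1,11,12,13,14) by (rule dedekind_prime.intro)
  interpret residue_data D
  proof
    show "discrete_valuation (val0 D)" by (rule valk)
    show "val0 D (unif D) = 1" using val0_\<iota>[OF dp.\<pi>_nonzero] dp.prime_val_generator assms(16) by simp
    show "unif D \<noteq> 0" using dp.\<pi>_nonzero assms(16) by (simp add: i.hom_eq_0_iff)
    show "reduction_map (val0 D) (red D)" by (rule assms(17))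
  qed
  interpret type_level D t \<phi>\<^sub>k h e
    using regular_type[OF assms(19)] assms(22,27,28,29) by unfold_locales
  have fk0: "f\<^sub>k \<noteq> 0" using assms(4,18) by (auto simp: i.hom_poly_eq_0_iff)
  have F0: "F \<noteq> 0" using minF by (auto simp: is_min_poly_def)
  \<comment> \<open>Division with remainder commutes with field embeddings, so the quotient formed
    over the completion is the image of \<open>Q\<close>.\<close>
  define Q' where "Q' = f\<^sub>k div \<phi>\<^sub>k ^ s"
  have Q': "Q' = map_poly \<iota> Q"
    by (simp add: Q'_def assms(18,21,33) i.hom_poly_div i.hom_poly_power)
  note quot = quotient_value[OF assms(37,36) fk0 assms(38,30,31,32,34,48) F0 assms(47), folded Q'_def]

  define \<alpha> where "\<alpha> = \<iota>\<^sub>L \<theta>"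
  have \<iota>L: "\<iota>\<^sub>L \<in> ring_hom (ring_on L) ring_of_type_algebra" and vL: "discrete_valuation v\<^sub>L"
    and vL_\<iota>: "\<And>x. x \<in> L \<Longrightarrow> x \<noteq> 0 \<Longrightarrow> v\<^sub>L (\<iota>\<^sub>L x) = prime_val B P x"
    and dense: "\<And>y N. \<exists>x\<in>L. val_ge v\<^sub>L N (y - \<iota>\<^sub>L x)"
    using complL by (auto simp: is_completion_def)
  note vL' = discrete_valuation_is_valuation[OF vL]
  note gf = generate_field.intros[where R = "ring_of_type_algebra :: 'K alg_closure ring" and H = "insert \<theta> (range to_ac)",
      folded P_def, simplified]
  have L1: "1 \<in> L" and L_add: "x \<in> L \<Longrightarrow> y \<in> L \<Longrightarrow> x + y \<in> L" and L_mult: "x \<in> L \<Longrightarrow> y \<in> L \<Longrightarrow> x * y \<in> L"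
    and L_\<theta>: "\<theta> \<in> L" and L_K: "to_ac a \<in> L" for x y a
    using gf by auto
  have \<iota>L_hom: "\<iota>\<^sub>L 1 = 1" "x \<in> L \<Longrightarrow> y \<in> L \<Longrightarrow> \<iota>\<^sub>L (x + y) = \<iota>\<^sub>L x + \<iota>\<^sub>L y"
    "x \<in> L \<Longrightarrow> y \<in> L \<Longrightarrow> \<iota>\<^sub>L (x * y) = \<iota>\<^sub>L x * \<iota>\<^sub>L y" for x y
    using \<iota>L by (auto simp: ring_hom_def)
  have L0: "0 \<in> L" using L_K[of 0] by simp
  have \<iota>L_0: "\<iota>\<^sub>L 0 = 0" using \<iota>L_hom(2)[OF L0 L0] by (metis add_0 add_cancel_right_right)
  \<comment> \<open>\<open>\<iota>\<^sub>L\<close> is a homomorphism on \<open>L\<close> only, so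
    membership of the value in \<open>L\<close> is carried along in the induction.\<close>
  have value_poly: "poly (map_poly to_ac g) \<theta> \<in> L \<and>
      \<iota>\<^sub>L (poly (map_poly to_ac g) \<theta>) = poly (map_poly j (map_poly \<iota> g)) \<alpha>" for g
  proof (induction g)
    case 0
    then show ?case using L0 \<iota>L_0 by simp
  next
    case (pCons a g)
    then show ?case
      using L_add[OF L_K[of a] L_mult[OF L_\<theta>, of "poly (map_poly to_ac g) \<theta>"]]
        \<iota>L_hom(2)[OF L_K[of a] L_mult[OF L_\<theta>, of "poly (map_poly to_ac g) \<theta>"]]
        \<iota>L_hom(3)[OF L_\<theta>, of "poly (map_poly to_ac g) \<theta>"] assms(44)
      by (simp add: map_poly_pCons i.hom_0 j.hom_0 \<alpha>_def)
  qed
  have minF': "is_min_poly j \<alpha> F" using minF by (simp add: \<alpha>_def)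
  note irrF = j.irreducible_over_min_poly[OF minF']

  \<comment> \<open>If \<open>ram\<close> were 0, \<open>v\<^sub>L\<close> would be trivial on the
    image of \<open>'k\<close>, hence on its extension by \<open>\<alpha>\<close>, which contains
    the image of \<open>L\<close>; but that image is dense for \<open>v\<^sub>L\<close>, and
    \<open>v\<^sub>L\<close> takes the value 1.\<close>
  have ram: "ram > 0"
  proof (rule ccontr)
    assume "\<not> ram > 0"
    then have triv: "v\<^sub>L (j x) = 0" if "x \<noteq> 0" for x using assms(45) that by simp
    let ?M = "{poly (map_poly j g) \<alpha> | g. True}"
    note M = j.is_subfield_simple_extension[OF minF']
    have "x \<in> L \<and> \<iota>\<^sub>L x \<in> ?M" if "x \<in> L" for x
      using that[unfolded P_def]
    proof (induction rule: generate_field.induct)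
      case one
      then show ?case using L1 \<iota>L_hom(1) subfield_1[OF M] by simp
    next
      case (incl x)
      moreover have "\<alpha> = poly (map_poly j [:0, 1:]) \<alpha>" by (simp add: map_poly_pCons j.hom_0 j.hom_1)
      then have "\<alpha> \<in> ?M" by blast
      moreover have "\<iota>\<^sub>L (to_ac a) \<in> ?M" for a
      proof -
        have "\<iota>\<^sub>L (to_ac a) = poly (map_poly j [:\<iota> a:]) \<alpha>" using assms(44) by (simp add: map_poly_pCons j.hom_0)
        then show ?thesis by blast
      qed
      ultimately show ?case using L_\<theta> L_K by (auto simp: \<alpha>_def)
    next
      case (a_inv x)
      have neg: "\<ominus>\<^bsub>ring_of_type_algebra\<^esub> x = - x"
      proof -
        interpret R: ring "ring_of_type_algebra :: 'K alg_closure ring" by (rule ring_from_type_algebra)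
        show ?thesis by (rule R.minus_equality) simp_all
      qed
      have mx: "- x \<in> L" using L_mult[OF L_K[of "- 1"], of x] a_inv.IH by simp
      have "\<iota>\<^sub>L x + \<iota>\<^sub>L (- x) = 0" using \<iota>L_hom(2)[of x "- x"] mx a_inv.IH \<iota>L_0 by simp
      then have "\<iota>\<^sub>L (- x) = - \<iota>\<^sub>L x" by (simp add: eq_neg_iff_add_eq_0 add.commute)
      then show ?case unfolding neg using mx subfield_uminus[OF M] a_inv.IH by simp
    next
      case (m_inv x)
      have x0: "x \<noteq> 0" using m_inv.hyps by simp
      have inv: "inv\<^bsub>ring_of_type_algebra\<^esub> x = inverse x"
      proof -
        interpret R: field "ring_of_type_algebra :: 'K alg_closure ring" by (rule field_from_type_algebra)
        show ?thesis using x0 by (intro R.comm_inv_char) simp_all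
      qed
      have mx: "inverse x \<in> L" using gf(4)[of x] m_inv.IH x0 by (simp add: inv)
      have "\<iota>\<^sub>L x * \<iota>\<^sub>L (inverse x) = 1" using \<iota>L_hom(3)[of x "inverse x"] mx m_inv.IH \<iota>L_hom(1) x0 by simp
      then have "\<iota>\<^sub>L (inverse x) = inverse (\<iota>\<^sub>L x)" by (rule inverse_unique[symmetric])
      then show ?case unfolding inv using mx subfield_inverse[OF M] m_inv.IH by simp
    next
      case (eng_add x y)
      then show ?case using L_add \<iota>L_hom(2) subfield_add[OF M] by simp
    next
      case (eng_mult x y)
      then show ?case using L_mult \<iota>L_hom(3) subfield_mult[OF M] by simp
    qed
    then have LM: "\<iota>\<^sub>L x \<in> ?M" if "x \<in> L" for x using that by blast
    obtain y where y: "y \<noteq> 0" "v\<^sub>L y = 1" using vL by (auto simp: discrete_valuation_def)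
    \<comment> \<open>Precision 2 exceeds the value 1 of \<open>y\<close>, so the approximation is
      non-zero and of positive value.\<close>
    obtain x where x: "x \<in> L" "val_ge v\<^sub>L 2 (y - \<iota>\<^sub>L x)" using dense by blast
    have nz: "\<iota>\<^sub>L x \<noteq> 0" using x(2) y by (auto simp: val_ge_def)
    have "val_ge v\<^sub>L 1 y" using y(2) by (simp add: val_ge_def)
    moreover have "val_ge v\<^sub>L 1 (y - \<iota>\<^sub>L x)" using x(2) by (rule val_ge_mono) simp
    ultimately have "val_ge v\<^sub>L 1 (y - (y - \<iota>\<^sub>L x))" by (rule val_ge_diff[OF vL'])
    then have "1 \<le> v\<^sub>L (\<iota>\<^sub>L x)" using nz by (simp add: val_ge_def)
    with j.valuation_trivial_on_extension[OF vL' triv minF' LM[OF x(1)] nz] show False by simp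
  qed

  define w where "w g = v\<^sub>L (poly (map_poly j g) \<alpha>)" for g
  have W: "F dvd a \<or> n \<le> w a \<longleftrightarrow> val_ge v\<^sub>L n (poly (map_poly j a) \<alpha>)" for a n
    by (simp add: irrF(2) w_def val_ge_def)
  have E: "int (type_eprod t) * int e > 0" using reg e_pos by (simp add: regular_def)
  have w_mult: "w (a * b) = w a + w b" if "\<not> F dvd a" "\<not> F dvd b" for a b
    using that valuation_mult[OF vL'] by (simp add: irrF(2) w_def j.hom_poly_mult)
  have w_add: "F dvd a + b \<or> n \<le> w (a + b)" if "F dvd a \<or> n \<le> w a" "F dvd b \<or> n \<le> w b" for a b n
    using that val_ge_add[OF vL'] unfolding W by (simp add: j.hom_poly_add)
  have w_const: "w [:c:] = int ram * val0 D c" if "c \<noteq> 0" for c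
    using that assms(45) by (simp add: w_def map_poly_pCons j.hom_0)
  have "int ram > 0" using ram by simp
  note spec = spectral_comparison[OF valk aug_valuation aug_const E irrF(1) w_mult w_add w_const this quot(1,3)]
  let ?x = "poly (map_poly to_ac Q) \<theta>"
  have xL: "?x \<in> L" and \<iota>x: "\<iota>\<^sub>L ?x = poly (map_poly j Q') \<alpha>" using value_poly[of Q] by (simp_all add: Q')
  have x0: "?x \<noteq> 0" using spec(1) \<iota>L_0 \<iota>x by (auto simp: irrF(2))
  have wx: "prime_val B P ?x = w Q'" using vL_\<iota>[OF xL x0] by (simp add: \<iota>x w_def)
  have e0: "real e > 0" "real (type_eprod t) > 0" using reg e_pos by (simp_all add: regular_def)
  have "real ram * (y - real s * of_int (type_val D t \<phi>\<^sub>k)) = real (type_eprod t) * real_of_int (w Q')"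
  proof -
    \<comment> \<open>Both sides carry the factor \<open>e\<close>: on the left from
      \<open>aug Q'\<close>, on the right from \<open>E\<close>. It is cancelled afterwards.\<close>
    have "real e * (real ram * (y - real s * of_int (type_val D t \<phi>\<^sub>k))) = real ram * real_of_int (aug Q')"
      by (simp add: quot(2))
    also have "\<dots> = real e * (real (type_eprod t) * real_of_int (w Q'))"
      using arg_cong[OF spec(2), of real_of_int] by simp
    finally show ?thesis using e0 by (simp only: mult_cancel_left) simp
  qed
  then have "real_of_int (w Q') / real ram = H"
    using e0 ram unfolding assms(35) by (subst frac_eq_eq) (simp_all add: mult.commute)
  with x0 show ?thesis by (simp add: scaled_val_def wx)
qed

end
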